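(* Let $\Omega=\{x_1,\dots,x_n\}$ be a finite set and $\mathcal{P}_n^\times$ the exponential family of nowhere vanishing probabilities on $\Omega$. Let $\tau:T\mathcal{P}_n^\times\to\mathbb{P}(\mathbb{C}^n)^\times$ be the universal covering map $[u]_p\mapsto[\sqrt{p_1}e^{iu_1/2},\dots,\sqrt{p_n}e^{iu_n/2}]$. Then the group $\Gamma(\mathcal{P}_n^\times)$ coincides with the deck transformation group of $\tau$. In particular, if both the Fubini–Study metric $g_{FS}$ and the Fubini–Study symplectic form $\omega_{FS}$ are multiplied by $4$, then one gets a natural identification (induced by $\tau$) of Kähler manifolds $$(\mathcal{P}_n^\times)^{\mathbb{C}}\cong\mathbb{P}(\mathbb{C}^n)^\times .$$ Moreover, in terms of this identification, the canonical projection $\pi_{\mathcal{P}_n^\times}:(\mathcal{P}_n^\times)^{\mathbb{C}}\to\mathcal{P}_n^\times$ becomes $$\pi_{\mathcal{P}_n^\times}:\mathbb{P}(\mathbb{C}^n)^\times\to\mathcal{P}_n^\times,\qquad \pi_{\mathcal{P}_n^\times}([z])(x_k)=\frac{z_k\overline{z_k}}{\langle z,z\rangle}.$$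
   Context: $\mathcal{P}_n^\times:=\{p:\Omega\to\mathbb{R}\mid p(x_i)>0\ \forall i,\ \sum_ip(x_i)=1\}$; write $p_i=p(x_i)$. It is an $(n-1)$-dimensional manifold and an exponential family: $p(x;\theta)=\exp\{\sum_{i=1}^{n-1}\theta_iF_i(x)-\psi(\theta)\}$ with $F_i(x_j)=\delta_{ij}$, $\theta\in\mathbb{R}^{n-1}$ and $\psi$ the normalization. Tangent vectors at $p$ are described by the exponential representation: for $u\in\mathbb{R}^n$ with $\sum_iu_ip_i=0$, $[u]_p\in T_p\mathcal{P}_n^\times$ denotes the tangent vector such that $\frac{d}{dt}|_0p(t)=[u]_{p(0)}$ iff $\frac{d}{dt}|_0p_i(t)=p_i(0)u_i$ for all $i$. The Fisher metric is $(h_F)_p([u]_p,[v]_p)=\sum_ip_iu_iv_i$, and the exponential connection $\nabla^{(e)}$ has covariant derivative $\frac{D^{(e)}}{dt}[V(t)]_{p(t)}=[\dot V(t)-E_{p(t)}(\dot V(t))]_{p(t)}$, with $E_p(W)=\sum_ip_iW_i$ (regarded as a constant vector); it is flat with affine chart $\theta$. **Kähler structure of $T\mathcal{E}$** ($\mathcal{E}=\mathcal{P}_n^\times$, $h=h_F$, $\nabla=\nabla^{(e)}$). Let $\pi:T\mathcal{E}\to\mathcal{E}$ be the projection and $K:T(T\mathcal{E})\to T\mathcal{E}$ the connector of $\nabla$; identify $A\in T_{u_x}T\mathcal{E}$ with $(u_x,v_x,w_x)$, $v_x=\pi_*A$, $w_x=KA$. Set $g((u,v,w),(u,\bar v,\bar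 w))=h(v,\bar v)+h(w,\bar w)$, $\omega((u,v,w),(u,\bar v,\bar w))=h(v,\bar w)-h(w,\bar v)$, $J(u,v,w)=(u,-w,v)$. This is Kähler. **Kähler functions.** On a Kähler manifold $(N,g,J,\omega)$, $\mathscr{K}(N)$ is the space of smooth $f:N\to\mathbb{R}$ with $\mathscr{L}_{X_f}g=0$, where $\omega(X_f,\cdot)=df$. **$\Gamma(\mathcal{E})$ and Kählerification.** $\Gamma(\mathcal{E})$ is the group of diffeomorphisms $\phi$ of $T\mathcal{E}$ with $\phi^*g=g$, $\phi_*J=J\phi_*$ and $f\circ\phi=f$ for all $f\in\mathscr{K}(T\mathcal{E})$. When $\Gamma(\mathcal{E})$ is discrete and acts freely and properly on $T\mathcal{E}$, the Kählerification is $\mathcal{E}^{\mathbb{C}}:=T\mathcal{E}/\Gamma(\mathcal{E})$ with the quotient Kähler structure. Every $\gamma\in\Gamma(\mathcal{E})$ satisfies $\pi\circ\gamma=\pi$, so $\pi$ induces the canonical projection $\pi_{\mathcal{E}}:\mathcal{E}^{\mathbb{C}}\to\mathcal{E}$. **Projective space.** $\mathbb{P}(\mathbb{C}^n)$ is the space of complex lines in $\mathbb{C}^n$, $[z]=[z_1,\dots,z_n]$ the line through $z\ne0$, $\langle\cdot,\cdot\rangle$ the Hermitian product on $\mathbb{C}^n$, linear in the second argument, and $\mathbb{P}(\mathbb{C}^n)^\times=\{[z]\mid z_i\neq0\ \forall i\}$. For a unit vector $u$, the chart $[z]\mapsto\frac{1}{\langle u,z\rangle}z-u\in[u]^\perp$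 identifies $T_{[u]}\mathbb{P}(\mathbb{C}^n)$ with $[u]^\perp$, and under this identification $g_{FS}(\xi_1,\xi_2)=\mathrm{Re}\langle\xi_1,\xi_2\rangle$, $\omega_{FS}(\xi_1,\xi_2)=\mathrm{Im}\langle\xi_1,\xi_2\rangle$; the complex structure is the natural one. *)

theory Defs
  imports "HOL-Analysis.Analysis" "HOL-Algebra.Bij"
begin

section \<open>Smooth manifolds\<close>

text \<open>
  \<open>S\<close> is a relatively open subset of the linear subspace \<open>W\<close>; \<open>f\<close> is of class \<open>C\<^sup>k\<close> on \<open>S\<close> iff all
  iterated directional derivatives of order at most \<open>k\<close>, in directions from \<open>W\<close>, exist and are
  continuous.
\<close>

primrec Ck_on ::
  "'e::real_normed_vector set \<Rightarrow> nat \<Rightarrow> 'e set \<Rightarrow> ('e \<Rightarrow> 'f::real_normed_vector) \<Rightarrow> bool"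
where
  "Ck_on W 0 S f \<longleftrightarrow> continuous_on S f"
| "Ck_on W (Suc k) S f \<longleftrightarrow>
     (\<forall>v\<in>W. \<exists>f'. (\<forall>x\<in>S. ((\<lambda>t. f (x + t *\<^sub>R v)) has_vector_derivative f' x) (at 0))
                 \<and> Ck_on W k S f')"

definition smooth_on ::
  "'e::real_normed_vector set \<Rightarrow> 'e set \<Rightarrow> ('e \<Rightarrow> 'f::real_normed_vector) \<Rightarrow> bool" where
  "smooth_on W S f \<longleftrightarrow> (\<forall>k. Ck_on W k S f)"

text \<open>
  A chart is a triple \<open>(U, \<phi>, W)\<close>: \<open>\<phi>\<close> maps its domain \<open>U\<close> bijectively onto a relatively open subset
  of the linear subspace \<open>W\<close>.  Working with subspaces of a Euclidean space allows model spaces such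
  as \<open>\<real>\<^sup>n\<^sup>-\<^sup>1\<close>, or an orthogonal complement, that are not types.
\<close>

type_synonym ('a, 'e) chart = "'a set \<times> ('a \<Rightarrow> 'e) \<times> 'e set"

record ('a, 'e) manifold =
  points :: "'a set"
  charts :: "('a, 'e) chart set"

definition smooth_fun ::
  "('a, 'e::real_normed_vector, 'm) manifold_scheme \<Rightarrow> ('a \<Rightarrow> real) \<Rightarrow> bool" where
  "smooth_fun M f \<longleftrightarrow> (\<forall>(U, \<phi>, W)\<in>charts M. smooth_on W (\<phi> ` U) (f \<circ> inv_into U \<phi>))"

text \<open>Openness of the coordinate domains below is what makes \<open>f\<close> continuous.\<close>

definition smooth_map ::
  "('a, 'e::real_normed_vector, 'm) manifold_scheme
   \<Rightarrow> ('b, 'f::real_normed_vector, 'l) manifold_scheme \<Rightarrow> ('a \<Rightarrow> 'b) \<Rightarrow> bool" where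
  "smooth_map M M' f \<longleftrightarrow>
     f ` points M \<subseteq> points M' \<and>
     (\<forall>(U, \<phi>, W)\<in>charts M. \<forall>(U', \<phi>', W')\<in>charts M'.
        openin (top_of_set W) (\<phi> ` (U \<inter> f -` U')) \<and>
        smooth_on W (\<phi> ` (U \<inter> f -` U')) (\<phi>' \<circ> f \<circ> inv_into U \<phi>))"

definition diffeo ::
  "('a, 'e::real_normed_vector, 'm) manifold_scheme
   \<Rightarrow> ('b, 'f::real_normed_vector, 'l) manifold_scheme \<Rightarrow> ('a \<Rightarrow> 'b) \<Rightarrow> bool" where
  "diffeo M M' f \<longleftrightarrow>
     bij_betw f (points M) (points M') \<and> smooth_map M M' f \<and>
     smooth_map M' M (inv_into (points M) f)"


subsection \<open>Tangent vectors\<close>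

text \<open>
  A tangent vector at \<open>x\<close> is an equivalence class of curves through \<open>x\<close> that are smooth near time 0,
  two curves being equivalent iff they have the same velocity at time 0 in the charts around \<open>x\<close>.
\<close>

type_synonym 'a tangent = "(real \<Rightarrow> 'a) set"

definition smooth_curve ::
  "('a, 'e::real_normed_vector, 'm) manifold_scheme \<Rightarrow> (real \<Rightarrow> 'a) \<Rightarrow> bool" where
  "smooth_curve M c \<longleftrightarrow>
     (\<exists>(U, \<phi>, W)\<in>charts M. \<exists>\<epsilon>>0.
        c ` {-\<epsilon><..<\<epsilon>} \<subseteq> U \<and> smooth_on UNIV {-\<epsilon><..<\<epsilon>} (\<phi> \<circ> c))"

definition velocity ::
  "('a, 'e::real_normed_vector, 'm) manifold_scheme \<Rightarrow> (real \<Rightarrow> 'a) \<Rightarrow> 'a tangent" where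
  "velocity M c =
     {c'. smooth_curve M c' \<and> c' 0 = c 0 \<and>
          (\<forall>(U, \<phi>, W)\<in>charts M. c 0 \<in> U \<longrightarrow>
             vector_derivative (\<phi> \<circ> c') (at 0) = vector_derivative (\<phi> \<circ> c) (at 0))}"

definition tangent_space ::
  "('a, 'e::real_normed_vector, 'm) manifold_scheme \<Rightarrow> 'a \<Rightarrow> 'a tangent set" where
  "tangent_space M x = {velocity M c |c. smooth_curve M c \<and> c 0 = x}"

definition curve_of :: "'a tangent \<Rightarrow> real \<Rightarrow> 'a" where
  "curve_of X = (SOME c. c \<in> X)"

definition base_point :: "'a tangent \<Rightarrow> 'a" where
  "base_point X = curve_of X 0"

definition pushforward ::
  "('b, 'f::real_normed_vector, 'l) manifold_scheme \<Rightarrow> ('a \<Rightarrow> 'b) \<Rightarrow> 'a tangent \<Rightarrow> 'b tangent" where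
  "pushforward M' f X = velocity M' (f \<circ> curve_of X)"

text \<open>Used for real functions on the manifold and for vector-valued chart maps.\<close>

definition differential :: "('a \<Rightarrow> 'f::real_normed_vector) \<Rightarrow> 'a tangent \<Rightarrow> 'f" where
  "differential f X = vector_derivative (f \<circ> curve_of X) (at 0)"

definition coord_vec ::
  "('a, 'e::real_normed_vector, 'm) manifold_scheme \<Rightarrow> ('a, 'e) chart \<Rightarrow> 'e \<Rightarrow> 'e \<Rightarrow> 'a tangent" where
  "coord_vec M = (\<lambda>(U, \<phi>, W) y v. velocity M (\<lambda>t. inv_into U \<phi> (y + t *\<^sub>R v)))"

text \<open>
  Coordinate expression of \<open>(\<L>\<^sub>X g)(v, w)\<close> at \<open>y\<close>: it is
  \<open>X(g(V,W)) - g([X,V], W) - g(V, [X,W])\<close> for the coordinate fields \<open>V, W\<close> with constant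
  components \<open>v, w\<close>, for which \<open>[X,V]\<close> has components \<open>- DX(y) v\<close>.
\<close>

definition lie_derivative_coord ::
  "('a, 'e::real_normed_vector, 'm) manifold_scheme \<Rightarrow> ('a, 'e) chart
   \<Rightarrow> ('a \<Rightarrow> 'a tangent) \<Rightarrow> ('a tangent \<Rightarrow> 'a tangent \<Rightarrow> real) \<Rightarrow> 'e \<Rightarrow> 'e \<Rightarrow> 'e \<Rightarrow> real" where
  "lie_derivative_coord M = (\<lambda>(U, \<phi>, W) X g y v w.
     let G = (\<lambda>y v w. g (coord_vec M (U, \<phi>, W) y v) (coord_vec M (U, \<phi>, W) y w));
         \<xi> = (\<lambda>y. differential \<phi> (X (inv_into U \<phi> y)))
     in vector_derivative (\<lambda>t. G (y + t *\<^sub>R \<xi> y) v w) (at 0)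
        + G y (vector_derivative (\<lambda>t. \<xi> (y + t *\<^sub>R v)) (at 0)) w
        + G y v (vector_derivative (\<lambda>t. \<xi> (y + t *\<^sub>R w)) (at 0)))"

definition lie_derivative_vanishes ::
  "('a, 'e::real_normed_vector, 'm) manifold_scheme
   \<Rightarrow> ('a \<Rightarrow> 'a tangent) \<Rightarrow> ('a tangent \<Rightarrow> 'a tangent \<Rightarrow> real) \<Rightarrow> bool" where
  "lie_derivative_vanishes M X g \<longleftrightarrow>
     (\<forall>(U, \<phi>, W)\<in>charts M. \<forall>y\<in>\<phi> ` U. \<forall>v\<in>W. \<forall>w\<in>W.
        lie_derivative_coord M (U, \<phi>, W) X g y v w = 0)"


section \<open>Kaehler structures\<close>

text \<open>The record only collects the data \<open>(g, \<omega>, J)\<close>; the tensor fields are meaningful only on tangent vectors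
  with a common base point.\<close>

record ('a, 'e) kahler = "('a, 'e) manifold" +
  metric :: "'a tangent \<Rightarrow> 'a tangent \<Rightarrow> real"
  symp :: "'a tangent \<Rightarrow> 'a tangent \<Rightarrow> real"
  cplx :: "'a tangent \<Rightarrow> 'a tangent"

definition kahler_functions :: "('a, 'e::real_normed_vector) kahler \<Rightarrow> ('a \<Rightarrow> real) set" where
  "kahler_functions M =
     {f. smooth_fun M f \<and>
         (\<exists>X. (\<forall>x\<in>points M. X x \<in> tangent_space M x \<and>
                 (\<forall>Y\<in>tangent_space M x. symp M (X x) Y = differential f Y)) \<and>
              lie_derivative_vanishes M X (metric M))}"

definition kahler_iso ::
  "('a, 'e::real_normed_vector) kahler \<Rightarrow> ('b, 'f::real_normed_vector) kahler \<Rightarrow> ('a \<Rightarrow> 'b) \<Rightarrow> bool"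
where
  "kahler_iso M M' f \<longleftrightarrow>
     diffeo M M' f \<and>
     (\<forall>x\<in>points M. \<forall>X\<in>tangent_space M x. \<forall>Y\<in>tangent_space M x.
        metric M' (pushforward M' f X) (pushforward M' f Y) = metric M X Y \<and>
        symp M' (pushforward M' f X) (pushforward M' f Y) = symp M X Y) \<and>
     (\<forall>x\<in>points M. \<forall>X\<in>tangent_space M x.
        pushforward M' f (cplx M X) = cplx M' (pushforward M' f X))"

definition rescale :: "real \<Rightarrow> ('a, 'e) kahler \<Rightarrow> ('a, 'e) kahler" where
  "rescale r M = M\<lparr>metric := (\<lambda>X Y. r * metric M X Y), symp := (\<lambda>X Y. r * symp M X Y)\<rparr>"

definition open_submanifold :: "('a, 'e) kahler \<Rightarrow> 'a set \<Rightarrow> ('a, 'e) kahler" where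
  "open_submanifold M S =
     M\<lparr>points := points M \<inter> S, charts := (\<lambda>(U, \<phi>, W). (U \<inter> S, \<phi>, W)) ` charts M\<rparr>"

text \<open>
  The group \<open>\<Gamma>\<close>, as a set of extensional functions; its group structure is that of \<^const>\<open>BijGroup\<close>.
\<close>

definition Gamma_group :: "('a, 'e::real_normed_vector) kahler \<Rightarrow> ('a \<Rightarrow> 'a) set" where
  "Gamma_group M =
     {\<phi> \<in> extensional (points M).
        diffeo M M \<phi> \<and>
        (\<forall>x\<in>points M. \<forall>X\<in>tangent_space M x. \<forall>Y\<in>tangent_space M x.
           metric M (pushforward M \<phi> X) (pushforward M \<phi> Y) = metric M X Y) \<and>
        (\<forall>x\<in>points M. \<forall>X\<in>tangent_space M x.
           pushforward M \<phi> (cplx M X) = cplx M (pushforward M \<phi> X)) \<and>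
        (\<forall>f\<in>kahler_functions M. \<forall>x\<in>points M. f (\<phi> x) = f x)}"


subsection \<open>Quotients by group actions\<close>

definition compact_open_topology ::
  "'a::topological_space set \<Rightarrow> ('a \<Rightarrow> 'a) set \<Rightarrow> ('a \<Rightarrow> 'a) topology" where
  "compact_open_topology S G =
     topology_generated_by
       {{\<gamma>\<in>G. \<gamma> ` C \<subseteq> V} |C V. compact C \<and> C \<subseteq> S \<and> openin (top_of_set S) V}"

definition discrete_group :: "'a::topological_space set \<Rightarrow> ('a \<Rightarrow> 'a) set \<Rightarrow> bool" where
  "discrete_group S G \<longleftrightarrow> compact_open_topology S G = discrete_topology G"

definition acts_freely :: "'a set \<Rightarrow> ('a \<Rightarrow> 'a) set \<Rightarrow> bool" where
  "acts_freely S G \<longleftrightarrow> (\<forall>\<gamma>\<in>G. (\<exists>x\<in>S. \<gamma> x = x) \<longrightarrow> (\<forall>x\<in>S. \<gamma> x = x))"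

definition acts_properly :: "'a::topological_space set \<Rightarrow> ('a \<Rightarrow> 'a) set \<Rightarrow> bool" where
  "acts_properly S G \<longleftrightarrow>
     proper_map (prod_topology (compact_open_topology S G) (top_of_set S))
                (prod_topology (top_of_set S) (top_of_set S))
                (\<lambda>(\<gamma>, x). (\<gamma> x, x))"

definition orbit_of :: "('a \<Rightarrow> 'a) set \<Rightarrow> 'a \<Rightarrow> 'a set" where
  "orbit_of G x = {\<gamma> x |\<gamma>. \<gamma> \<in> G}"

text \<open>
  Quotient of \<open>M\<close> by a discrete group acting freely and properly by structure-preserving maps.
  Its charts are charts of \<open>M\<close> composed with local inverses of the quotient map, and its tensors are
  evaluated on lifts of the arguments to a common point of \<open>M\<close>.
\<close>

definition quotient_kahler ::
  "('a, 'e::real_normed_vector) kahler \<Rightarrow> ('a \<Rightarrow> 'a) set \<Rightarrow> ('a set, 'e) kahler" where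
  "quotient_kahler M G =
     (let q = orbit_of G;
          Q = \<lparr>points = q ` points M,
               charts = {(q ` U, \<phi> \<circ> inv_into U q, W) |U U' \<phi> W.
                  (U', \<phi>, W) \<in> charts M \<and> U \<subseteq> U' \<and> openin (top_of_set W) (\<phi> ` U) \<and> inj_on q U}\<rparr>;
          descend = (\<lambda>b X Y. THE r. \<exists>x\<in>points M. \<exists>A\<in>tangent_space M x. \<exists>B\<in>tangent_space M x.
             pushforward Q q A = X \<and> pushforward Q q B = Y \<and> r = b A B)
      in \<lparr>points = points Q, charts = charts Q,
          metric = descend (metric M), symp = descend (symp M),
          cplx = (\<lambda>X. THE Y. \<exists>x\<in>points M. \<exists>A\<in>tangent_space M x.
             pushforward Q q A = X \<and> Y = pushforward Q q (cplx M A))\<rparr>)"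

definition kahlerification :: "('a, 'e::real_normed_vector) kahler \<Rightarrow> ('a set, 'e) kahler" where
  "kahlerification M = quotient_kahler M (Gamma_group M)"

definition deck_group ::
  "'a::topological_space set \<Rightarrow> ('a \<Rightarrow> 'b) \<Rightarrow> ('a \<Rightarrow> 'a) set" where
  "deck_group S p =
     {\<phi> \<in> extensional S. (\<exists>\<psi>. homeomorphism S S \<phi> \<psi>) \<and> (\<forall>x\<in>S. p (\<phi> x) = p x)}"


section \<open>The tangent bundle of the family of nowhere vanishing probabilities\<close>

text \<open>
  The finite sample space is the index type \<open>'n\<close>, and \<open>(p, u)\<close> stands for the tangent vector \<open>[u]\<^sub>p\<close>
  in exponential representation.
\<close>

definition prob_pos :: "(real^'n) set" where
  "prob_pos = {p. (\<forall>i. 0 < p $ i) \<and> (\<Sum>i\<in>UNIV. p $ i) = 1}"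

type_synonym 'n tvec = "(real^'n) \<times> (real^'n)"

definition TP :: "'n::finite tvec set" where
  "TP = {(p, u). p \<in> prob_pos \<and> (\<Sum>i\<in>UNIV. u $ i * p $ i) = 0}"

definition fisher :: "real^'n \<Rightarrow> real^'n \<Rightarrow> real^'n \<Rightarrow> real" where
  "fisher p u v = (\<Sum>i\<in>UNIV. p $ i * u $ i * v $ i)"

definition expect :: "real^'n \<Rightarrow> real^'n \<Rightarrow> real" where
  "expect p W = (\<Sum>i\<in>UNIV. p $ i * W $ i)"

text \<open>
  With \<open>x\<^sub>k\<close> as reference point, \<open>p(x; \<theta>) = exp (\<Sum>\<^sub>i\<^sub>\<noteq>\<^sub>k \<theta>\<^sub>i F\<^sub>i(x) - \<psi>(\<theta>))\<close> gives
  \<open>\<theta>\<^sub>i = ln (p\<^sub>i / p\<^sub>k)\<close>, and the coordinates of \<open>[u]\<^sub>p\<close> are \<open>u\<^sub>i - u\<^sub>k\<close>; the \<open>k\<close>-th coordinates vanish.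
\<close>

definition theta_chart :: "'n::finite \<Rightarrow> ('n tvec, 'n tvec) chart" where
  "theta_chart k =
     (TP, \<lambda>(p, u). (\<chi> i. ln (p $ i / p $ k), \<chi> i. u $ i - u $ k),
      {(a, b). a $ k = 0 \<and> b $ k = 0})"

definition TP_manifold :: "('n::finite tvec, 'n tvec) manifold" where
  "TP_manifold = \<lparr>points = TP, charts = range theta_chart\<rparr>"

text \<open>
  For \<open>A\<close> the velocity at 0 of \<open>t \<mapsto> [V(t)]\<^bsub>p(t)\<^esub>\<close>, the following are the exponential
  representations of \<open>\<pi>\<^sub>* A\<close>, the velocity of \<open>p(t)\<close>, and of \<open>K A\<close>, the covariant derivative of
  \<open>[V(t)]\<^bsub>p(t)\<^esub>\<close> with respect to the exponential connection.
\<close>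

definition proj_push :: "'n::finite tvec tangent \<Rightarrow> real^'n" where
  "proj_push A = (\<chi> i. vector_derivative (\<lambda>t. fst (curve_of A t) $ i) (at 0) / fst (base_point A) $ i)"

definition connector :: "'n::finite tvec tangent \<Rightarrow> real^'n" where
  "connector A =
     (let V' = vector_derivative (\<lambda>t. snd (curve_of A t)) (at 0)
      in V' - (\<chi> i. expect (fst (base_point A)) V'))"

definition TP_kahler :: "('n::finite tvec, 'n tvec) kahler" where
  "TP_kahler =
     \<lparr>points = points TP_manifold, charts = charts TP_manifold,
      metric = (\<lambda>A B. let p = fst (base_point A) in
        fisher p (proj_push A) (proj_push B) + fisher p (connector A) (connector B)),
      symp = (\<lambda>A B. let p = fst (base_point A) in
        fisher p (proj_push A) (connector B) - fisher p (connector A) (proj_push B)),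
      cplx = (\<lambda>A. THE B. B \<in> tangent_space TP_manifold (base_point A) \<and>
        proj_push B = - connector A \<and> connector B = proj_push A)\<rparr>"

text \<open>The projection of an orbit: the common base point of its elements.\<close>

definition canonical_proj :: "'n::finite tvec set \<Rightarrow> real^'n" where
  "canonical_proj O' = the_elem (fst ` O')"


section \<open>Complex projective space\<close>

typedef (overloaded) ('n::finite) cproj = "{vec.span {z} |z :: complex^'n. z \<noteq> 0}"
proof -
  have "(\<chi> i. 1) \<noteq> (0 :: complex^'n)"
    by (simp add: vec_eq_iff)
  then show ?thesis
    by blast
qed

text \<open>The point \<open>[z]\<close>, for \<open>z \<noteq> 0\<close>.\<close>

definition line :: "complex^'n \<Rightarrow> 'n cproj" where
  "line z = Abs_cproj (vec.span {z})"

instantiation cproj :: (finite) topological_space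
begin

definition open_cproj :: "'a cproj set \<Rightarrow> bool" where
  "open_cproj S \<longleftrightarrow> open {z. z \<noteq> 0 \<and> line z \<in> S}"

instance
proof
  have "{z :: complex^'a. z \<noteq> 0} = - {0}"
    by auto
  then show "open (UNIV :: 'a cproj set)"
    by (simp add: open_cproj_def open_Compl)
next
  fix S T :: "'a cproj set"
  assume "open S" "open T"
  moreover have "{z. z \<noteq> 0 \<and> line z \<in> S \<inter> T}
      = {z. z \<noteq> 0 \<and> line z \<in> S} \<inter> {z. z \<noteq> 0 \<and> line z \<in> T}"
    by auto
  ultimately show "open (S \<inter> T)"
    by (simp only: open_cproj_def open_Int)
next
  fix \<K> :: "'a cproj set set"
  assume "\<forall>S\<in>\<K>. open S"
  moreover have "{z. z \<noteq> 0 \<and> line z \<in> \<Union>\<K>} = (\<Union>S\<in>\<K>. {z. z \<noteq> 0 \<and> line z \<in> S})"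
    by auto
  ultimately show "open (\<Union>\<K>)"
    by (simp only: open_cproj_def) (rule open_UN, blast)
qed

end

definition herm :: "complex^'n \<Rightarrow> complex^'n \<Rightarrow> complex" where
  "herm z w = (\<Sum>i\<in>UNIV. cnj (z $ i) * w $ i)"

definition unit_chart_map :: "complex^'n \<Rightarrow> 'n cproj \<Rightarrow> complex^'n" where
  "unit_chart_map u L =
     (let z = (SOME z. z \<noteq> 0 \<and> line z = L) in (1 / herm u z) *s z - u)"

definition unit_chart :: "complex^'n \<Rightarrow> ('n cproj, complex^'n) chart" where
  "unit_chart u =
     ({line z |z. herm u z \<noteq> 0}, unit_chart_map u, {\<xi>. herm u \<xi> = 0})"

definition cproj_manifold :: "('n::finite cproj, complex^'n) manifold" where
  "cproj_manifold = \<lparr>points = UNIV, charts = {unit_chart u |u. norm u = 1}\<rparr>"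

text \<open>
  The identification of the tangent space at \<open>[u]\<close> with the orthogonal complement of \<open>u\<close>, for a
  chosen unit vector \<open>u\<close>.  Another choice multiplies all values by the same unit complex
  number and does not affect the tensors below.
\<close>

definition horizontal :: "('n::finite cproj) tangent \<Rightarrow> complex^'n" where
  "horizontal X = differential (unit_chart_map (SOME u. norm u = 1 \<and> line u = base_point X)) X"

definition fubini_study :: "('n::finite cproj, complex^'n) kahler" where
  "fubini_study =
     \<lparr>points = points cproj_manifold, charts = charts cproj_manifold,
      metric = (\<lambda>X Y. Re (herm (horizontal X) (horizontal Y))),
      symp = (\<lambda>X Y. Im (herm (horizontal X) (horizontal Y))),
      cplx = (\<lambda>X. THE Y. Y \<in> tangent_space cproj_manifold (base_point X) \<and>
        horizontal Y = \<i> *s horizontal X)\<rparr>"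

definition cproj_units :: "('n::finite cproj) set" where
  "cproj_units = {line z |z. \<forall>i. z $ i \<noteq> 0}"

definition tau :: "'n::finite tvec \<Rightarrow> 'n cproj" where
  "tau = (\<lambda>(p, u). line (\<chi> k. complex_of_real (sqrt (p $ k)) * exp (\<i> * complex_of_real (u $ k) / 2)))"

end

theory Submission
  imports Defs
begin

text \<open>
  Let \<open>\<theta>\<close> be the natural parameters of a probability vector and \<open>v\<close> the components of a tangent vector.  In the
  complex coordinates \<open>w = \<theta> + i v\<close> the map \<open>\<tau>\<close> is \<open>w \<mapsto> [exp (w\<^sub>1/2), \<dots>, exp (w\<^sub>n/2)]\<close>, where a constant added to all
  \<open>w\<^sub>i\<close> does not matter.  Its fibres are therefore the orbits of the translations \<open>v \<mapsto> v + 4 \<pi> m\<close> with integral \<open>m\<close>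
  (\<open>tau_fibre\<close>), the principal branch of the logarithm provides local sections, and \<open>\<tau>\<close> is a covering with these
  translations as deck transformations (\<open>tau_covering_space\<close>, \<open>deck_group_eq\<close>).  In coordinates the total space is a vector
  space, hence simply connected.

  Differentiating the exponentials, \<open>\<tau>\<close> sends a tangent vector with centred horizontal and vertical parts \<open>\<alpha>, \<beta>\<close>
  to \<open>u\<^sub>i (\<alpha>\<^sub>i + i \<beta>\<^sub>i)/2\<close>, where \<open>u\<close> is a unit vector on the line with \<open>\<bar>u\<^sub>i\<bar>\<^sup>2 = p\<^sub>i\<close> (\<open>horizontal_tau_push\<close>).  So \<open>\<tau>\<close>
  intertwines the Kaehler structure of the tangent bundle with 4 times the Fubini-Study structure, and it is
  bijective on tangent spaces.  In particular, deck transformations preserve metric and complex structure.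

  It remains to relate Kaehler functions to the lattice, and two facts suffice.  First, a Kaehler function \<open>f\<close> is
  \<open>4 \<pi>\<close>-periodic in each \<open>v\<^sub>i\<close> (\<open>kahler_function_unit_translation\<close>): the vanishing of the Lie derivative of the metric in the plane of
  \<open>\<theta>\<^sub>i\<close> and \<open>v\<^sub>i\<close> says \<open>2 f\<^bsub>\<theta>v\<^esub> = (1 - 2 p\<^sub>i) f\<^sub>v\<close> and \<open>f\<^bsub>\<theta>\<theta>\<^esub> - f\<^bsub>vv\<^esub> = (1 - 2 p\<^sub>i) f\<^sub>\<theta>\<close>.  By the first equation
  \<open>f\<^sub>v\<close> is \<open>\<surd>(p\<^sub>i (1 - p\<^sub>i))\<close> times a function of \<open>v\<^sub>i\<close>, and then the second one is the equation of a harmonic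
  oscillator of frequency 1/2 in \<open>v\<^sub>i\<close>.  Hence deck transformations belong to \<open>\<Gamma>\<close>.  Secondly, the functions
  \<open>\<surd>(p\<^sub>a p\<^sub>b) cos ((u\<^sub>a - u\<^sub>b + c)/2)\<close> are Kaehler functions (\<open>interference_kahler\<close>), and their values determine the fibre of \<open>\<tau>\<close>
  that contains a point.  Hence elements of \<open>\<Gamma>\<close> are deck transformations.

  Finally, \<open>\<tau>\<close> factors through the quotient by \<open>\<Gamma>\<close>.  The induced map to the projective space is bijective, its inverse is locally a
  branch of the logarithm, and the tensors of the quotient, which are evaluated on lifts, agree with those of the
  projective space because \<open>\<tau>\<close> preserves them (\<open>orbit_tau_kahler_iso\<close>).

  Tangent vectors are classes of curves, and smoothness is defined by iterated directional derivatives.  The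
  bridge between the two is that a function with continuous directional derivatives is Frechet
  differentiable (\<open>C1_directional_imp_has_derivative\<close>); it makes the push-forward functorial for all
  maps that are differentiable in charts.
\<close>

section \<open>Calculus on relatively open subsets of linear subspaces\<close>

abbreviation dir_deriv :: "('e::real_normed_vector \<Rightarrow> 'f::real_normed_vector) \<Rightarrow> 'e \<Rightarrow> 'e \<Rightarrow> 'f \<Rightarrow> bool" where
  "dir_deriv f v x d \<equiv> ((\<lambda>t. f (x + t *\<^sub>R v)) has_vector_derivative d) (at 0)"

lemma Ck_on_SucE:
  assumes "Ck_on W (Suc k) S f"
  obtains f' where "\<And>v x. v \<in> W \<Longrightarrow> x \<in> S \<Longrightarrow> dir_deriv f v x (f' v x)"
    "\<And>v. v \<in> W \<Longrightarrow> Ck_on W k S (f' v)"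
proof -
  have "\<forall>v. \<exists>f'. v \<in> W \<longrightarrow> (\<forall>x\<in>S. dir_deriv f v x (f' x)) \<and> Ck_on W k S f'"
    using assms by auto
  from choice[OF this] that show thesis by blast
qed

lemma Ck_on_SucE':
  assumes "Ck_on W (Suc k) S f" "v \<in> W"
  obtains f' where "\<And>x. x \<in> S \<Longrightarrow> dir_deriv f v x (f' x)"
    "Ck_on W k S f'"
  using assms unfolding Ck_on.simps(2) by blast

lemma eventually_line_in_openin:
  fixes x v :: "'e::real_normed_vector"
  assumes W: "subspace W" and S: "openin (top_of_set W) S" and x: "x \<in> S" and v: "v \<in> W"
  shows "\<forall>\<^sub>F t in nhds 0. x + t *\<^sub>R v \<in> S"
proof -
  obtain A where A: "open A" "S = W \<inter> A" using S by (auto simp: openin_open)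
  have xW: "x \<in> W" using A x by auto
  have "((\<lambda>t. x + t *\<^sub>R v) \<longlongrightarrow> x + 0 *\<^sub>R v) (nhds 0)"
    by (intro tendsto_intros filterlim_ident)
  hence "\<forall>\<^sub>F t in nhds 0. x + t *\<^sub>R v \<in> A"
    using A x by (intro topological_tendstoD) auto
  thus ?thesis
    by eventually_elim (use A W xW v in \<open>auto intro: subspace_add subspace_scale\<close>)
qed

lemma Ck_on_cong:
  assumes W: "subspace W" and S: "openin (top_of_set W) S"
    and eq: "\<And>x. x \<in> S \<Longrightarrow> f x = g x" and f: "Ck_on W k S f"
  shows "Ck_on W k S g"
proof (cases k)
  case 0
  then show ?thesis using f eq by (simp cong: continuous_on_cong)
next
  case (Suc j)
  have "dir_deriv g v x d"
    if d: "dir_deriv f v x d" and xv: "x \<in> S" "v \<in> W" for x v d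
  proof -
    have "\<forall>\<^sub>F t in nhds 0. f (x + t *\<^sub>R v) = g (x + t *\<^sub>R v)"
      using eventually_line_in_openin[OF W S xv] by eventually_elim (simp add: eq)
    thus ?thesis using d eq[OF xv(1)]
      by (subst has_vector_derivative_cong_ev[where g="\<lambda>t. f (x + t *\<^sub>R v)"]) (auto elim: eventually_mono)
  qed
  with f Suc show ?thesis by (simp, meson)
qed

lemma Ck_on_subset: "Ck_on W k S f \<Longrightarrow> T \<subseteq> S \<Longrightarrow> Ck_on W k T f"
proof (induction k arbitrary: f)
  case 0 then show ?case by (auto intro: continuous_on_subset)
next
  case (Suc k) then show ?case by (simp, meson subset_iff)
qed

lemma subspace_orthonormal_expansion:
  fixes W :: "'e::euclidean_space set"
  assumes "subspace W"
  obtains B where "finite B" "B \<subseteq> W" "\<And>b. b \<in> B \<Longrightarrow> norm b = 1"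
    "\<And>w. w \<in> W \<Longrightarrow> (\<Sum>b\<in>B. (w \<bullet> b) *\<^sub>R b) = w"
proof -
  obtain B where B: "B \<subseteq> W" "pairwise orthogonal B" "\<And>x. x \<in> B \<Longrightarrow> norm x = 1" "independent B" "span B = W"
    using orthonormal_basis_subspace[OF assms] by metis
  have fin: "finite B" using B(4) by (rule independent_imp_finite)
  have "(\<Sum>b\<in>B. (w \<bullet> b) *\<^sub>R b) = w" if "w \<in> W" for w
  proof -
    have "w \<in> span B" using that B by simp
    then obtain u where u: "w = (\<Sum>b\<in>B. u b *\<^sub>R b)" unfolding span_finite[OF fin] by auto
    have "w \<bullet> b = u b" if b: "b \<in> B" for b
    proof -
      have "w \<bullet> b = (\<Sum>c\<in>B. u c * (c \<bullet> b))" by (simp add: u inner_sum_left)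
      also have "\<dots> = (\<Sum>c\<in>B. if c = b then u b else 0)"
        using B(2,3) b by (intro sum.cong) (auto simp: pairwise_def orthogonal_def norm_eq_1)
      finally show ?thesis using fin b by simp
    qed
    thus ?thesis using u by simp
  qed
  with B fin that show thesis by blast
qed

text \<open>
  An increment in \<open>W\<close> is split into steps along an orthonormal basis of \<open>W\<close>.  The mean value inequality
  and the continuity of the directional derivative control each step, so the linear map with the right
  values on the basis is a Frechet derivative; being one, it is correct in all other directions
  too.  This turns smoothness by iterated directional derivatives into a notion with a chain rule.
\<close>

lemma C1_directional_imp_has_derivative:
  fixes f :: "'e::euclidean_space \<Rightarrow> 'f::real_normed_vector"
  assumes W: "subspace W" and S: "openin (top_of_set W) S" and x: "x \<in> S"
    and d: "\<And>v y. v \<in> W \<Longrightarrow> y \<in> S \<Longrightarrow> dir_deriv f v y (f' v y)"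
    and c: "\<And>v. v \<in> W \<Longrightarrow> continuous_on S (f' v)"
  shows "\<exists>D. (f has_derivative D) (at x within S) \<and> (\<forall>v\<in>W. D v = f' v x)"
proof -
  obtain B where B: "finite B" "B \<subseteq> W" "\<And>b. b \<in> B \<Longrightarrow> norm b = 1"
    "\<And>w. w \<in> W \<Longrightarrow> (\<Sum>b\<in>B. (w \<bullet> b) *\<^sub>R b) = w"
    using subspace_orthonormal_expansion[OF W] by blast
  have SW: "S \<subseteq> W" using S by (simp add: openin_euclidean_subtopology_iff)
  obtain r where r: "r > 0" "\<And>y. y \<in> W \<Longrightarrow> dist y x < r \<Longrightarrow> y \<in> S"
    using S x by (auto simp: openin_euclidean_subtopology_iff)
  have xW: "x \<in> W" using SW x by auto
  define P where "P C h = (\<Sum>b\<in>C. (h \<bullet> b) *\<^sub>R b)" for C and h :: 'e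
  have PW: "P C h \<in> W" if "C \<subseteq> B" for C h
    unfolding P_def using that B(2) W by (intro subspace_sum subspace_scale) auto
  have Pn: "norm (P C h) \<le> real (card B) * norm h" if "C \<subseteq> B" for C h
  proof -
    have "norm (P C h) \<le> (\<Sum>b\<in>C. norm h)"
      unfolding P_def
    proof (rule sum_norm_le)
      fix b assume "b \<in> C"
      then show "norm ((h \<bullet> b) *\<^sub>R b) \<le> norm h"
        using that B(3)[of b] Cauchy_Schwarz_ineq2[of h b] by auto
    qed
    also have "\<dots> \<le> real (card B) * norm h"
      using card_mono[OF B(1) that] by (simp add: mult_right_mono)
    finally show ?thesis .
  qed
  have main: "\<exists>\<delta>>0. \<forall>h. norm h < \<delta> \<longrightarrow>
      norm (f (x + P C h) - f x - (\<Sum>b\<in>C. (h \<bullet> b) *\<^sub>R f' b x)) \<le> e * norm h"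
    if "finite C" "C \<subseteq> B" "e > 0" for C e
    using that
  proof (induction C arbitrary: e rule: finite_induct)
    case empty
    then show ?case by (intro exI[of _ 1]) (simp add: P_def)
  next
    case (insert b C e0)
    define e where "e = e0 / 2"
    have epos: "e > 0" using insert.prems by (simp add: e_def)
    have bW: "b \<in> W" and nb: "norm b = 1" using insert B by auto
    obtain d1 where d1: "d1 > 0" "\<And>h. norm h < d1 \<Longrightarrow>
      norm (f (x + P C h) - f x - (\<Sum>b\<in>C. (h \<bullet> b) *\<^sub>R f' b x)) \<le> e * norm h"
      using insert.IH[of e] insert.prems epos by auto
    obtain d2 where d2: "d2 > 0" "\<And>y. y \<in> S \<Longrightarrow> dist y x < d2 \<Longrightarrow> dist (f' b y) (f' b x) < e/3"
      using c[OF bW] x epos unfolding continuous_on_iff by (metis zero_less_divide_iff zero_less_numeral)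
    \<comment> \<open>bounds the distance covered by the earlier steps together with the present one\<close>
    define N where "N = real (card B) + 1"
    have N: "N > 0" by (simp add: N_def)
    define d3 where "d3 = min d1 (min d2 r / N)"
    have d3: "d3 > 0" using d1 d2 r N by (simp add: d3_def)
    have "norm (f (x + P (insert b C) h) - f x - (\<Sum>b\<in>insert b C. (h \<bullet> b) *\<^sub>R f' b x)) \<le> e0 * norm h"
      if h: "norm h < d3" for h
    proof -
      define y where "y = x + P C h"
      define s where "s = h \<bullet> b"
      have s: "\<bar>s\<bar> \<le> norm h" using Cauchy_Schwarz_ineq2[of h b] nb by (simp add: s_def)
      have hN: "N * norm h < min d2 r"
        using h N by (simp add: d3_def field_simps)
      have near: "y + t *\<^sub>R b \<in> S \<and> dist (y + t *\<^sub>R b) x < d2" if t: "\<bar>t\<bar> \<le> \<bar>s\<bar>" for t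
      proof -
        have "dist (y + t *\<^sub>R b) x = norm (P C h + t *\<^sub>R b)" by (simp add: y_def dist_norm)
        also have "\<dots> \<le> real (card B) * norm h + norm h"
          using Pn[of C h] insert.prems t s nb norm_triangle_ineq[of "P C h" "t *\<^sub>R b"] by auto
        also have "\<dots> < min d2 r" using hN by (simp add: N_def algebra_simps)
        finally have *: "dist (y + t *\<^sub>R b) x < min d2 r" .
        have "y + t *\<^sub>R b \<in> W" unfolding y_def using PW[of C h] insert.prems bW W xW
          by (intro subspace_add subspace_scale) auto
        with * r(2) show ?thesis by auto
      qed
      define I where "I = closed_segment 0 s"
      have I: "\<bar>t\<bar> \<le> \<bar>s\<bar>" if "t \<in> I" for t
        using that unfolding I_def closed_segment_eq_real_ivl by (auto split: if_splits)
      have der: "((\<lambda>t. f (y + t *\<^sub>R b)) has_vector_derivative f' b (y + t *\<^sub>R b)) (at t within I)" if "t \<in> I" for t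
      proof -
        have "((\<lambda>u. f ((y + t *\<^sub>R b) + u *\<^sub>R b)) has_vector_derivative f' b (y + t *\<^sub>R b)) (at 0)"
          using d[OF bW] near[OF I[OF that]] by blast
        hence "((\<lambda>u. f ((y + t *\<^sub>R b) + u *\<^sub>R b)) \<circ> (\<lambda>u. u - t) has_vector_derivative 1 *\<^sub>R f' b (y + t *\<^sub>R b)) (at t)"
          by (intro vector_diff_chain_at) (auto intro!: derivative_eq_intros)
        moreover have "(\<lambda>u. f ((y + t *\<^sub>R b) + u *\<^sub>R b)) \<circ> (\<lambda>u. u - t) = (\<lambda>u. f (y + u *\<^sub>R b))"
          by (auto simp: algebra_simps o_def)
        ultimately show ?thesis by (simp add: has_vector_derivative_at_within)
      qed
      have "norm (f (y + s *\<^sub>R b) - f (y + 0 *\<^sub>R b) - (s - 0) *\<^sub>R f' b (y + 0 *\<^sub>R b)) \<le> norm (s - 0) * (2 * e/3)"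
      proof (rule vector_differentiable_bound_linearization[where S=I and f'="\<lambda>t. f' b (y + t *\<^sub>R b)"])
        fix t assume t: "t \<in> I"
        have "dist (f' b (y + t *\<^sub>R b)) (f' b x) < e/3" "dist (f' b (y + 0 *\<^sub>R b)) (f' b x) < e/3"
          using d2(2) near[OF I[OF t]] near[of 0] by auto
        thus "norm (f' b (y + t *\<^sub>R b) - f' b (y + 0 *\<^sub>R b)) \<le> 2 * e/3"
          unfolding dist_norm[symmetric]
          using dist_triangle2[of "f' b (y + t *\<^sub>R b)" "f' b (y + 0 *\<^sub>R b)" "f' b x"] by linarith
      qed (use der in \<open>auto simp: I_def\<close>)
      moreover have "norm (s *\<^sub>R f' b y - s *\<^sub>R f' b x) \<le> norm s * (e/3)"
      proof -
        have "norm (f' b y - f' b x) \<le> e/3" using d2(2)[of y] near[of 0] by (auto simp: dist_norm)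
        from mult_left_mono[OF this abs_ge_zero[of s]] show ?thesis by (simp add: scaleR_diff_right[symmetric])
      qed
      ultimately have 2: "norm (f (y + s *\<^sub>R b) - f y - s *\<^sub>R f' b x) \<le> \<bar>s\<bar> * (2*e/3) + \<bar>s\<bar> * (e/3)"
        using norm_triangle_ineq[of "f (y + s *\<^sub>R b) - f y - s *\<^sub>R f' b y" "s *\<^sub>R f' b y - s *\<^sub>R f' b x"] by (simp add: algebra_simps)
      also have "\<dots> \<le> norm h * (2*e/3) + norm h * (e/3)"
        using s epos by (intro add_mono mult_right_mono) auto
      finally have 3: "norm (f (y + s *\<^sub>R b) - f y - s *\<^sub>R f' b x) \<le> norm h * e"
        by (simp add: field_simps)
      have P: "P (insert b C) h = P C h + s *\<^sub>R b"
        using insert.hyps by (simp add: P_def s_def)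
      define A1 where "A1 = f (x + P C h) - f x - (\<Sum>b\<in>C. (h \<bullet> b) *\<^sub>R f' b x)"
      define A2 where "A2 = f (y + s *\<^sub>R b) - f y - s *\<^sub>R f' b x"
      have eq: "f (x + P (insert b C) h) - f x - (\<Sum>b\<in>insert b C. (h \<bullet> b) *\<^sub>R f' b x) = A1 + A2"
        using insert.hyps by (simp add: P y_def s_def A1_def A2_def algebra_simps)
      have "norm A1 \<le> e * norm h"
        using d1(2)[of h] h by (simp add: d3_def A1_def)
      moreover have "norm A2 \<le> norm h * e" using 3 by (simp add: A2_def)
      ultimately show ?thesis
        unfolding eq using norm_triangle_ineq[of A1 A2] by (simp add: e_def algebra_simps)
    qed
    with d3 show ?case by blast
  qed
  define D where "D h = (\<Sum>b\<in>B. (h \<bullet> b) *\<^sub>R f' b x)" for h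
  have bl: "bounded_linear D"
    unfolding D_def by (intro bounded_linear_sum bounded_linear_scaleR_const bounded_linear_inner_left)
  have D: "(f has_derivative D) (at x within S)"
    unfolding has_derivative_within_alt
  proof (intro conjI bl allI impI)
    fix e :: real assume e: "0 < e"
    obtain \<delta> where \<delta>: "\<delta> > 0" "\<And>h. norm h < \<delta> \<Longrightarrow>
      norm (f (x + P B h) - f x - (\<Sum>b\<in>B. (h \<bullet> b) *\<^sub>R f' b x)) \<le> e * norm h"
      using main[OF B(1) _ e] by blast
    have "norm (f y - f x - D (y - x)) \<le> e * norm (y - x)" if y: "y \<in> S" "norm (y - x) < \<delta>" for y
    proof -
      have "y - x \<in> W" using y SW xW W by (blast intro: subspace_diff)
      hence "P B (y - x) = y - x" using B(4) by (simp add: P_def)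
      thus ?thesis using \<delta>(2)[OF y(2)] by (simp add: D_def)
    qed
    with \<delta>(1) show "\<exists>d>0. \<forall>y\<in>S. norm (y - x) < d \<longrightarrow> norm (f y - f x - D (y - x)) \<le> e * norm (y - x)"
      by blast
  qed
  moreover have "D v = f' v x" if v: "v \<in> W" for v
  proof -
    obtain \<delta> where \<delta>: "\<delta> > 0" "\<And>t. \<bar>t\<bar> < \<delta> \<Longrightarrow> x + t *\<^sub>R v \<in> S"
      using eventually_line_in_openin[OF W S x v] by (auto simp: eventually_nhds_metric dist_real_def)
    have "((f \<circ> (\<lambda>t. x + t *\<^sub>R v)) has_derivative (D \<circ> (\<lambda>t. t *\<^sub>R v))) (at 0 within {-\<delta><..<\<delta>})"
      by (rule diff_chain_within)
        (auto intro!: derivative_eq_intros has_derivative_subset[OF D] \<delta>)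
    moreover have "at 0 within {-\<delta><..<\<delta>} = at 0" using \<delta>(1) by (intro at_within_open) auto
    moreover have "D \<circ> (\<lambda>t. t *\<^sub>R v) = (\<lambda>t. t *\<^sub>R D v)"
      using bl by (auto simp: linear_simps)
    ultimately have "dir_deriv f v x (D v)"
      by (simp add: has_vector_derivative_def o_def)
    from vector_derivative_unique_at[OF this d[OF v x]] show ?thesis .
  qed
  ultimately show ?thesis by blast
qed

text \<open>
  For positive order, the definition asks for the continuity of derivatives only; that of the function
  comes from Frechet differentiability.
\<close>

lemma Ck_on_imp_continuous_on:
  fixes f :: "'e::euclidean_space \<Rightarrow> 'f::real_normed_vector"
  assumes W: "subspace W" and S: "openin (top_of_set W) S"
  shows "Ck_on W k S f \<Longrightarrow> continuous_on S f"
proof (induction k arbitrary: f)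
  case 0 then show ?case by simp
next
  case (Suc k)
  from Suc.prems obtain f' where f': "\<And>v y. v \<in> W \<Longrightarrow> y \<in> S \<Longrightarrow> dir_deriv f v y (f' v y)"
    "\<And>v. v \<in> W \<Longrightarrow> Ck_on W k S (f' v)"
    by (rule Ck_on_SucE) (rule that)
  show ?case
    unfolding continuous_on_eq_continuous_within
    using C1_directional_imp_has_derivative[OF W S _ f'(1) Suc.IH[OF f'(2)]]
    by (meson has_derivative_continuous)
qed

lemma Ck_on_SucD:
  fixes f :: "'e::euclidean_space \<Rightarrow> 'f::real_normed_vector"
  assumes W: "subspace W" and S: "openin (top_of_set W) S"
  shows "Ck_on W (Suc k) S f \<Longrightarrow> Ck_on W k S f"
proof (induction k arbitrary: f)
  case 0 then show ?case using Ck_on_imp_continuous_on[OF W S 0] by simp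
next
  case (Suc k)
  from Suc.prems obtain f' where f': "\<And>v y. v \<in> W \<Longrightarrow> y \<in> S \<Longrightarrow> dir_deriv f v y (f' v y)"
    "\<And>v. v \<in> W \<Longrightarrow> Ck_on W (Suc k) S (f' v)"
    by (rule Ck_on_SucE) (rule that)
  show ?case unfolding Ck_on.simps(2)[of W k] using f'(1) Suc.IH[OF f'(2)] by blast
qed

lemma smooth_on_has_derivative:
  fixes f :: "'e::euclidean_space \<Rightarrow> 'f::real_normed_vector"
  assumes W: "subspace W" and S: "openin (top_of_set W) S" and f: "smooth_on W S f" and x: "x \<in> S"
  obtains D where "(f has_derivative D) (at x within S)"
    "\<And>v. v \<in> W \<Longrightarrow> dir_deriv f v x (D v)"
proof -
  have "Ck_on W (Suc 0) S f" using f unfolding smooth_on_def by blast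
  then obtain f' where f': "\<And>v y. v \<in> W \<Longrightarrow> y \<in> S \<Longrightarrow> dir_deriv f v y (f' v y)"
    "\<And>v. v \<in> W \<Longrightarrow> continuous_on S (f' v)"
    by (rule Ck_on_SucE) (rule that, auto)
  from C1_directional_imp_has_derivative[OF W S x this] obtain D
    where D: "(f has_derivative D) (at x within S)" "\<forall>v\<in>W. D v = f' v x"
    by blast
  show thesis using that[OF D(1)] D(2) f'(1)[OF _ x] by metis
qed

lemma Ck_on_bounded_linear_compose:
  assumes L: "bounded_linear L"
  shows "Ck_on W k S f \<Longrightarrow> Ck_on W k S (\<lambda>x. L (f x))"
proof (induction k arbitrary: f)
  case 0 then show ?case using L by (simp add: linear_continuous_on_compose bounded_linear.continuous_on)
next
  case (Suc k)
  show ?case unfolding Ck_on.simps(2)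
  proof
    fix v assume "v \<in> W"
    with Suc.prems obtain f' where "\<And>x. x \<in> S \<Longrightarrow> dir_deriv f v x (f' x)" "Ck_on W k S f'"
      by (rule Ck_on_SucE') (rule that)
    thus "\<exists>f'. (\<forall>x\<in>S. ((\<lambda>t. L (f (x + t *\<^sub>R v))) has_vector_derivative f' x) (at 0)) \<and> Ck_on W k S f'"
      using bounded_linear.has_vector_derivative[OF L] Suc.IH by (intro exI[of _ "\<lambda>x. L (f' x)"]) auto
  qed
qed

lemma Ck_on_const: "Ck_on W k S (\<lambda>x. c)"
proof (induction k arbitrary: c)
  case (Suc k) show ?case unfolding Ck_on.simps(2)
    by (intro ballI exI[of _ "\<lambda>x. 0"]) (use Suc in auto)
qed simp

lemma Ck_on_bounded_linear:
  assumes L: "bounded_linear L"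
  shows "Ck_on W k S L"
proof (cases k)
  case 0 then show ?thesis using L by (simp add: linear_continuous_on)
next
  case (Suc j)
  have "dir_deriv L v x (L v)" for x v
    by (rule bounded_linear.has_vector_derivative[OF L]) (auto intro!: derivative_eq_intros)
  thus ?thesis unfolding Suc Ck_on.simps(2) using Ck_on_const by (intro ballI exI conjI)
qed

lemma Ck_on_add: "Ck_on W k S f \<Longrightarrow> Ck_on W k S g \<Longrightarrow> Ck_on W k S (\<lambda>x. f x + g x)"
proof (induction k arbitrary: f g)
  case 0 then show ?case by (auto intro: continuous_intros)
next
  case (Suc k)
  show ?case unfolding Ck_on.simps(2)
  proof
    fix v assume "v \<in> W"
    note v = this
    from Suc.prems(1) v obtain f' where f': "\<And>x. x \<in> S \<Longrightarrow> dir_deriv f v x (f' x)" "Ck_on W k S f'"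
      by (rule Ck_on_SucE') (rule that)
    from Suc.prems(2) v obtain g' where g': "\<And>x. x \<in> S \<Longrightarrow> dir_deriv g v x (g' x)" "Ck_on W k S g'"
      by (rule Ck_on_SucE') (rule that)
    from f' g' show "\<exists>f'. (\<forall>x\<in>S. ((\<lambda>t. f (x + t *\<^sub>R v) + g (x + t *\<^sub>R v)) has_vector_derivative f' x) (at 0)) \<and> Ck_on W k S f'"
      using Suc.IH by (intro exI[of _ "\<lambda>x. f' x + g' x"] conjI ballI has_vector_derivative_add) auto
  qed
qed

lemma Ck_on_bilinear:
  fixes f :: "'e::euclidean_space \<Rightarrow> 'f::real_normed_vector"
  assumes W: "subspace W" and S: "openin (top_of_set W) S" and B: "bounded_bilinear m"
  shows "Ck_on W k S f \<Longrightarrow> Ck_on W k S g \<Longrightarrow> Ck_on W k S (\<lambda>x. m (f x) (g x))"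
proof (induction k arbitrary: f g)
  case 0 then show ?case by (simp add: bounded_bilinear.continuous_on[OF B])
next
  case (Suc k)
  note D = Suc.prems[THEN Ck_on_SucD[OF W S]]
  show ?case unfolding Ck_on.simps(2)
  proof
    fix v assume v: "v \<in> W"
    from Suc.prems(1) v obtain f' where f': "\<And>x. x \<in> S \<Longrightarrow> dir_deriv f v x (f' x)" "Ck_on W k S f'"
      by (rule Ck_on_SucE') (rule that)
    from Suc.prems(2) v obtain g' where g': "\<And>x. x \<in> S \<Longrightarrow> dir_deriv g v x (g' x)" "Ck_on W k S g'"
      by (rule Ck_on_SucE') (rule that)
    show "\<exists>f'. (\<forall>x\<in>S. ((\<lambda>t. m (f (x + t *\<^sub>R v)) (g (x + t *\<^sub>R v))) has_vector_derivative f' x) (at 0)) \<and> Ck_on W k S f'"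
    proof (intro exI[of _ "\<lambda>x. m (f x) (g' x) + m (f' x) (g x)"] conjI ballI)
      fix x assume "x \<in> S"
      from bounded_bilinear.has_vector_derivative[OF B f'(1)[OF this] g'(1)[OF this]]
      show "((\<lambda>t. m (f (x + t *\<^sub>R v)) (g (x + t *\<^sub>R v))) has_vector_derivative m (f x) (g' x) + m (f' x) (g x)) (at 0)"
        by simp
    qed (intro Ck_on_add Suc.IH D f' g')
  qed
qed

text \<open>
  The outer function has one (real or complex) variable, so the directional derivative of the composition is
  a product and the chain rule for curves suffices.
\<close>

lemma Ck_on_chain:
  fixes f :: "'e::euclidean_space \<Rightarrow> 'f::real_normed_field"
  assumes W: "subspace W" and S: "openin (top_of_set W) S"
    and f: "Ck_on W (Suc k) S f" and h: "Ck_on W k S (\<lambda>x. h (f x))"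
    and g: "\<And>x. x \<in> S \<Longrightarrow> (g has_field_derivative h (f x)) (at (f x))"
  shows "Ck_on W (Suc k) S (\<lambda>x. g (f x))"
  unfolding Ck_on.simps(2)
proof
  fix v assume v: "v \<in> W"
  from f v obtain f' where f': "\<And>x. x \<in> S \<Longrightarrow> dir_deriv f v x (f' x)" "Ck_on W k S f'"
    by (rule Ck_on_SucE') (rule that)
  show "\<exists>f'. (\<forall>x\<in>S. ((\<lambda>t. g (f (x + t *\<^sub>R v))) has_vector_derivative f' x) (at 0)) \<and> Ck_on W k S f'"
  proof (intro exI[of _ "\<lambda>x. f' x * h (f x)"] conjI ballI)
    fix x assume x: "x \<in> S"
    have "(g \<circ> (\<lambda>t. f (x + t *\<^sub>R v)) has_vector_derivative (f' x * h (f x))) (at 0)"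
      by (rule field_vector_diff_chain_at[OF f'(1)[OF x]]) (use g[OF x] in simp)
    thus "((\<lambda>t. g (f (x + t *\<^sub>R v))) has_vector_derivative f' x * h (f x)) (at 0)" by (simp add: o_def)
  qed (intro Ck_on_bilinear[OF W S bounded_bilinear_mult] f' h)
qed

lemma Ck_on_exp:
  fixes f :: "'e::euclidean_space \<Rightarrow> 'f::{real_normed_field,banach}"
  assumes W: "subspace W" and S: "openin (top_of_set W) S"
  shows "Ck_on W k S f \<Longrightarrow> Ck_on W k S (\<lambda>x. exp (f x))"
proof (induction k)
  case 0 then show ?case by (auto intro: continuous_intros)
next
  case (Suc k)
  show ?case
    by (rule Ck_on_chain[OF W S Suc.prems Suc.IH[OF Ck_on_SucD[OF W S Suc.prems]]]) (rule DERIV_exp)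
qed

lemma Ck_on_inverse:
  fixes f :: "'e::euclidean_space \<Rightarrow> 'f::real_normed_field"
  assumes W: "subspace W" and S: "openin (top_of_set W) S" and nz: "\<And>x. x \<in> S \<Longrightarrow> f x \<noteq> 0"
  shows "Ck_on W k S f \<Longrightarrow> Ck_on W k S (\<lambda>x. inverse (f x))"
proof (induction k)
  case 0 then show ?case using nz by (auto intro: continuous_intros)
next
  case (Suc k)
  have "Ck_on W k S (\<lambda>x. inverse (f x))" using Suc.IH[OF Ck_on_SucD[OF W S Suc.prems]] .
  hence "Ck_on W k S (\<lambda>x. - (inverse (f x) * inverse (f x)))"
    by (intro Ck_on_bounded_linear_compose[OF bounded_linear_minus[OF bounded_linear_ident]] Ck_on_bilinear[OF W S bounded_bilinear_mult])
  from Ck_on_chain[OF W S Suc.prems, of "\<lambda>y. - (inverse y * inverse y)" inverse, OF this] show ?case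
    using nz by (metis DERIV_inverse numeral_2_eq_2 power_Suc power_0 mult.right_neutral power_inverse)
qed

lemma Ck_on_Ln:
  fixes f :: "'e::euclidean_space \<Rightarrow> complex"
  assumes W: "subspace W" and S: "openin (top_of_set W) S" and nz: "\<And>x. x \<in> S \<Longrightarrow> f x \<notin> \<real>\<^sub>\<le>\<^sub>0"
    and f: "\<And>k. Ck_on W k S f"
  shows "Ck_on W k S (\<lambda>x. Ln (f x))"
proof (cases k)
  case 0 then show ?thesis using f[of 0] nz by (auto intro!: continuous_on_Ln')
next
  case (Suc j)
  have nz': "\<And>x. x \<in> S \<Longrightarrow> f x \<noteq> 0" using nz by force
  show ?thesis unfolding Suc
    by (rule Ck_on_chain[OF W S f Ck_on_inverse[OF W S nz' f]]) (use nz in \<open>auto intro: has_field_derivative_Ln\<close>)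
qed

lemma Ck_on_sum:
  "(\<And>i. i \<in> I \<Longrightarrow> Ck_on W k S (f i)) \<Longrightarrow> Ck_on W k S (\<lambda>x. \<Sum>i\<in>I. f i x)"
  by (induction I rule: infinite_finite_induct) (auto intro: Ck_on_const Ck_on_add)

lemma Ck_on_vec:
  fixes f :: "'e::euclidean_space \<Rightarrow> 'f::euclidean_space ^ 'n"
  assumes "\<And>i. Ck_on W k S (\<lambda>x. f x $ i)"
  shows "Ck_on W k S f"
proof -
  have "bounded_linear (axis i :: 'f \<Rightarrow> 'f ^ 'n)" for i
    unfolding linear_conv_bounded_linear[symmetric]
    by (rule linearI) (auto simp: axis_def vec_eq_iff)
  from Ck_on_bounded_linear_compose[OF this assms]
  have "Ck_on W k S (\<lambda>x. \<Sum>i\<in>UNIV. axis i (f x $ i))" by (intro Ck_on_sum)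
  moreover have "(\<Sum>i\<in>UNIV. axis i (f x $ i)) = f x" for x
    by (simp add: vec_eq_iff axis_def if_distrib[of "\<lambda>g. g $ _"] cong: if_cong)
  ultimately show ?thesis by simp
qed

lemma Ck_on_Pair:
  fixes f :: "'e::euclidean_space \<Rightarrow> 'f::real_normed_vector" and g :: "'e \<Rightarrow> 'g::real_normed_vector"
  assumes "Ck_on W k S f" "Ck_on W k S g"
  shows "Ck_on W k S (\<lambda>x. (f x, g x))"
proof -
  have "Ck_on W k S (\<lambda>x. (f x, 0) + (0, g x))"
    using Ck_on_bounded_linear_compose[OF bounded_linear_Pair[OF bounded_linear_ident bounded_linear_zero] assms(1)]
      Ck_on_bounded_linear_compose[OF bounded_linear_Pair[OF bounded_linear_zero bounded_linear_ident] assms(2)]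
    by (rule Ck_on_add)
  thus ?thesis by simp
qed

text \<open>
  Directional derivatives are unique, so the ones found on the neighbourhoods fit together.
\<close>

lemma Ck_on_local:
  fixes f :: "'e::euclidean_space \<Rightarrow> 'f::real_normed_vector"
  assumes W: "subspace W" and S: "openin (top_of_set W) S"
  shows "(\<And>x. x \<in> S \<Longrightarrow> \<exists>A. open A \<and> x \<in> A \<and> Ck_on W k (S \<inter> A) f) \<Longrightarrow> Ck_on W k S f"
proof (induction k arbitrary: f)
  case 0
  have "continuous (at x within S) f" if "x \<in> S" for x
  proof -
    from 0[OF that] obtain A where A: "open A" "x \<in> A" "continuous_on (S \<inter> A) f"
      unfolding Ck_on.simps(1) by blast
    have "at x within S = at x within (S \<inter> A)" by (rule at_within_nhd[OF A(2,1)]) auto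
    with bspec[OF A(3)[unfolded continuous_on_eq_continuous_within], of x] A(2) that
    show ?thesis by simp
  qed
  then show ?case by (simp add: continuous_on_eq_continuous_within)
next
  case (Suc k)
  show ?case unfolding Ck_on.simps(2)
  proof
    fix v assume v: "v \<in> W"
    define g where "g x = vector_derivative (\<lambda>t. f (x + t *\<^sub>R v)) (at 0)" for x
    have *: "\<exists>A. open A \<and> x \<in> A \<and> (\<forall>y\<in>S \<inter> A. dir_deriv f v y (g y)) \<and> Ck_on W k (S \<inter> A) g"
      if "x \<in> S" for x
    proof -
      from Suc.prems[OF that] obtain A where A: "open A" "x \<in> A" "Ck_on W (Suc k) (S \<inter> A) f" by blast
      from Ck_on_SucE'[OF A(3) v] obtain f' where
        f': "\<forall>y\<in>S \<inter> A. dir_deriv f v y (f' y)" "Ck_on W k (S \<inter> A) f'"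
        by metis
      have eq: "g y = f' y" if "y \<in> S \<inter> A" for y
        unfolding g_def using f' that by (simp add: vector_derivative_at)
      have "openin (top_of_set W) (S \<inter> A)" using S A(1) by (metis openin_Int_open)
      from Ck_on_cong[OF W this _ f'(2)] eq have "Ck_on W k (S \<inter> A) g" by simp
      with A f' eq show ?thesis by (intro exI[of _ A]) auto
    qed
    have "Ck_on W k S g" by (rule Suc.IH) (use * in blast)
    with * show "\<exists>f'. (\<forall>x\<in>S. dir_deriv f v x (f' x)) \<and> Ck_on W k S f'"
      by (intro exI[of _ g]) blast
  qed
qed

section \<open>First-order calculus on manifolds given by charts\<close>

definition manifold_atlas :: "('a, 'e::real_normed_vector, 'm) manifold_scheme \<Rightarrow> bool" where
  "manifold_atlas M \<longleftrightarrow>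
     (\<forall>(U, \<phi>, W)\<in>charts M. subspace W \<and> U \<subseteq> points M \<and> inj_on \<phi> U \<and> openin (top_of_set W) (\<phi> ` U)) \<and>
     (\<forall>x\<in>points M. \<exists>(U, \<phi>, W)\<in>charts M. x \<in> U)"

text \<open>
  The first-order, pointwise version of smoothness.  It composes by the plain chain rule, and it is all that
  the push-forward of tangent vectors depends on.
\<close>

definition diff_map ::
  "('a, 'e::real_normed_vector, 'm) manifold_scheme
   \<Rightarrow> ('b, 'f::real_normed_vector, 'l) manifold_scheme \<Rightarrow> ('a \<Rightarrow> 'b) \<Rightarrow> bool" where
  "diff_map M M' f \<longleftrightarrow>
     f ` points M \<subseteq> points M' \<and>
     (\<forall>(U, \<phi>, W)\<in>charts M. \<forall>(U', \<phi>', W')\<in>charts M'. \<forall>x\<in>U. f x \<in> U' \<longrightarrow>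
        (\<forall>\<^sub>F y in at (\<phi> x) within \<phi> ` U. f (inv_into U \<phi> y) \<in> U') \<and>
        (\<lambda>y. \<phi>' (f (inv_into U \<phi> y))) differentiable (at (\<phi> x) within \<phi> ` U))"

text \<open>
  That the identity is differentiable says that the chart changes are.
\<close>

definition diff_manifold :: "('a, 'e::real_normed_vector, 'm) manifold_scheme \<Rightarrow> bool" where
  "diff_manifold M \<longleftrightarrow> manifold_atlas M \<and> diff_map M M (\<lambda>x. x)"

text \<open>
  Concerns the germ of the curve at time 0 only.
\<close>

definition chart_velocity :: "('a, 'e::real_normed_vector) chart \<Rightarrow> (real \<Rightarrow> 'a) \<Rightarrow> 'e \<Rightarrow> bool" where
  "chart_velocity = (\<lambda>(U, \<phi>, W) c v.
     c 0 \<in> U \<and> (\<forall>\<^sub>F t in nhds 0. c t \<in> U) \<and> ((\<lambda>t. \<phi> (c t)) has_vector_derivative v) (at 0))"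

definition diff_curve :: "('a, 'e::real_normed_vector, 'm) manifold_scheme \<Rightarrow> (real \<Rightarrow> 'a) \<Rightarrow> bool" where
  "diff_curve M c \<longleftrightarrow> (\<exists>\<kappa>\<in>charts M. \<exists>v. chart_velocity \<kappa> c v)"

lemma manifold_atlasD:
  assumes "manifold_atlas M" "(U, \<phi>, W) \<in> charts M"
  shows "subspace W" "U \<subseteq> points M" "inj_on \<phi> U" "openin (top_of_set W) (\<phi> ` U)"
  using assms by (auto simp: manifold_atlas_def)

lemma manifold_atlas_chart_at:
  assumes "manifold_atlas M" "x \<in> points M"
  obtains U \<phi> W where "(U, \<phi>, W) \<in> charts M" "x \<in> U"
  using assms by (auto simp: manifold_atlas_def)

lemma diff_mapD:
  assumes "diff_map M M' f" "(U, \<phi>, W) \<in> charts M" "(U', \<phi>', W') \<in> charts M'" "x \<in> U" "f x \<in> U'"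
  shows "\<forall>\<^sub>F y in at (\<phi> x) within \<phi> ` U. f (inv_into U \<phi> y) \<in> U'"
    "(\<lambda>y. \<phi>' (f (inv_into U \<phi> y))) differentiable (at (\<phi> x) within \<phi> ` U)"
  using assms unfolding diff_map_def by fastforce+

lemma diff_map_in: "diff_map M M' f \<Longrightarrow> x \<in> points M \<Longrightarrow> f x \<in> points M'"
  by (auto simp: diff_map_def)

lemma chart_velocity_push:
  assumes M: "manifold_atlas M" and f: "diff_map M M' f"
    and ch: "(U, \<phi>, W) \<in> charts M" "(U', \<phi>', W') \<in> charts M'"
    and c: "chart_velocity (U, \<phi>, W) c v" and fc: "f (c 0) \<in> U'"
    and D: "((\<lambda>y. \<phi>' (f (inv_into U \<phi> y))) has_derivative D) (at (\<phi> (c 0)) within \<phi> ` U)"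
  shows "chart_velocity (U', \<phi>', W') (f \<circ> c) (D v)"
proof -
  note a = manifold_atlasD[OF M ch(1)]
  from c have c0: "c 0 \<in> U" and cU: "\<forall>\<^sub>F t in nhds 0. c t \<in> U" and dc: "((\<lambda>t. \<phi> (c t)) has_vector_derivative v) (at 0)"
    by (auto simp: chart_velocity_def)
  obtain \<delta> where \<delta>: "\<delta> > 0" "\<And>t. \<bar>t\<bar> < \<delta> \<Longrightarrow> c t \<in> U"
    using cU by (auto simp: eventually_nhds_metric dist_real_def)
  define T where "T = {-\<delta><..<\<delta>}"
  have T: "at 0 within T = at 0" unfolding T_def using \<delta> by (intro at_within_open) auto
  have inT: "c t \<in> U" if "t \<in> T" for t using \<delta>(2)[of t] that by (auto simp: T_def)
  have dcT: "((\<lambda>t. \<phi> (c t)) has_derivative (\<lambda>t. t *\<^sub>R v)) (at 0 within T)"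
    using dc by (simp add: T has_vector_derivative_def)
  have lin: "D (t *\<^sub>R v) = t *\<^sub>R D v" for t
    using has_derivative_bounded_linear[OF D] by (simp add: linear_simps)
  have "((\<lambda>y. \<phi>' (f (inv_into U \<phi> y))) \<circ> (\<lambda>t. \<phi> (c t)) has_derivative D \<circ> (\<lambda>t. t *\<^sub>R v)) (at 0 within T)"
    by (rule diff_chain_within[OF dcT has_derivative_subset[OF D]]) (use inT in auto)
  hence "((\<lambda>t. \<phi>' (f (c t))) has_derivative D \<circ> (\<lambda>t. t *\<^sub>R v)) (at 0 within T)"
    by (rule has_derivative_transform[rotated 2]) (use \<delta> inT a(3) in \<open>auto simp: T_def\<close>)
  hence d: "((\<lambda>t. \<phi>' (f (c t))) has_vector_derivative D v) (at 0)"
    unfolding has_vector_derivative_def T by (simp add: o_def lin)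
  have cont: "((\<lambda>t. \<phi> (c t)) \<longlongrightarrow> \<phi> (c 0)) (at 0)"
    using has_vector_derivative_continuous[OF dc] by (simp add: continuous_at)
  have "\<forall>\<^sub>F t in at 0. f (c t) \<in> U'"
  proof -
    have "\<forall>\<^sub>F y in nhds (\<phi> (c 0)). y \<in> \<phi> ` U \<longrightarrow> f (inv_into U \<phi> y) \<in> U'"
      using diff_mapD(1)[OF f ch c0 fc] c0 fc a(3) unfolding eventually_at_filter
      by (auto elim!: eventually_mono)
    hence "\<forall>\<^sub>F t in at 0. \<phi> (c t) \<in> \<phi> ` U \<longrightarrow> f (inv_into U \<phi> (\<phi> (c t))) \<in> U'"
      using cont by (rule eventually_compose_filterlim)
    moreover have "\<forall>\<^sub>F t in at 0. c t \<in> U" using cU by (simp add: eventually_nhds_conv_at)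
    ultimately show ?thesis by eventually_elim (use a(3) in auto)
  qed
  with fc d show ?thesis by (auto simp: chart_velocity_def eventually_nhds_conv_at o_def)
qed

lemma chart_velocity_unique:
  "chart_velocity \<kappa> c v \<Longrightarrow> chart_velocity \<kappa> c w \<Longrightarrow> v = w"
  by (cases \<kappa>) (auto simp: chart_velocity_def intro: vector_derivative_unique_at)

lemma diff_map_chart_velocity:
  assumes M: "manifold_atlas M" and f: "diff_map M M' f"
    and ch: "\<kappa> \<in> charts M" "(U', \<phi>', W') \<in> charts M'"
    and c: "chart_velocity \<kappa> c v" and fc: "f (c 0) \<in> U'"
  obtains w where "chart_velocity (U', \<phi>', W') (f \<circ> c) w"
    "\<And>c'. chart_velocity \<kappa> c' v \<Longrightarrow> c' 0 = c 0 \<Longrightarrow> chart_velocity (U', \<phi>', W') (f \<circ> c') w"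
proof -
  obtain U \<phi> W where k: "\<kappa> = (U, \<phi>, W)" by (cases \<kappa>)
  have c0: "c 0 \<in> U" using c by (simp add: chart_velocity_def k)
  from diff_mapD(2)[OF f ch(1)[unfolded k] ch(2) c0 fc] obtain D where
    D: "((\<lambda>y. \<phi>' (f (inv_into U \<phi> y))) has_derivative D) (at (\<phi> (c 0)) within \<phi> ` U)"
    by (auto simp: differentiable_def)
  show thesis
    by (rule that[of "D v"]; (rule chart_velocity_push[OF M f ch(1)[unfolded k] ch(2)])) (use c fc D k in auto)
qed

lemma diff_curve_velocity_in_chart:
  assumes M: "diff_manifold M" and c: "diff_curve M c" and ch: "(U, \<phi>, W) \<in> charts M" "c 0 \<in> U"
  shows "\<exists>v. chart_velocity (U, \<phi>, W) c v"
proof -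
  obtain \<kappa> v where "\<kappa> \<in> charts M" "chart_velocity \<kappa> c v" using c by (auto simp: diff_curve_def)
  with diff_map_chart_velocity[of M M "\<lambda>x. x" \<kappa> U \<phi> W c v] M ch show ?thesis
    by (auto simp: diff_manifold_def o_def)
qed

text \<open>The chart change has a Frechet derivative, which carries equal velocities to equal velocities.\<close>

lemma chart_velocity_eq_transfer:
  assumes M: "diff_manifold M" and ch: "\<kappa> \<in> charts M" "\<kappa>' \<in> charts M"
    and c: "chart_velocity \<kappa> c v" "chart_velocity \<kappa> c' v" "c 0 = c' 0"
    and w: "chart_velocity \<kappa>' c w"
  shows "chart_velocity \<kappa>' c' w"
proof -
  obtain U \<phi> W where k: "\<kappa>' = (U, \<phi>, W)" by (cases \<kappa>')
  have c0: "c 0 \<in> U" using w by (simp add: k chart_velocity_def)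
  from M have "manifold_atlas M" "diff_map M M (\<lambda>x. x)" by (auto simp: diff_manifold_def)
  from diff_map_chart_velocity[OF this ch(1) ch(2)[unfolded k] c(1) c0]
  obtain w' where w': "chart_velocity \<kappa>' ((\<lambda>x. x) \<circ> c) w'"
    "\<And>c'. chart_velocity \<kappa> c' v \<Longrightarrow> c' 0 = c 0 \<Longrightarrow> chart_velocity \<kappa>' ((\<lambda>x. x) \<circ> c') w'"
    unfolding k by metis
  have "chart_velocity \<kappa>' c w'" "chart_velocity \<kappa>' c' w'"
    using w'(1) w'(2)[OF c(2)] c(3) by (simp_all add: o_def)
  with chart_velocity_unique w show ?thesis by blast
qed

lemma smooth_curve_imp_diff_curve:
  assumes "smooth_curve M c"
  shows "diff_curve M c"
proof -
  obtain U \<phi> W \<epsilon> where ch: "(U, \<phi>, W) \<in> charts M" "\<epsilon> > 0" "c ` {-\<epsilon><..<\<epsilon>} \<subseteq> U" "smooth_on UNIV {-\<epsilon><..<\<epsilon>} (\<phi> \<circ> c)"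
    using assms by (auto simp: smooth_curve_def)
  have "openin (top_of_set UNIV) {-\<epsilon><..<\<epsilon>}" "0 \<in> {-\<epsilon><..<\<epsilon>}" using ch(2) by auto
  from smooth_on_has_derivative[OF subspace_UNIV this(1) ch(4) this(2)]
  obtain D where "((\<lambda>t. (\<phi> \<circ> c) (0 + t *\<^sub>R 1)) has_vector_derivative D (1::real)) (at 0)"
    by (metis UNIV_I)
  hence "((\<lambda>t. \<phi> (c t)) has_vector_derivative D 1) (at 0)" by (simp add: o_def)
  moreover have "\<forall>\<^sub>F t in nhds 0. c t \<in> U"
    using ch by (intro eventually_mono[OF eventually_nhds_in_open[of "{-\<epsilon><..<\<epsilon>}"]]) auto
  moreover have "c 0 \<in> U" using ch by auto
  ultimately show ?thesis using ch(1) by (force simp: diff_curve_def chart_velocity_def)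
qed

text \<open>
  The difference quotients lie in the model space, which is closed.
\<close>

lemma chart_velocity_in_model_space:
  fixes M :: "('a, 'e::euclidean_space, 'm) manifold_scheme"
  assumes M: "manifold_atlas M" and ch: "(U, \<phi>, W) \<in> charts M" and c: "chart_velocity (U, \<phi>, W) c v"
  shows "v \<in> W"
proof -
  note a = manifold_atlasD[OF M ch]
  have sub: "\<phi> ` U \<subseteq> W" using a(4) by (simp add: openin_euclidean_subtopology_iff)
  from c have c0: "c 0 \<in> U" and cU: "\<forall>\<^sub>F t in nhds 0. c t \<in> U" and dc: "((\<lambda>t. \<phi> (c t)) has_vector_derivative v) (at 0)"
    by (auto simp: chart_velocity_def)
  have "((\<lambda>t. norm (\<phi> (c t) - \<phi> (c 0) - t *\<^sub>R v) / norm t) \<longlongrightarrow> 0) (at 0)"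
    using dc by (simp add: has_vector_derivative_def has_derivative_iff_norm)
  moreover have "\<forall>\<^sub>F t in at 0. norm (\<phi> (c t) - \<phi> (c 0) - t *\<^sub>R v) / norm t
      = norm ((1/t) *\<^sub>R (\<phi> (c t) - \<phi> (c 0)) - v)"
    unfolding eventually_at_filter
  proof (intro always_eventually allI impI)
    fix t :: real assume t: "t \<noteq> 0"
    have "(1/t) *\<^sub>R (\<phi> (c t) - \<phi> (c 0)) - v = (1/t) *\<^sub>R (\<phi> (c t) - \<phi> (c 0) - t *\<^sub>R v)"
      using t by (simp add: scaleR_diff_right)
    thus "norm (\<phi> (c t) - \<phi> (c 0) - t *\<^sub>R v) / norm t = norm ((1/t) *\<^sub>R (\<phi> (c t) - \<phi> (c 0)) - v)"
      by (simp add: divide_inverse_commute)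
  qed
  ultimately have "((\<lambda>t. norm ((1/t) *\<^sub>R (\<phi> (c t) - \<phi> (c 0)) - v)) \<longlongrightarrow> 0) (at 0)"
    by (rule Lim_transform_eventually)
  hence lim: "((\<lambda>t. (1/t) *\<^sub>R (\<phi> (c t) - \<phi> (c 0))) \<longlongrightarrow> v) (at 0)"
    by (simp add: tendsto_norm_zero_iff LIM_zero_iff)
  have "\<forall>\<^sub>F t in at 0. c t \<in> U" using cU by (simp add: eventually_nhds_conv_at)
  hence "\<forall>\<^sub>F t in at 0. (1/t) *\<^sub>R (\<phi> (c t) - \<phi> (c 0)) \<in> W"
    by eventually_elim (use sub c0 a(1) in \<open>blast intro: subspace_scale subspace_diff\<close>)
  from Lim_in_closed_set[OF closed_subspace[OF a(1)] this _ lim] show ?thesis by simp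
qed

text \<open>
  Straight lines in a chart realise every velocity by a smooth curve, so that a velocity class in the sense of
  the definition of tangent vectors is never empty, even if it is given by a curve that is
  differentiable at time 0 only.
\<close>

lemma chart_line_smooth:
  assumes M: "manifold_atlas M" and ch: "(U, \<phi>, W) \<in> charts M" and y: "y \<in> \<phi> ` U" and v: "v \<in> W"
  shows "smooth_curve M (\<lambda>t. inv_into U \<phi> (y + t *\<^sub>R v))"
    "chart_velocity (U, \<phi>, W) (\<lambda>t. inv_into U \<phi> (y + t *\<^sub>R v)) v"
proof -
  note a = manifold_atlasD[OF M ch]
  have ev: "\<forall>\<^sub>F t in nhds 0. y + t *\<^sub>R v \<in> \<phi> ` U" by (rule eventually_line_in_openin[OF a(1,4) y v])
  then obtain \<epsilon> where e: "\<epsilon> > 0" "\<And>t. \<bar>t\<bar> < \<epsilon> \<Longrightarrow> y + t *\<^sub>R v \<in> \<phi> ` U"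
    by (auto simp: eventually_nhds_metric dist_real_def)
  have in_U: "inv_into U \<phi> z \<in> U" "\<phi> (inv_into U \<phi> z) = z" if "z \<in> \<phi> ` U" for z
    using that by (auto intro: inv_into_into f_inv_into_f)
  have "Ck_on UNIV k {-\<epsilon><..<\<epsilon>} (\<phi> \<circ> (\<lambda>t. inv_into U \<phi> (y + t *\<^sub>R v)))" for k
  proof (rule Ck_on_cong)
    show "Ck_on UNIV k {-\<epsilon><..<\<epsilon>} (\<lambda>t. y + t *\<^sub>R v)"
      by (intro Ck_on_add Ck_on_const Ck_on_bounded_linear bounded_linear_scaleR_left)
  qed (use e in_U in auto)
  thus "smooth_curve M (\<lambda>t. inv_into U \<phi> (y + t *\<^sub>R v))"
    unfolding smooth_curve_def smooth_on_def
    by (intro bexI[OF _ ch]) (use e in_U in \<open>auto intro!: exI[of _ \<epsilon>]\<close>)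
  have "((\<lambda>t. y + t *\<^sub>R v) has_vector_derivative v) (at 0)"
    by (auto intro!: derivative_eq_intros)
  hence "((\<lambda>t. \<phi> (inv_into U \<phi> (y + t *\<^sub>R v))) has_vector_derivative v) (at 0)"
    by (subst has_vector_derivative_cong_ev[where g="\<lambda>t. y + t *\<^sub>R v"])
      (use ev in_U y in \<open>auto elim!: eventually_mono\<close>)
  thus "chart_velocity (U, \<phi>, W) (\<lambda>t. inv_into U \<phi> (y + t *\<^sub>R v)) v"
    using ev in_U y by (auto simp: chart_velocity_def elim!: eventually_mono)
qed

subsection \<open>Tangent vectors as velocities\<close>

lemma velocity_eqI:
  assumes M: "diff_manifold M" and ch: "\<kappa> \<in> charts M"
    and c: "chart_velocity \<kappa> c v" "chart_velocity \<kappa> c' v" "c 0 = c' 0"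
  shows "velocity M c = velocity M c'"
proof -
  have "vector_derivative (\<phi> \<circ> c) (at 0) = vector_derivative (\<phi> \<circ> c') (at 0)"
    if ch': "(U, \<phi>, W) \<in> charts M" "c 0 \<in> U" for U \<phi> W
  proof -
    have "diff_curve M c" using ch c by (auto simp: diff_curve_def)
    from diff_curve_velocity_in_chart[OF M this ch'] obtain w where w: "chart_velocity (U, \<phi>, W) c w"
      by blast
    have "chart_velocity (U, \<phi>, W) c' w" by (rule chart_velocity_eq_transfer[OF M ch ch'(1) c w])
    with w have "vector_derivative (\<phi> \<circ> c) (at 0) = w" "vector_derivative (\<phi> \<circ> c') (at 0) = w"
      by (auto simp: chart_velocity_def o_def intro!: vector_derivative_at)
    thus ?thesis by simp
  qed
  thus ?thesis unfolding velocity_def using c(3) by (auto 0 4)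
qed

lemma velocity_memD:
  assumes M: "diff_manifold M" and c: "diff_curve M c" and c': "c' \<in> velocity M c"
  shows "smooth_curve M c'" "c' 0 = c 0"
    "\<kappa> \<in> charts M \<Longrightarrow> chart_velocity \<kappa> c v \<Longrightarrow> chart_velocity \<kappa> c' v"
proof -
  show s: "smooth_curve M c'" "c' 0 = c 0" using c' by (auto simp: velocity_def)
  assume k: "\<kappa> \<in> charts M" "chart_velocity \<kappa> c v"
  obtain U \<phi> W where kk: "\<kappa> = (U, \<phi>, W)" by (cases \<kappa>)
  have c0: "c 0 \<in> U" using k(2) by (simp add: kk chart_velocity_def)
  obtain w where w: "chart_velocity \<kappa> c' w"
    using diff_curve_velocity_in_chart[OF M smooth_curve_imp_diff_curve[OF s(1)] k(1)[unfolded kk]] c0 s(2) unfolding kk by auto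
  have "vector_derivative (\<phi> \<circ> c') (at 0) = vector_derivative (\<phi> \<circ> c) (at 0)"
    using c' k(1) c0 unfolding velocity_def kk by auto
  hence "v = w" using w k(2) by (auto simp: kk chart_velocity_def o_def vector_derivative_at)
  with w show "chart_velocity \<kappa> c' v" by simp
qed

lemma velocity_nonempty:
  fixes M :: "('a, 'e::euclidean_space, 'm) manifold_scheme"
  assumes M: "diff_manifold M" and c: "diff_curve M c"
  obtains c' where "smooth_curve M c'" "c' 0 = c 0" "velocity M c' = velocity M c" "c' \<in> velocity M c"
proof -
  from M have at: "manifold_atlas M" by (simp add: diff_manifold_def)
  obtain U \<phi> W v where ch: "(U, \<phi>, W) \<in> charts M" "chart_velocity (U, \<phi>, W) c v"
    using c by (auto simp: diff_curve_def)
  have c0: "c 0 \<in> U" using ch(2) by (simp add: chart_velocity_def)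
  define c' where "c' t = inv_into U \<phi> (\<phi> (c 0) + t *\<^sub>R v)" for t
  have *: "smooth_curve M c'" "chart_velocity (U, \<phi>, W) c' v"
    unfolding c'_def[abs_def]
    using chart_line_smooth[OF at ch(1) _ chart_velocity_in_model_space[OF at ch]] c0 by auto
  have 0: "c' 0 = c 0" using manifold_atlasD(3)[OF at ch(1)] c0 by (simp add: c'_def)
  have e: "velocity M c' = velocity M c" by (rule velocity_eqI[OF M ch(1) *(2) ch(2) 0])
  have "c' \<in> velocity M c'" using *(1) by (auto simp: velocity_def)
  with that * 0 e show thesis by metis
qed

lemma curve_of_velocity:
  fixes M :: "('a, 'e::euclidean_space, 'm) manifold_scheme"
  assumes "diff_manifold M" "diff_curve M c"
  shows "curve_of (velocity M c) \<in> velocity M c"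
proof -
  obtain c' where "c' \<in> velocity M c" by (rule velocity_nonempty[OF assms])
  thus ?thesis unfolding curve_of_def by (rule someI[of "\<lambda>c'. c' \<in> velocity M c"])
qed

lemma base_point_velocity:
  fixes M :: "('a, 'e::euclidean_space, 'm) manifold_scheme"
  assumes "diff_manifold M" "diff_curve M c"
  shows "base_point (velocity M c) = c 0"
  using velocity_memD(2)[OF assms curve_of_velocity[OF assms]] by (simp add: base_point_def)

lemma velocity_curve_of_velocity:
  fixes M :: "('a, 'e::euclidean_space, 'm) manifold_scheme"
  assumes M: "diff_manifold M" and c: "diff_curve M c"
  shows "velocity M (curve_of (velocity M c)) = velocity M c"
proof -
  obtain \<kappa> v where k: "\<kappa> \<in> charts M" "chart_velocity \<kappa> c v" using c by (auto simp: diff_curve_def)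
  note m = velocity_memD[OF M c curve_of_velocity[OF M c]]
  show ?thesis by (rule velocity_eqI[OF M k(1) m(3)[OF k] k(2) m(2)])
qed

lemma velocity_in_tangent_space:
  fixes M :: "('a, 'e::euclidean_space, 'm) manifold_scheme"
  assumes "diff_manifold M" "diff_curve M c"
  shows "velocity M c \<in> tangent_space M (c 0)"
  proof -
  obtain c' where "smooth_curve M c'" "c' 0 = c 0" "velocity M c' = velocity M c"
    by (rule velocity_nonempty[OF assms])
  thus ?thesis unfolding tangent_space_def by (intro CollectI exI[of _ c']) simp
qed

lemma tangent_spaceD:
  fixes M :: "('a, 'e::euclidean_space, 'm) manifold_scheme"
  assumes M: "diff_manifold M" and X: "X \<in> tangent_space M x"
  shows "smooth_curve M (curve_of X)" "diff_curve M (curve_of X)" "curve_of X 0 = x" "base_point X = x"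
    "velocity M (curve_of X) = X"
proof -
  obtain c where c: "X = velocity M c" "smooth_curve M c" "c 0 = x" using X by (auto simp: tangent_space_def)
  note d = smooth_curve_imp_diff_curve[OF c(2)]
  note m = velocity_memD[OF M d curve_of_velocity[OF M d]]
  show "smooth_curve M (curve_of X)" "curve_of X 0 = x" "velocity M (curve_of X) = X"
    using m(1,2) c velocity_curve_of_velocity[OF M d] by auto
  thus "diff_curve M (curve_of X)" "base_point X = x"
    by (auto simp: base_point_def smooth_curve_imp_diff_curve)
qed

lemma tangent_space_empty_off_points:
  assumes M: "manifold_atlas M" and X: "X \<in> tangent_space M x"
  shows "x \<in> points M"
  using X manifold_atlasD(2)[OF M] unfolding tangent_space_def smooth_curve_def by force

lemma velocity_eqD:
  fixes M :: "('a, 'e::euclidean_space, 'm) manifold_scheme"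
  assumes M: "diff_manifold M" and c: "diff_curve M c" "diff_curve M c'" and e: "velocity M c = velocity M c'"
  shows "c 0 = c' 0" "\<kappa> \<in> charts M \<Longrightarrow> chart_velocity \<kappa> c v \<Longrightarrow> chart_velocity \<kappa> c' v"
proof -
  let ?d = "curve_of (velocity M c)"
  have d: "?d \<in> velocity M c" "?d \<in> velocity M c'" using curve_of_velocity[OF M c(1)] e by auto
  show 0: "c 0 = c' 0" using velocity_memD(2)[OF M c(1) d(1)] velocity_memD(2)[OF M c(2) d(2)] by simp
  assume k: "\<kappa> \<in> charts M" "chart_velocity \<kappa> c v"
  obtain U \<phi> W where kk: "\<kappa> = (U, \<phi>, W)" by (cases \<kappa>)
  have "c' 0 \<in> U" using k(2) 0 by (simp add: kk chart_velocity_def)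
  from diff_curve_velocity_in_chart[OF M c(2) k(1)[unfolded kk] this] obtain w where w: "chart_velocity \<kappa> c' w"
    unfolding kk by blast
  have "chart_velocity \<kappa> ?d v" "chart_velocity \<kappa> ?d w"
    using velocity_memD(3)[OF M c(1) d(1) k] velocity_memD(3)[OF M c(2) d(2) k(1) w] by auto
  with chart_velocity_unique w show "chart_velocity \<kappa> c' v" by blast
qed

subsection \<open>Functoriality of the push-forward\<close>

lemma diff_curve_compose:
  assumes M: "manifold_atlas M" "manifold_atlas M'" and f: "diff_map M M' f" and c: "diff_curve M c"
  shows "diff_curve M' (f \<circ> c)"
proof -
  obtain \<kappa> v where k: "\<kappa> \<in> charts M" "chart_velocity \<kappa> c v" using c by (auto simp: diff_curve_def)
  have "c 0 \<in> points M" using k manifold_atlasD(2)[OF M(1)] by (cases \<kappa>) (auto simp: chart_velocity_def)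
  hence "f (c 0) \<in> points M'" using f by (auto simp: diff_map_def)
  then obtain U \<phi> W where ch: "(U, \<phi>, W) \<in> charts M'" "f (c 0) \<in> U" by (rule manifold_atlas_chart_at[OF M(2)])
  show ?thesis using diff_map_chart_velocity[OF M(1) f k(1) ch(1) k(2) ch(2)] ch(1) unfolding diff_curve_def by metis
qed

text \<open>
  In charts, the velocity of the image curve is the value of a Frechet derivative at the velocity of the curve.
\<close>

lemma velocity_compose_cong:
  fixes M :: "('a, 'e::euclidean_space, 'm) manifold_scheme"
  assumes M: "diff_manifold M" "diff_manifold M'" and f: "diff_map M M' f"
    and c: "diff_curve M c" "diff_curve M c'" and e: "velocity M c = velocity M c'"
  shows "velocity M' (f \<circ> c) = velocity M' (f \<circ> c')"
proof -
  from M have at: "manifold_atlas M" "manifold_atlas M'" by (auto simp: diff_manifold_def)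
  obtain \<kappa> v where k: "\<kappa> \<in> charts M" "chart_velocity \<kappa> c v" using c by (auto simp: diff_curve_def)
  note e' = velocity_eqD[OF M(1) c e]
  have "c 0 \<in> points M" using k manifold_atlasD(2)[OF at(1)] by (cases \<kappa>) (auto simp: chart_velocity_def)
  hence "f (c 0) \<in> points M'" using f by (auto simp: diff_map_def)
  then obtain U \<phi> W where ch: "(U, \<phi>, W) \<in> charts M'" "f (c 0) \<in> U" by (rule manifold_atlas_chart_at[OF at(2)])
  obtain w where "chart_velocity (U, \<phi>, W) (f \<circ> c) w" "chart_velocity (U, \<phi>, W) (f \<circ> c') w"
    using diff_map_chart_velocity[OF at(1) f k(1) ch(1) k(2) ch(2)] e'(1) e'(2)[OF k] by metis
  from velocity_eqI[OF M(2) ch(1) this] e'(1) show ?thesis by simp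
qed

text \<open>
  The push-forward is defined through an arbitrarily chosen representative; any other differentiable curve with the
  same velocity may be used instead.
\<close>

lemma pushforward_velocity:
  fixes M :: "('a, 'e::euclidean_space, 'm) manifold_scheme"
  assumes M: "diff_manifold M" "diff_manifold M'" and f: "diff_map M M' f" and c: "diff_curve M c"
  shows "pushforward M' f (velocity M c) = velocity M' (f \<circ> c)"
  unfolding pushforward_def
  by (intro velocity_compose_cong[OF M f] c velocity_curve_of_velocity[OF M(1) c]
      smooth_curve_imp_diff_curve[OF velocity_memD(1)[OF M(1) c curve_of_velocity[OF M(1) c]]])

lemma pushforward_in_tangent_space:
  fixes M :: "('a, 'e::euclidean_space, 'm) manifold_scheme"
    and M' :: "('b, 'f::euclidean_space, 'l) manifold_scheme"
  assumes M: "diff_manifold M" "diff_manifold M'" and f: "diff_map M M' f" and X: "X \<in> tangent_space M x"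
  shows "pushforward M' f X \<in> tangent_space M' (f x)"
proof -
  from M have at: "manifold_atlas M" "manifold_atlas M'" by (auto simp: diff_manifold_def)
  note t = tangent_spaceD[OF M(1) X]
  show ?thesis
    using velocity_in_tangent_space[OF M(2) diff_curve_compose[OF at f t(2)]] t(3) by (simp add: pushforward_def)
qed

lemma pushforward_compose:
  fixes M :: "('a, 'e::euclidean_space, 'm) manifold_scheme"
    and M' :: "('b, 'f::euclidean_space, 'l) manifold_scheme"
    and M'' :: "('c, 'g::euclidean_space, 'k) manifold_scheme"
  assumes M: "diff_manifold M" "diff_manifold M'" "diff_manifold M''"
    and f: "diff_map M M' f" and g: "diff_map M' M'' g" and X: "X \<in> tangent_space M x"
  shows "pushforward M'' g (pushforward M' f X) = pushforward M'' (g \<circ> f) X"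
proof -
  from M have at: "manifold_atlas M" "manifold_atlas M'" by (auto simp: diff_manifold_def)
  note t = tangent_spaceD[OF M(1) X]
  have "pushforward M'' g (velocity M' (f \<circ> curve_of X)) = velocity M'' (g \<circ> (f \<circ> curve_of X))"
    by (rule pushforward_velocity[OF M(2,3) g diff_curve_compose[OF at f t(2)]])
  thus ?thesis by (simp add: pushforward_def o_assoc)
qed

lemma pushforward_cong:
  fixes M :: "('a, 'e::euclidean_space, 'm) manifold_scheme"
  assumes M: "diff_manifold M" "diff_manifold M'" and f: "diff_map M M' f"
    and e: "\<And>y. y \<in> points M \<Longrightarrow> f y = g y" and X: "X \<in> tangent_space M x"
  shows "pushforward M' f X = pushforward M' g X"
proof -
  from M have at: "manifold_atlas M" "manifold_atlas M'" by (auto simp: diff_manifold_def)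
  note t = tangent_spaceD[OF M(1) X]
  have d: "diff_curve M' (f \<circ> curve_of X)" by (rule diff_curve_compose[OF at f t(2)])
  then obtain \<kappa> v where k: "\<kappa> \<in> charts M'" "chart_velocity \<kappa> (f \<circ> curve_of X) v" by (auto simp: diff_curve_def)
  obtain \<kappa>0 v0 where k0: "\<kappa>0 \<in> charts M" "chart_velocity \<kappa>0 (curve_of X) v0" using t(2) by (auto simp: diff_curve_def)
  have ev: "\<forall>\<^sub>F t in nhds 0. f (curve_of X t) = g (curve_of X t)"
    using k0 e manifold_atlasD(2)[OF at(1)] by (cases \<kappa>0) (force simp: chart_velocity_def elim!: eventually_mono)
  obtain U \<phi> W where kk: "\<kappa> = (U, \<phi>, W)" by (cases \<kappa>)
  have 0: "f (curve_of X 0) = g (curve_of X 0)" using ev by (rule eventually_nhds_x_imp_x)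
  have "chart_velocity \<kappa> (g \<circ> curve_of X) v"
  proof -
    have "\<forall>\<^sub>F t in nhds 0. (f \<circ> curve_of X) t \<in> U" using k(2) by (simp add: kk chart_velocity_def)
    with ev have 1: "\<forall>\<^sub>F t in nhds 0. (g \<circ> curve_of X) t \<in> U" by eventually_elim simp
    have "((\<lambda>t. \<phi> (f (curve_of X t))) has_vector_derivative v) (at 0)" using k(2) by (simp add: kk chart_velocity_def)
    hence "((\<lambda>t. \<phi> (g (curve_of X t))) has_vector_derivative v) (at 0)"
      by (subst has_vector_derivative_cong_ev[where g="\<lambda>t. \<phi> (f (curve_of X t))"])
        (use ev 0 in \<open>auto elim!: eventually_mono\<close>)
    with 1 show ?thesis using eventually_nhds_x_imp_x[OF 1] by (simp add: kk chart_velocity_def)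
  qed
  from velocity_eqI[OF M(2) k(1) k(2) this] 0 show ?thesis by (simp add: pushforward_def)
qed

lemma pushforward_id:
  fixes M :: "('a, 'e::euclidean_space, 'm) manifold_scheme"
  assumes "diff_manifold M" "X \<in> tangent_space M x"
  shows "pushforward M (\<lambda>x. x) X = X"
  using tangent_spaceD(5)[OF assms] by (simp add: pushforward_def o_def)

subsection \<open>Composition and smooth maps\<close>

lemma diff_map_compose:
  assumes M: "manifold_atlas M" "manifold_atlas M'" and f: "diff_map M M' f" and g: "diff_map M' M'' g"
  shows "diff_map M M'' (g \<circ> f)"
  unfolding diff_map_def
proof (intro conjI ballI, goal_cases)
  case 1 show ?case using diff_map_in[OF f] diff_map_in[OF g] by auto
next
  case (2 \<kappa> )
  obtain U \<phi> W where k: "\<kappa> = (U, \<phi>, W)" by (cases \<kappa>)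
  have main: "(\<forall>\<^sub>F y in at (\<phi> x) within \<phi> ` U. (g \<circ> f) (inv_into U \<phi> y) \<in> U'') \<and>
        (\<lambda>y. \<phi>'' ((g \<circ> f) (inv_into U \<phi> y))) differentiable (at (\<phi> x) within \<phi> ` U)"
    if ch'': "(U'', \<phi>'', W'') \<in> charts M''" and x: "x \<in> U" and gx: "(g \<circ> f) x \<in> U''" for x U'' \<phi>'' W''
  proof -
    note ch = 2[unfolded k]
    note a = manifold_atlasD[OF M(1) ch]
    have "f x \<in> points M'" using f a(2) x by (auto simp: diff_map_def)
    then obtain U' \<phi>' W' where ch': "(U', \<phi>', W') \<in> charts M'" "f x \<in> U'" by (rule manifold_atlas_chart_at[OF M(2)])
    note a' = manifold_atlasD[OF M(2) ch'(1)]
    note fd = diff_mapD[OF f ch ch'(1) x ch'(2)]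
    note gd = diff_mapD[OF g ch'(1) ch'' ch'(2) gx[unfolded o_apply]]
    define T where "T = {y \<in> \<phi> ` U. f (inv_into U \<phi> y) \<in> U'}"
    have xT: "\<phi> x \<in> T" using x ch'(2) a(3) by (simp add: T_def)
    have "\<forall>\<^sub>F y in nhds (\<phi> x). y \<in> \<phi> ` U \<longrightarrow> y \<in> T"
      using fd(1) xT unfolding eventually_at_filter T_def by (auto elim!: eventually_mono)
    then obtain A where A: "open A" "\<phi> x \<in> A" "\<And>y. y \<in> A \<Longrightarrow> y \<in> \<phi> ` U \<Longrightarrow> y \<in> T"
      unfolding eventually_nhds by blast
    have TU: "T \<subseteq> \<phi> ` U" by (auto simp: T_def)
    have at: "at (\<phi> x) within T = at (\<phi> x) within \<phi> ` U"
      by (rule at_within_nhd[OF A(2,1)]) (use A(3) TU in auto)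
    define F where "F y = \<phi>' (f (inv_into U \<phi> y))" for y
    define G where "G z = \<phi>'' (g (inv_into U' \<phi>' z))" for z
    have FT: "F ` T \<subseteq> \<phi>' ` U'" by (auto simp: F_def T_def)
    have Fx: "F (\<phi> x) = \<phi>' (f x)" using a(3) x by (simp add: F_def)
    have GF: "G (F y) = \<phi>'' (g (f (inv_into U \<phi> y)))" if "y \<in> T" for y
      using that a'(3) by (simp add: F_def G_def T_def)
    obtain D where D: "(F has_derivative D) (at (\<phi> x) within T)"
      using fd(2) unfolding at F_def[abs_def] by (auto simp: differentiable_def)
    obtain D' where D': "(G has_derivative D') (at (F (\<phi> x)) within \<phi>' ` U')"
      using gd(2) gx unfolding Fx G_def[abs_def] by (auto simp: differentiable_def)
    have "(G \<circ> F has_derivative D' \<circ> D) (at (\<phi> x) within T)"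
      by (rule diff_chain_within[OF D has_derivative_subset[OF D' FT]])
    hence "((\<lambda>y. \<phi>'' (g (f (inv_into U \<phi> y)))) has_derivative D' \<circ> D) (at (\<phi> x) within T)"
      by (rule has_derivative_transform[OF xT, rotated]) (simp add: GF)
    hence 1: "(\<lambda>y. \<phi>'' ((g \<circ> f) (inv_into U \<phi> y))) differentiable (at (\<phi> x) within \<phi> ` U)"
      by (auto simp: at differentiable_def)
    have "(F \<longlongrightarrow> F (\<phi> x)) (at (\<phi> x) within T)"
      using has_derivative_continuous[OF D] by (simp add: continuous_within)
    moreover have "\<forall>\<^sub>F z in nhds (F (\<phi> x)). z \<in> \<phi>' ` U' \<longrightarrow> g (inv_into U' \<phi>' z) \<in> U''"
      using gd(1) gx a'(3) ch'(2) unfolding Fx eventually_at_filter by (auto elim!: eventually_mono)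
    ultimately have "\<forall>\<^sub>F y in at (\<phi> x) within T. F y \<in> \<phi>' ` U' \<longrightarrow> g (inv_into U' \<phi>' (F y)) \<in> U''"
      by (rule eventually_compose_filterlim[rotated])
    hence "\<forall>\<^sub>F y in at (\<phi> x) within T. (g \<circ> f) (inv_into U \<phi> y) \<in> U''"
      unfolding eventually_at_filter
      by eventually_elim (use a'(3) in \<open>auto simp: F_def T_def\<close>)
    with 1 show ?thesis by (simp add: at)
  qed
  show ?case unfolding k using main by fastforce
qed

lemma diff_map_cong:
  assumes M: "manifold_atlas M" and f: "diff_map M M' f" and e: "\<And>y. y \<in> points M \<Longrightarrow> f y = g y"
  shows "diff_map M M' g"
  unfolding diff_map_def
proof (intro conjI ballI, goal_cases)
  case 1 show ?case using f e by (auto simp: diff_map_def)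
next
  case (2 \<kappa> )
  obtain U \<phi> W where k: "\<kappa> = (U, \<phi>, W)" by (cases \<kappa>)
  note ch = 2[unfolded k]
  note a = manifold_atlasD[OF M(1) ch]
  have eq: "f (inv_into U \<phi> y) = g (inv_into U \<phi> y)" if "y \<in> \<phi> ` U" for y
    using e a(2) inv_into_into[OF that] by auto
  have main: "(\<forall>\<^sub>F y in at (\<phi> x) within \<phi> ` U. g (inv_into U \<phi> y) \<in> U') \<and>
        (\<lambda>y. \<phi>' (g (inv_into U \<phi> y))) differentiable (at (\<phi> x) within \<phi> ` U)"
    if ch': "(U', \<phi>', W') \<in> charts M'" and x: "x \<in> U" and gx: "g x \<in> U'" for x U' \<phi>' W'
  proof -
    have "f x \<in> U'" using gx e a(2) x by auto
    note d = diff_mapD[OF f ch ch' x this]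
    have "(\<lambda>y. \<phi>' (g (inv_into U \<phi> y))) differentiable (at (\<phi> x) within \<phi> ` U)"
      by (rule differentiable_transform_within[OF d(2), of 1]) (use x eq in auto)
    moreover have "\<forall>\<^sub>F y in at (\<phi> x) within \<phi> ` U. g (inv_into U \<phi> y) \<in> U'"
      using d(1) eq by (auto simp: eventually_at_filter elim!: eventually_mono)
    ultimately show ?thesis by blast
  qed
  show ?case unfolding k by (auto simp: main)
qed

lemma smooth_map_imp_diff_map:
  fixes M :: "('a, 'e::euclidean_space, 'm) manifold_scheme"
  assumes M: "manifold_atlas M" and f: "smooth_map M M' f"
  shows "diff_map M M' f"
  unfolding diff_map_def
proof (intro conjI ballI, goal_cases)
  case 1 show ?case using f by (auto simp: smooth_map_def)
next
  case (2 \<kappa> )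
  obtain U \<phi> W where k: "\<kappa> = (U, \<phi>, W)" by (cases \<kappa>)
  note ch = 2[unfolded k]
  note a = manifold_atlasD[OF M(1) ch]
  have main: "(\<forall>\<^sub>F y in at (\<phi> x) within \<phi> ` U. f (inv_into U \<phi> y) \<in> U') \<and>
        (\<lambda>y. \<phi>' (f (inv_into U \<phi> y))) differentiable (at (\<phi> x) within \<phi> ` U)"
    if ch': "(U', \<phi>', W') \<in> charts M'" and x: "x \<in> U" and fx: "f x \<in> U'" for x U' \<phi>' W'
  proof -
    define S where "S = \<phi> ` (U \<inter> f -` U')"
    have S: "openin (top_of_set W) S" "smooth_on W S (\<phi>' \<circ> f \<circ> inv_into U \<phi>)"
      using f ch ch' unfolding smooth_map_def S_def by fast+
    have xS: "\<phi> x \<in> S" using x fx by (auto simp: S_def)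
    obtain D where D: "((\<phi>' \<circ> f \<circ> inv_into U \<phi>) has_derivative D) (at (\<phi> x) within S)"
      by (rule smooth_on_has_derivative[OF a(1) S xS])
    obtain A where A: "open A" "S = W \<inter> A" using S(1) by (auto simp: openin_open)
    have SU: "S \<subseteq> \<phi> ` U" by (auto simp: S_def)
    have UW: "\<phi> ` U \<subseteq> W" using a(4) by (simp add: openin_euclidean_subtopology_iff)
    have "at (\<phi> x) within S = at (\<phi> x) within \<phi> ` U"
      by (rule at_within_nhd[of _ A]) (use A xS SU UW in auto)
    with D have "(\<lambda>y. \<phi>' (f (inv_into U \<phi> y))) differentiable (at (\<phi> x) within \<phi> ` U)"
      by (auto simp: differentiable_def o_def)
    moreover have "\<forall>\<^sub>F y in at (\<phi> x) within \<phi> ` U. f (inv_into U \<phi> y) \<in> U'"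
    proof -
      have "\<forall>\<^sub>F y in nhds (\<phi> x). y \<in> A" using A xS by (intro eventually_nhds_in_open) auto
      thus ?thesis unfolding eventually_at_filter
      proof eventually_elim
        case (elim y)
        { assume y: "y \<in> \<phi> ` U"
          hence "y \<in> S" using elim A UW by auto
          hence "f (inv_into U \<phi> y) \<in> U'" using a(3) by (auto simp: S_def) }
        thus ?case by simp
      qed
    qed
    ultimately show ?thesis by blast
  qed
  show ?case unfolding k by (auto simp: main)
qed

text \<open>
  Tangent vectors see nothing but the charts, so manifolds, Kaehler manifolds and their rescalings may share them.
\<close>

lemma charts_eq_imp_same_tangents:
  assumes "charts M = charts M'"
  shows "smooth_curve M = smooth_curve M'" "velocity M = velocity M'" "tangent_space M = tangent_space M'"
    "pushforward M f = pushforward M' f"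
proof -
  show 1: "smooth_curve M = smooth_curve M'" by (simp add: fun_eq_iff smooth_curve_def assms)
  show 2: "velocity M = velocity M'" by (simp add: fun_eq_iff velocity_def assms 1)
  show 3: "tangent_space M = tangent_space M'" by (simp add: fun_eq_iff tangent_space_def 1 2)
  show "pushforward M f = pushforward M' f" by (simp add: fun_eq_iff pushforward_def 2)
qed

section \<open>The tangent bundle of the family of probabilities in affine coordinates\<close>

definition softmax :: "real^'n \<Rightarrow> real^'n" where
  "softmax a = (\<chi> i. exp (a $ i) / (\<Sum>j\<in>UNIV. exp (a $ j)))"

definition centre :: "real^'n \<Rightarrow> real^'n \<Rightarrow> real^'n" where
  "centre p a = (\<chi> i. a $ i - expect p a)"

text \<open>
  The affine coordinates \<open>(\<theta>, v)\<close> are taken redundantly, without a reference point \<open>x\<^sub>k\<close>: adding a constant to all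
  \<open>\<theta>\<^sub>i\<close>, or to all \<open>v\<^sub>i\<close>, gives the same point.  This makes most constructions below independent of the chart.
\<close>

definition of_coords :: "'n::finite tvec \<Rightarrow> 'n tvec" where
  "of_coords y = (softmax (fst y), centre (softmax (fst y)) (snd y))"

text \<open>
  A choice of redundant coordinates for each point; a right inverse of \<^const>\<open>of_coords\<close>.
\<close>

definition log_coords :: "'n::finite tvec \<Rightarrow> 'n tvec" where
  "log_coords x = (\<chi> i. ln (fst x $ i), snd x)"

text \<open>
  Normalises redundant coordinates to those of the chart with reference point \<open>x\<^sub>k\<close>.
\<close>

definition reduce :: "'n::finite \<Rightarrow> 'n tvec \<Rightarrow> 'n tvec" where
  "reduce k y = (\<chi> i. fst y $ i - fst y $ k, \<chi> i. snd y $ i - snd y $ k)"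

definition model :: "'n::finite \<Rightarrow> 'n tvec set" where
  "model k = {(a, b). a $ k = 0 \<and> b $ k = 0}"

definition theta_map :: "'n::finite \<Rightarrow> 'n tvec \<Rightarrow> 'n tvec" where
  "theta_map k = (\<lambda>(p, u). (\<chi> i. ln (p $ i / p $ k), \<chi> i. u $ i - u $ k))"

lemma theta_chart_eq: "theta_chart k = (TP, theta_map k, model k)"
  by (simp add: theta_chart_def theta_map_def model_def)

lemma sum_exp_pos: "(\<Sum>j\<in>UNIV. exp (a $ j :: real)) > 0" for a :: "real^'n"
  by (intro sum_pos) auto

lemma softmax_in_prob_pos: "softmax a \<in> prob_pos"
  using sum_exp_pos[of a] by (simp add: prob_pos_def softmax_def sum_divide_distrib[symmetric])

lemma prob_posD: "p \<in> prob_pos \<Longrightarrow> p $ i > 0" "p \<in> prob_pos \<Longrightarrow> (\<Sum>i\<in>UNIV. p $ i) = 1"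
  by (auto simp: prob_pos_def)

lemma expect_diff: "expect p (a - b) = expect p a - expect p b"
  by (simp add: expect_def algebra_simps sum_subtractf)

lemma expect_add: "expect p (a + b) = expect p a + expect p b"
  by (simp add: expect_def algebra_simps sum.distrib)

lemma expect_scale: "expect p (c *\<^sub>R a) = c * expect p a"
  by (simp add: expect_def sum_distrib_left algebra_simps)

lemma expect_const: "p \<in> prob_pos \<Longrightarrow> expect p (\<chi> i. c) = c"
  by (simp add: expect_def sum_distrib_right[symmetric] prob_posD)

lemma expect_shift: "p \<in> prob_pos \<Longrightarrow> expect p (\<chi> i. a $ i - c) = expect p a - c"
  using expect_diff[of p a "\<chi> i. c"] expect_const[of p c]
  by (simp add: minus_vec_def)

lemma expect_axis: "expect p (axis i c) = c * p $ i"
  by (simp add: expect_def axis_def if_distrib[of "\<lambda>x. _ * x"] cong: if_cong)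

lemma expect_centre: "p \<in> prob_pos \<Longrightarrow> expect p (centre p a) = 0"
  by (simp add: centre_def expect_shift)

lemma centre_shift: "p \<in> prob_pos \<Longrightarrow> centre p (\<chi> i. a $ i - c) = centre p a"
  by (simp add: centre_def expect_shift vec_eq_iff)

lemma centre_centred: "expect p a = 0 \<Longrightarrow> centre p a = a"
  by (simp add: centre_def vec_eq_iff)

lemma softmax_shift: "softmax (\<chi> i. a $ i - c) = softmax a"
  by (simp add: softmax_def exp_diff sum_divide_distrib[symmetric] vec_eq_iff)

lemma of_coords_reduce: "of_coords (reduce k y) = of_coords y"
  by (simp add: of_coords_def reduce_def softmax_shift centre_shift softmax_in_prob_pos)

lemma TP_iff: "x \<in> TP \<longleftrightarrow> fst x \<in> prob_pos \<and> expect (fst x) (snd x) = 0"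
  by (cases x) (simp add: TP_def expect_def mult.commute)

lemma of_coords_in_TP: "of_coords y \<in> TP"
  by (simp add: TP_iff of_coords_def softmax_in_prob_pos expect_centre)

lemma of_coords_log_coords: "x \<in> TP \<Longrightarrow> of_coords (log_coords x) = x"
  by (cases x) (auto simp: TP_iff of_coords_def log_coords_def softmax_def prob_posD vec_eq_iff centre_centred)

lemma theta_map_eq: "x \<in> TP \<Longrightarrow> theta_map k x = reduce k (log_coords x)"
  by (cases x) (simp add: TP_iff theta_map_def reduce_def log_coords_def prob_posD ln_div vec_eq_iff
    prob_posD(1)[THEN less_imp_neq, symmetric])

lemma theta_map_of_coords: "theta_map k (of_coords y) = reduce k y"
proof -
  have "exp (fst y $ i) / (\<Sum>j\<in>UNIV. exp (fst y $ j)) / (exp (fst y $ k) / (\<Sum>j\<in>UNIV. exp (fst y $ j)))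
    = exp (fst y $ i - fst y $ k)" for i
    using sum_exp_pos[of "fst y"] by (simp add: exp_diff)
  thus ?thesis by (simp add: theta_map_def of_coords_def reduce_def softmax_def centre_def)
qed

lemma reduce_in_model: "reduce k y \<in> model k" by (simp add: reduce_def model_def)

lemma reduce_id: "y \<in> model k \<Longrightarrow> reduce k y = y"
  by (cases y) (simp add: reduce_def model_def vec_eq_iff)

lemma of_coords_theta_map: "x \<in> TP \<Longrightarrow> of_coords (theta_map k x) = x"
  by (simp add: theta_map_eq of_coords_reduce of_coords_log_coords)

lemma theta_map_image: "theta_map k ` TP = model k"
proof
  show "theta_map k ` TP \<subseteq> model k" by (auto simp: theta_map_eq reduce_in_model)
  show "model k \<subseteq> theta_map k ` TP"
  proof
    fix y assume "y \<in> model k"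
    hence "y = theta_map k (of_coords y)" by (simp add: theta_map_of_coords reduce_id)
    thus "y \<in> theta_map k ` TP" using of_coords_in_TP by blast
  qed
qed

lemma theta_map_inj: "inj_on (theta_map k) TP"
  by (rule inj_on_inverseI[of _ of_coords]) (rule of_coords_theta_map)

lemma inv_into_theta_map: "y \<in> model k \<Longrightarrow> inv_into TP (theta_map k) y = of_coords y"
  by (rule inv_into_f_eq[OF theta_map_inj of_coords_in_TP]) (simp add: theta_map_of_coords reduce_id)

lemma subspace_model: "subspace (model k)"
  by (auto simp: subspace_def model_def zero_prod_def)

lemma linear_reduce: "linear (reduce k)"
  by (rule linearI) (auto simp: reduce_def vec_eq_iff algebra_simps)

lemma bounded_linear_reduce: "bounded_linear (reduce k)"
  using linear_reduce linear_conv_bounded_linear by blast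

lemma TP_kahler_simps [simp]: "points TP_kahler = TP" "charts TP_kahler = range theta_chart"
  by (simp_all add: TP_kahler_def TP_manifold_def)

lemma TP_manifold_charts: "charts TP_manifold = charts TP_kahler"
  by (simp add: TP_kahler_def)

lemma TP_atlas: "manifold_atlas TP_kahler"
  by (auto simp: manifold_atlas_def theta_chart_eq subspace_model theta_map_inj theta_map_image)

lemma TP_diff_manifold: "diff_manifold (TP_kahler :: ('n::finite tvec, 'n tvec) kahler)"
proof -
  have "(\<lambda>y. theta_map k' (inv_into TP (theta_map k) y)) differentiable (at (theta_map k x) within model k)"
    if x: "x \<in> TP" for k k' :: 'n and x
  proof (rule differentiable_transform_within[where d=1])
    show "reduce k' differentiable (at (theta_map k x) within model k)"
      by (intro linear_imp_differentiable linear_reduce)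
    show "theta_map k x \<in> model k" using x theta_map_image by blast
  qed (auto simp: inv_into_theta_map theta_map_of_coords)
  hence "diff_map (TP_kahler :: ('n tvec, 'n tvec) kahler) TP_kahler (\<lambda>x. x)"
    by (auto simp: diff_map_def theta_chart_eq theta_map_image inv_into_theta_map of_coords_in_TP eventually_at_filter)
  thus ?thesis using TP_atlas by (simp add: diff_manifold_def)
qed

subsection \<open>Topology\<close>

lemma continuous_on_softmax: "continuous_on S f \<Longrightarrow> continuous_on S (\<lambda>x. softmax (f x))"
  unfolding softmax_def by (intro continuous_intros) (auto simp: sum_exp_pos[THEN less_imp_neq, symmetric])

lemma continuous_on_of_coords: "continuous_on S of_coords"
  unfolding of_coords_def centre_def expect_def
  by (intro continuous_intros continuous_on_softmax)

lemma continuous_on_theta_map: "continuous_on TP (theta_map k)"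
proof -
  have "continuous_on TP (\<lambda>x. reduce k (log_coords x))"
    unfolding reduce_def log_coords_def
    by (intro continuous_intros) (auto simp: TP_iff prob_posD less_imp_neq[symmetric])
  thus ?thesis by (simp add: theta_map_eq cong: continuous_on_cong)
qed

lemma homeomorphism_theta_map: "homeomorphism TP (model k) (theta_map k) of_coords"
proof (rule homeomorphismI)
  show "of_coords ` model k \<subseteq> TP" using of_coords_in_TP by blast
qed (auto simp: continuous_on_theta_map continuous_on_of_coords theta_map_image of_coords_theta_map
    theta_map_of_coords reduce_id)

lemma simply_connected_TP: "simply_connected (TP :: 'n::finite tvec set)"
proof -
  fix k :: 'n
  have "(TP :: 'n tvec set) homeomorphic model k" using homeomorphism_theta_map homeomorphic_def by blast
  moreover have "simply_connected (model k)"
    by (intro convex_imp_simply_connected subspace_imp_convex subspace_model)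
  ultimately show ?thesis using homeomorphic_simply_connected_eq by blast
qed

subsection \<open>Tangent vectors\<close>

lemma has_vector_derivative_vec:
  fixes f :: "real \<Rightarrow> real^'n"
  shows "(f has_vector_derivative f') F \<longleftrightarrow> (\<forall>i. ((\<lambda>t. f t $ i) has_vector_derivative f' $ i) F)"
proof
  assume f: "(f has_vector_derivative f') F"
  show "\<forall>i. ((\<lambda>t. f t $ i) has_vector_derivative f' $ i) F"
    using bounded_linear.has_vector_derivative[OF bounded_linear_vec_nth f] by blast
next
  assume *: "\<forall>i. ((\<lambda>t. f t $ i) has_vector_derivative f' $ i) F"
  have "((\<lambda>t. \<Sum>i\<in>UNIV. f t $ i *\<^sub>R axis i (1::real)) has_vector_derivative (\<Sum>i\<in>UNIV. f' $ i *\<^sub>R axis i 1)) F"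
    using * by (intro has_vector_derivative_sum bounded_linear.has_vector_derivative[OF bounded_linear_scaleR_left]) auto
  moreover have "(\<Sum>i\<in>UNIV. a $ i *\<^sub>R axis i (1::real)) = a" for a :: "real^'n"
    using basis_expansion[of a] by (simp add: scalar_mult_eq_scaleR)
  ultimately show "(f has_vector_derivative f') F" by simp
qed

text \<open>
  The logarithmic derivative of \<open>p\<^sub>i = e\<^bsup>\<theta>\<^sub>i\<^esup> / \<Sum>\<^sub>j e\<^bsup>\<theta>\<^sub>j\<^esup>\<close> is \<open>\<theta>'\<^sub>i\<close> minus its mean.
\<close>

lemma softmax_has_vector_derivative:
  assumes f: "(f has_vector_derivative f') (at t)"
  shows "((\<lambda>t. softmax (f t)) has_vector_derivative (\<chi> i. softmax (f t) $ i * centre (softmax (f t)) f' $ i)) (at t)"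
  unfolding has_vector_derivative_vec
proof
  fix i
  define S where "S = (\<Sum>j\<in>UNIV. exp (f t $ j))"
  have S: "S > 0" unfolding S_def by (rule sum_exp_pos)
  have fi: "((\<lambda>t. f t $ i) has_real_derivative f' $ i) (at t)" for i
    using f unfolding has_vector_derivative_vec by (simp add: has_real_derivative_iff_has_vector_derivative)
  have "((\<lambda>t. exp (f t $ i) / (\<Sum>j\<in>UNIV. exp (f t $ j))) has_real_derivative
     (exp (f t $ i) * f' $ i * S - exp (f t $ i) * (\<Sum>j\<in>UNIV. exp (f t $ j) * f' $ j)) / (S * S)) (at t)"
    unfolding S_def using S
    by (intro DERIV_divide DERIV_sum DERIV_fun_exp fi) (auto simp: S_def)
  moreover have "(exp (f t $ i) * f' $ i * S - exp (f t $ i) * (\<Sum>j\<in>UNIV. exp (f t $ j) * f' $ j)) / (S * S)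
     = softmax (f t) $ i * centre (softmax (f t)) f' $ i"
    using S unfolding softmax_def centre_def expect_def S_def[symmetric]
    by (simp add: sum_divide_distrib[symmetric] field_simps)
  ultimately show "((\<lambda>t. softmax (f t) $ i) has_vector_derivative
      (\<chi> i. softmax (f t) $ i * centre (softmax (f t)) f' $ i) $ i) (at t)"
    by (simp add: softmax_def has_real_derivative_iff_has_vector_derivative)
qed

text \<open>
  The exponential representative is \<open>v\<close> minus a constant vector, so its derivative is only found up to a constant
  vector \<open>r\<close>.  The connector subtracts the mean and does not see \<open>r\<close>.
\<close>

lemma chart_velocity_TP_derivs:
  assumes c: "chart_velocity (theta_chart k) c v"
  defines "p \<equiv> fst (c 0)"
  shows "((\<lambda>t. fst (c t)) has_vector_derivative (\<chi> i. p $ i * centre p (fst v) $ i)) (at 0)"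
    "\<exists>r. ((\<lambda>t. snd (c t)) has_vector_derivative (\<chi> i. snd v $ i - r)) (at 0)"
proof -
  define y where "y t = theta_map k (c t)" for t
  from c have c0: "c 0 \<in> TP" and ev: "\<forall>\<^sub>F t in nhds 0. c t \<in> TP" and d: "(y has_vector_derivative v) (at 0)"
    by (auto simp: chart_velocity_def theta_chart_eq y_def[abs_def])
  have cy: "\<forall>\<^sub>F t in nhds 0. c t = of_coords (y t)"
    using ev by eventually_elim (simp add: y_def of_coords_theta_map)
  have d1: "((\<lambda>t. fst (y t)) has_vector_derivative fst v) (at 0)"
    by (rule bounded_linear.has_vector_derivative[OF bounded_linear_fst d])
  have d2: "((\<lambda>t. snd (y t)) has_vector_derivative snd v) (at 0)"
    by (rule bounded_linear.has_vector_derivative[OF bounded_linear_snd d])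
  have p: "softmax (fst (y 0)) = p"
    using eventually_nhds_x_imp_x[OF cy] by (simp add: p_def of_coords_def)
  have sm: "((\<lambda>t. softmax (fst (y t))) has_vector_derivative (\<chi> i. p $ i * centre p (fst v) $ i)) (at 0)"
    using softmax_has_vector_derivative[OF d1] by (simp add: p)
  have 1: "\<forall>\<^sub>F t in nhds 0. fst (c t) = softmax (fst (y t))"
    using cy by eventually_elim (simp add: of_coords_def)
  show "((\<lambda>t. fst (c t)) has_vector_derivative (\<chi> i. p $ i * centre p (fst v) $ i)) (at 0)"
    using sm eventually_nhds_x_imp_x[OF 1] 1
    by (subst has_vector_derivative_cong_ev[where g="\<lambda>t. softmax (fst (y t))"]) (auto elim: eventually_mono)
  have sm': "((\<lambda>t. softmax (fst (y t)) $ i) has_real_derivative p $ i * centre p (fst v) $ i) (at 0)" for i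
    using sm unfolding has_vector_derivative_vec by (simp add: has_real_derivative_iff_has_vector_derivative)
  have d2': "((\<lambda>t. snd (y t) $ i) has_real_derivative snd v $ i) (at 0)" for i
    using d2 unfolding has_vector_derivative_vec by (simp add: has_real_derivative_iff_has_vector_derivative)
  have "\<exists>r. ((\<lambda>t. expect (softmax (fst (y t))) (snd (y t))) has_real_derivative r) (at 0)"
    unfolding expect_def by (rule exI[of _ "\<Sum>i\<in>UNIV. p $ i * centre p (fst v) $ i * snd (y 0) $ i + snd v $ i * softmax (fst (y 0)) $ i"])
      (intro DERIV_sum DERIV_mult sm' d2')
  then obtain r where r: "((\<lambda>t. expect (softmax (fst (y t))) (snd (y t))) has_real_derivative r) (at 0)" ..
  have "((\<lambda>t. centre (softmax (fst (y t))) (snd (y t))) has_vector_derivative (\<chi> i. snd v $ i - r)) (at 0)"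
    unfolding has_vector_derivative_vec
    by (auto simp: centre_def has_real_derivative_iff_has_vector_derivative[symmetric] intro!: derivative_intros d2' r)
  moreover have 2: "\<forall>\<^sub>F t in nhds 0. snd (c t) = centre (softmax (fst (y t))) (snd (y t))"
    using cy by eventually_elim (simp add: of_coords_def)
  ultimately have "((\<lambda>t. snd (c t)) has_vector_derivative (\<chi> i. snd v $ i - r)) (at 0)"
    using eventually_nhds_x_imp_x[OF 2]
    by (subst has_vector_derivative_cong_ev[where g="\<lambda>t. centre (softmax (fst (y t))) (snd (y t))"]) (auto elim: eventually_mono)
  thus "\<exists>r. ((\<lambda>t. snd (c t)) has_vector_derivative (\<chi> i. snd v $ i - r)) (at 0)" ..
qed

text \<open>
  In affine coordinates of a flat connection the connector is the identity; the centring
  translates coordinates into the exponential representation.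
\<close>

lemma proj_push_connector_velocity:
  assumes c: "chart_velocity (theta_chart k) c v"
  defines "A \<equiv> velocity TP_kahler c" and "p \<equiv> fst (c 0)"
  shows "base_point A = c 0" "proj_push A = centre p (fst v)" "connector A = centre p (snd v)"
proof -
  have dc: "diff_curve TP_kahler c" using c unfolding diff_curve_def by (intro bexI exI) auto
  show b: "base_point A = c 0" unfolding A_def by (rule base_point_velocity[OF TP_diff_manifold dc])
  have c0: "c 0 \<in> TP" using c by (simp add: chart_velocity_def theta_chart_eq)
  hence p: "p \<in> prob_pos" by (simp add: TP_iff p_def)
  note m = velocity_memD[OF TP_diff_manifold dc curve_of_velocity[OF TP_diff_manifold dc], folded A_def]
  have c': "chart_velocity (theta_chart k) (curve_of A) v" using m(3)[OF _ c] by simp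
  have p': "fst (curve_of A 0) = p" using m(2) by (simp add: p_def)
  note D = chart_velocity_TP_derivs[OF c', unfolded p']
  have "((\<lambda>t. fst (curve_of A t) $ i) has_vector_derivative p $ i * centre p (fst v) $ i) (at 0)" for i
    using D(1) unfolding has_vector_derivative_vec by simp
  hence "vector_derivative (\<lambda>t. fst (curve_of A t) $ i) (at 0) = p $ i * centre p (fst v) $ i" for i
    by (rule vector_derivative_at)
  thus "proj_push A = centre p (fst v)"
    using prob_posD(1)[OF p] by (simp add: proj_push_def b p_def[symmetric] vec_eq_iff less_imp_neq[symmetric])
  obtain r where r: "((\<lambda>t. snd (curve_of A t)) has_vector_derivative (\<chi> i. snd v $ i - r)) (at 0)" using D(2) ..
  hence e: "vector_derivative (\<lambda>t. snd (curve_of A t)) (at 0) = (\<chi> i. snd v $ i - r)" by (rule vector_derivative_at)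
  have "connector A = centre p (\<chi> i. snd v $ i - r)"
    unfolding connector_def Let_def e b p_def[symmetric] by (simp add: centre_def vec_eq_iff)
  thus "connector A = centre p (snd v)" by (simp add: centre_shift[OF p])
qed

text \<open>
  The tangent vector at \<open>x\<close> whose redundant affine coordinates are \<open>\<alpha>\<close>.
\<close>

definition tvec_at :: "'n::finite tvec \<Rightarrow> 'n tvec \<Rightarrow> 'n tvec tangent" where
  "tvec_at x \<alpha> = velocity TP_kahler (\<lambda>t. of_coords (log_coords x + t *\<^sub>R \<alpha>))"

lemma chart_velocity_of_coords:
  "chart_velocity (theta_chart k) (\<lambda>t. of_coords (y + t *\<^sub>R \<alpha>)) (reduce k \<alpha>)"
proof -
  have "((\<lambda>t. reduce k (y + t *\<^sub>R \<alpha>)) has_vector_derivative reduce k \<alpha>) (at 0)"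
    by (rule bounded_linear.has_vector_derivative[OF bounded_linear_reduce]) (auto intro!: derivative_eq_intros)
  thus ?thesis by (simp add: chart_velocity_def theta_chart_eq of_coords_in_TP theta_map_of_coords)
qed

lemma diff_curve_of_coords: "diff_curve TP_kahler (\<lambda>t. of_coords (y + t *\<^sub>R \<alpha>))"
  unfolding diff_curve_def by (intro bexI exI, rule chart_velocity_of_coords) simp

lemma tvec_at_of_coords: "velocity TP_kahler (\<lambda>t. of_coords (y + t *\<^sub>R \<alpha>)) = tvec_at (of_coords y) \<alpha>"
  unfolding tvec_at_def
  by (rule velocity_eqI[OF TP_diff_manifold _ chart_velocity_of_coords chart_velocity_of_coords])
    (auto simp: of_coords_log_coords of_coords_in_TP)

lemma tvec_at_facts:
  assumes "x \<in> TP"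
  shows "tvec_at x \<alpha> \<in> tangent_space TP_kahler x" "base_point (tvec_at x \<alpha>) = x"
    "proj_push (tvec_at x \<alpha>) = centre (fst x) (fst \<alpha>)" "connector (tvec_at x \<alpha>) = centre (fst x) (snd \<alpha>)"
proof -
  have x: "of_coords (log_coords x + 0 *\<^sub>R \<alpha>) = x" using assms by (simp add: of_coords_log_coords)
  have p: "fst x \<in> prob_pos" using assms by (simp add: TP_iff)
  show "tvec_at x \<alpha> \<in> tangent_space TP_kahler x" unfolding tvec_at_def
    using velocity_in_tangent_space[OF TP_diff_manifold diff_curve_of_coords[of "log_coords x" \<alpha>]] x by simp
  show "base_point (tvec_at x \<alpha>) = x"
    "proj_push (tvec_at x \<alpha>) = centre (fst x) (fst \<alpha>)" "connector (tvec_at x \<alpha>) = centre (fst x) (snd \<alpha>)"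
    using proj_push_connector_velocity[OF chart_velocity_of_coords, of "log_coords x" \<alpha>] x
    by (auto simp: tvec_at_def reduce_def centre_shift[OF p])
qed

text \<open>
  Horizontal and vertical part together are coordinates on each tangent space of the tangent bundle.
\<close>

lemma tangent_eq_tvec_at:
  assumes A: "A \<in> tangent_space TP_kahler x"
  shows "A = tvec_at x (proj_push A, connector A)"
    "expect (fst x) (proj_push A) = 0" "expect (fst x) (connector A) = 0" "x \<in> TP"
proof -
  note t = tangent_spaceD[OF TP_diff_manifold A]
  show x: "x \<in> TP" using tangent_space_empty_off_points[OF TP_atlas A] by simp
  hence p: "fst x \<in> prob_pos" by (simp add: TP_iff)
  fix k :: 'a
  have "(TP, theta_map k, model k) \<in> charts TP_kahler" by (simp add: theta_chart_eq[symmetric])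
  from diff_curve_velocity_in_chart[OF TP_diff_manifold t(2) this] x t(3)
  obtain v where v: "chart_velocity (theta_chart k) (curve_of A) v" by (auto simp: theta_chart_eq)
  note pc = proj_push_connector_velocity[OF v, unfolded t(5) t(3)]
  show "expect (fst x) (proj_push A) = 0" "expect (fst x) (connector A) = 0"
    using pc expect_centre[OF p] by auto
  have vm: "v \<in> model k" using chart_velocity_in_model_space[OF TP_atlas _ v[unfolded theta_chart_eq]]
    by (auto simp: theta_chart_eq[symmetric])
  have "reduce k (proj_push A, connector A) = v"
    using vm unfolding pc(2,3) by (cases v) (simp add: reduce_def model_def centre_def vec_eq_iff)
  hence v': "chart_velocity (theta_chart k) (\<lambda>t. of_coords (log_coords x + t *\<^sub>R (proj_push A, connector A))) v"
    using chart_velocity_of_coords[of k "log_coords x" "(proj_push A, connector A)"] by simp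
  show "A = tvec_at x (proj_push A, connector A)"
  proof -
    have "curve_of A 0 = of_coords (log_coords x + 0 *\<^sub>R (proj_push A, connector A))"
      using x t(3) by (simp only: scaleR_zero_left add_0_right of_coords_log_coords)
    moreover have "theta_chart k \<in> charts TP_kahler" by simp
    ultimately have "velocity TP_kahler (curve_of A) = tvec_at x (proj_push A, connector A)"
      unfolding tvec_at_def by (intro velocity_eqI[OF TP_diff_manifold _ v v'])
    thus ?thesis by (simp only: t(5))
  qed
qed

lemma cplx_TP:
  assumes A: "A \<in> tangent_space TP_kahler x"
  shows "cplx TP_kahler A = tvec_at x (- connector A, proj_push A)"
proof -
  note a = tangent_eq_tvec_at[OF A]
  have b: "base_point A = x" using tangent_spaceD(4)[OF TP_diff_manifold A] .
  have n: "expect (fst x) (- connector A) = 0" using a(3) expect_scale[of "fst x" "-1" "connector A"] by simp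
  have ts: "tangent_space TP_manifold = (tangent_space TP_kahler :: 'a tvec \<Rightarrow> _)"
    by (rule charts_eq_imp_same_tangents) (rule TP_manifold_charts)
  have "cplx TP_kahler A = (THE B. B \<in> tangent_space TP_manifold (base_point A) \<and>
      proj_push B = - connector A \<and> connector B = proj_push A)"
    by (simp add: TP_kahler_def)
  also have "\<dots> = tvec_at x (- connector A, proj_push A)"
    unfolding b ts
  proof (rule the_equality)
    show "tvec_at x (- connector A, proj_push A) \<in> tangent_space TP_kahler x \<and>
      proj_push (tvec_at x (- connector A, proj_push A)) = - connector A \<and>
      connector (tvec_at x (- connector A, proj_push A)) = proj_push A"
      using a n by (simp add: tvec_at_facts centre_centred)
  next
    fix B assume "B \<in> tangent_space TP_kahler x \<and> proj_push B = - connector A \<and> connector B = proj_push A"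
    thus "B = tvec_at x (- connector A, proj_push A)" using tangent_eq_tvec_at(1)[of B x] by simp
  qed
  finally show ?thesis .
qed

definition cov :: "real^'n \<Rightarrow> real^'n \<Rightarrow> real^'n \<Rightarrow> real" where
  "cov p a b = expect p (\<chi> i. a $ i * b $ i) - expect p a * expect p b"

text \<open>
  The Fisher metric of centred vectors is a covariance, which makes sense for redundant coordinates as well.
\<close>

lemma fisher_centre: "p \<in> prob_pos \<Longrightarrow> fisher p (centre p a) (centre p b) = cov p a b"
proof -
  assume p: "p \<in> prob_pos"
  have "fisher p (centre p a) (centre p b) = (\<Sum>i\<in>UNIV. p $ i * (a $ i * b $ i)) - expect p b * (\<Sum>i\<in>UNIV. p $ i * a $ i)
     - expect p a * (\<Sum>i\<in>UNIV. p $ i * b $ i) + expect p a * expect p b * (\<Sum>i\<in>UNIV. p $ i)"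
    unfolding fisher_def centre_def sum_distrib_left sum.distrib[symmetric] sum_subtractf[symmetric]
    by (rule sum.cong) (auto simp: algebra_simps)
  also have "\<dots> = cov p a b" using prob_posD(2)[OF p] by (simp add: cov_def expect_def)
  finally show ?thesis .
qed

lemma metric_TP:
  assumes "x \<in> TP"
  shows "metric TP_kahler (tvec_at x \<alpha>) (tvec_at x \<beta>) = cov (fst x) (fst \<alpha>) (fst \<beta>) + cov (fst x) (snd \<alpha>) (snd \<beta>)"
    "symp TP_kahler (tvec_at x \<alpha>) (tvec_at x \<beta>) = cov (fst x) (fst \<alpha>) (snd \<beta>) - cov (fst x) (snd \<alpha>) (fst \<beta>)"
  using assms by (auto simp: TP_kahler_def Let_def tvec_at_facts fisher_centre TP_iff)

lemma coord_vec_TP: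
  assumes "y \<in> model k" "v \<in> model k"
  shows "coord_vec TP_kahler (theta_chart k) y v = tvec_at (of_coords y) v"
proof -
  have "y + t *\<^sub>R v \<in> model k" for t using assms subspace_model subspace_add subspace_scale by blast
  hence "(\<lambda>t. inv_into TP (theta_map k) (y + t *\<^sub>R v)) = (\<lambda>t. of_coords (y + t *\<^sub>R v))"
    by (simp add: inv_into_theta_map)
  thus ?thesis by (simp add: coord_vec_def theta_chart_eq tvec_at_of_coords)
qed

lemma differential_theta_map:
  assumes "x \<in> TP"
  shows "differential (theta_map k) (tvec_at x \<alpha>) = reduce k \<alpha>"
proof -
  have d: "diff_curve TP_kahler (\<lambda>t. of_coords (log_coords x + t *\<^sub>R \<alpha>))" by (rule diff_curve_of_coords)
  have "chart_velocity (theta_chart k) (curve_of (tvec_at x \<alpha>)) (reduce k \<alpha>)"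
    unfolding tvec_at_def
    by (rule velocity_memD(3)[OF TP_diff_manifold d curve_of_velocity[OF TP_diff_manifold d] _ chart_velocity_of_coords]) simp
  thus ?thesis by (auto simp: differential_def chart_velocity_def theta_chart_eq o_def vector_derivative_at)
qed

lemma differential_smooth_fun_TP:
  assumes f: "smooth_fun TP_kahler f"
  shows "\<exists>D. ((\<lambda>t. f (of_coords (y + t *\<^sub>R \<alpha>))) has_vector_derivative D) (at 0) \<and> differential f (tvec_at (of_coords y) \<alpha>) = D"
proof -
  fix k :: 'a
  define z where "z = reduce k y"
  have zm: "z \<in> model k" by (simp add: z_def reduce_in_model)
  have "smooth_on (model k) (model k) (f \<circ> inv_into TP (theta_map k))"
    using f by (auto simp: smooth_fun_def theta_chart_eq theta_map_image)
  then obtain D where D: "((f \<circ> inv_into TP (theta_map k)) has_derivative D) (at z within model k)"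
    using smooth_on_has_derivative[OF subspace_model _ _ zm] by (metis openin_subtopology_self)
  have main: "((\<lambda>t. f (c t)) has_vector_derivative D v) (at 0)"
    if c: "chart_velocity (theta_chart k) c v" and c0: "c 0 = of_coords y" for c v
  proof -
    from c have ev: "\<forall>\<^sub>F t in nhds 0. c t \<in> TP" and d: "((\<lambda>t. theta_map k (c t)) has_vector_derivative v) (at 0)"
      by (auto simp: chart_velocity_def theta_chart_eq)
    obtain \<delta> where \<delta>: "\<delta> > 0" "\<And>t. \<bar>t\<bar> < \<delta> \<Longrightarrow> c t \<in> TP"
      using ev by (auto simp: eventually_nhds_metric dist_real_def)
    define T where "T = {-\<delta><..<\<delta>}"
    have T: "at 0 within T = at 0" "0 \<in> T" unfolding T_def using \<delta> by (auto intro: at_within_open)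
    have inT: "c t \<in> TP" if "t \<in> T" for t using \<delta>(2)[of t] that by (auto simp: T_def)
    have z0: "theta_map k (c 0) = z" by (simp add: c0 theta_map_of_coords z_def)
    have dT: "((\<lambda>t. theta_map k (c t)) has_derivative (\<lambda>t. t *\<^sub>R v)) (at 0 within T)"
      using d by (simp add: T has_vector_derivative_def)
    have sub: "(\<lambda>t. theta_map k (c t)) ` T \<subseteq> model k" using inT theta_map_image by blast
    have "((f \<circ> inv_into TP (theta_map k)) \<circ> (\<lambda>t. theta_map k (c t)) has_derivative D \<circ> (\<lambda>t. t *\<^sub>R v)) (at 0 within T)"
      by (rule diff_chain_within[OF dT]) (use has_derivative_subset[OF D sub] z0 in simp)
    hence "((\<lambda>t. f (c t)) has_derivative D \<circ> (\<lambda>t. t *\<^sub>R v)) (at 0 within T)"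
      by (rule has_derivative_transform[rotated 2])
        (use T inT in \<open>auto simp: inv_into_f_f[OF theta_map_inj]\<close>)
    moreover have "D \<circ> (\<lambda>t. t *\<^sub>R v) = (\<lambda>t. t *\<^sub>R D v)"
      using has_derivative_bounded_linear[OF D] by (auto simp: linear_simps)
    ultimately show ?thesis by (simp add: has_vector_derivative_def T)
  qed
  let ?c = "\<lambda>t. of_coords (y + t *\<^sub>R \<alpha>)"
  have d: "diff_curve TP_kahler ?c" by (rule diff_curve_of_coords)
  note m = velocity_memD[OF TP_diff_manifold d curve_of_velocity[OF TP_diff_manifold d], unfolded tvec_at_of_coords]
  have 1: "((\<lambda>t. f (?c t)) has_vector_derivative D (reduce k \<alpha>)) (at 0)"
    by (rule main[OF chart_velocity_of_coords]) simp
  have 2: "((\<lambda>t. f (curve_of (tvec_at (of_coords y) \<alpha>) t)) has_vector_derivative D (reduce k \<alpha>)) (at 0)"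
    by (rule main[OF m(3)[OF _ chart_velocity_of_coords]]) (use m(2) in auto)
  from 1 2 show ?thesis by (auto simp: differential_def o_def vector_derivative_at)
qed

section \<open>Derivatives of covariances\<close>

text \<open>
  The third joint cumulant, in a form in which it is visibly the derivative of a covariance in the direction \<open>c\<close>
  of the natural parameter.
\<close>

definition cov3 :: "real^'n \<Rightarrow> real^'n \<Rightarrow> real^'n \<Rightarrow> real^'n \<Rightarrow> real" where
  "cov3 p c a b = cov p c (\<chi> i. a $ i * b $ i) - cov p c a * expect p b - expect p a * cov p c b"

lemma cov_sym: "cov p a b = cov p b a"
  by (simp add: cov_def mult.commute)

lemma cov_add: "cov p (a + a') b = cov p a b + cov p a' b"
proof -
  have "(\<chi> i. (a + a') $ i * b $ i) = (\<chi> i. a $ i * b $ i) + (\<chi> i. a' $ i * b $ i)"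
    by (simp add: vec_eq_iff algebra_simps)
  thus ?thesis by (simp add: cov_def expect_add algebra_simps)
qed

lemma cov_scale: "cov p (c *\<^sub>R a) b = c * cov p a b"
proof -
  have "(\<chi> i. (c *\<^sub>R a) $ i * b $ i) = c *\<^sub>R (\<chi> i. a $ i * b $ i)"
    by (simp add: vec_eq_iff algebra_simps)
  thus ?thesis by (simp add: cov_def expect_scale algebra_simps)
qed

lemma cov_axis: "cov p (axis i 1) a = p $ i * (a $ i - expect p a)"
proof -
  have "(\<chi> j. axis i (1::real) $ j * a $ j) = axis i (a $ i)"
    by (simp add: vec_eq_iff axis_def)
  thus ?thesis by (simp add: cov_def expect_axis algebra_simps)
qed

lemma cov_axis': "cov p a (axis i 1) = p $ i * (a $ i - expect p a)"
  by (simp add: cov_sym[of p a] cov_axis)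

lemma cov_zero [simp]: "cov p 0 a = 0" "cov p a 0 = 0"
  using cov_scale[of p 0 0 a] by (auto simp: cov_sym[of p a 0])

lemma cov_shift: "p \<in> prob_pos \<Longrightarrow> cov p (\<chi> i. a $ i - c) b = cov p a b"
proof -
  assume p: "p \<in> prob_pos"
  have "(\<chi> i. (\<chi> i. a $ i - c) $ i * b $ i) = (\<chi> i. a $ i * b $ i) - c *\<^sub>R b"
    by (simp add: vec_eq_iff algebra_simps)
  hence "expect p (\<chi> i. (\<chi> i. a $ i - c) $ i * b $ i) = expect p (\<chi> i. a $ i * b $ i) - c * expect p b"
    by (simp only: expect_diff expect_scale)
  thus ?thesis unfolding cov_def expect_shift[OF p] by (simp only: algebra_simps)
qed

lemma cov_reduce:
  assumes "p \<in> prob_pos"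
  shows "cov p (fst (reduce k z)) b = cov p (fst z) b" "cov p (snd (reduce k z)) b = cov p (snd z) b"
    "cov p b (fst (reduce k z)) = cov p b (fst z)" "cov p b (snd (reduce k z)) = cov p b (snd z)"
  using cov_shift[OF assms] by (auto simp: reduce_def cov_sym[of p b])

lemma cov3_add: "cov3 p (c + c') a b = cov3 p c a b + cov3 p c' a b"
  by (simp add: cov3_def cov_add algebra_simps)

lemma cov3_scale: "cov3 p (r *\<^sub>R c) a b = r * cov3 p c a b"
  by (simp add: cov3_def cov_scale algebra_simps)

lemma cov3_axis: "cov3 p (axis i 1) a b = p $ i * ((a $ i - expect p a) * (b $ i - expect p b) - cov p a b)"
  by (simp add: cov3_def cov_axis cov_def[of p a b] algebra_simps)

text \<open>
  Together with the next lemma: the cumulant is symmetric, and the indicator function of a point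
  is idempotent, which brings \<open>cov3 p e\<^sub>i a e\<^sub>i\<close> down to a covariance.
\<close>

lemma cov3_axis_last: "cov3 p (axis i 1) a (axis i 1) = (1 - 2 * p $ i) * cov p a (axis i 1)"
  by (simp add: cov3_axis cov_axis' expect_axis algebra_simps)

lemma cov3_axis_axis: "cov3 p a (axis i 1) (axis i 1) = (1 - 2 * p $ i) * cov p a (axis i 1)"
proof -
  have "(\<chi> j. axis i (1::real) $ j * axis i 1 $ j) = axis i 1" by (simp add: vec_eq_iff axis_def)
  thus ?thesis by (simp add: cov3_def expect_axis algebra_simps)
qed

lemma cov3_zero [simp]: "cov3 p 0 a b = 0" "cov3 p a 0 b = 0" "cov3 p a b 0 = 0"
  using expect_scale[of p 0 0] by (auto simp: cov3_def zero_vec_def[symmetric])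

lemma has_real_derivative_nth:
  fixes f :: "real \<Rightarrow> real^'n"
  shows "(f has_vector_derivative f') F \<Longrightarrow> ((\<lambda>t. f t $ i) has_real_derivative f' $ i) F"
  unfolding has_vector_derivative_vec by (simp add: has_real_derivative_iff_has_vector_derivative)

lemma expect_softmax_derivative:
  assumes F: "(F has_vector_derivative F') (at t)" and A: "(A has_vector_derivative A') (at t)"
  shows "((\<lambda>t. expect (softmax (F t)) (A t)) has_real_derivative
     cov (softmax (F t)) F' (A t) + expect (softmax (F t)) A') (at t)"
proof -
  define p where "p = softmax (F t)"
  have "((\<lambda>t. expect (softmax (F t)) (A t)) has_real_derivative
      (\<Sum>i\<in>UNIV. p $ i * centre p F' $ i * A t $ i + A' $ i * softmax (F t) $ i)) (at t)"
    unfolding expect_def using has_real_derivative_nth[OF softmax_has_vector_derivative[OF F]] has_real_derivative_nth[OF A]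
    by (intro DERIV_sum DERIV_mult) (auto simp: p_def)
  moreover have "(\<Sum>i\<in>UNIV. p $ i * centre p F' $ i * A t $ i + A' $ i * softmax (F t) $ i) = cov p F' (A t) + expect p A'"
  proof -
    have "(\<Sum>i\<in>UNIV. p $ i * centre p F' $ i * A t $ i + A' $ i * softmax (F t) $ i)
       = (\<Sum>i\<in>UNIV. p $ i * (F' $ i * A t $ i)) - expect p F' * (\<Sum>i\<in>UNIV. p $ i * A t $ i) + (\<Sum>i\<in>UNIV. p $ i * A' $ i)"
      unfolding centre_def p_def[symmetric] sum_distrib_left sum.distrib[symmetric] sum_subtractf[symmetric]
      by (rule sum.cong) (auto simp: algebra_simps)
    thus ?thesis by (simp add: cov_def expect_def)
  qed
  ultimately show ?thesis by (simp add: p_def)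
qed

lemma cov_softmax_derivative:
  assumes F: "(F has_vector_derivative F') (at t)" and A: "(A has_vector_derivative A') (at t)"
  shows "((\<lambda>t. cov (softmax (F t)) (A t) b) has_real_derivative
     cov3 (softmax (F t)) F' (A t) b + cov (softmax (F t)) A' b) (at t)"
proof -
  have Ab: "((\<lambda>t. \<chi> i. A t $ i * b $ i) has_vector_derivative (\<chi> i. A' $ i * b $ i)) (at t)"
    using A unfolding has_vector_derivative_vec
    by (auto intro!: derivative_eq_intros simp: has_real_derivative_iff_has_vector_derivative[symmetric])
  have b: "((\<lambda>t. b) has_vector_derivative 0) (at t)" by simp
  have z: "expect p 0 = 0" for p :: "real^'a" by (simp add: expect_def)
  show ?thesis
    unfolding cov_def[of "softmax (F _)" "A _" b] cov_def[of _ A' b] cov3_def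
    by (rule derivative_eq_intros expect_softmax_derivative[OF F] A Ab b refl)+
      (simp add: z algebra_simps)
qed

section \<open>The Lie derivative of the metric in affine coordinates\<close>

lemma vector_derivative_in_model:
  assumes "((\<lambda>t. reduce k (g t)) has_vector_derivative d) (at 0)"
  shows "d \<in> model k"
proof -
  have 1: "((\<lambda>t. fst (reduce k (g t)) $ k) has_real_derivative fst d $ k) (at 0)"
    "((\<lambda>t. snd (reduce k (g t)) $ k) has_real_derivative snd d $ k) (at 0)"
    using bounded_linear.has_vector_derivative[OF bounded_linear_fst assms] bounded_linear.has_vector_derivative[OF bounded_linear_snd assms]
    by (auto intro: has_real_derivative_nth)
  hence "fst d $ k = 0" "snd d $ k = 0"
    using DERIV_unique[OF 1(1), of 0] DERIV_unique[OF 1(2), of 0] by (auto simp: reduce_def)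
  thus ?thesis by (cases d) (simp add: model_def)
qed

text \<open>
  The coefficients of the metric depend on \<open>\<theta>\<close> only and their derivatives are third cumulants.  The
  field \<open>\<Xi>\<close> gives redundant coordinates of \<open>X\<close>, and covariances do not notice the redundancy.
\<close>

lemma lie_derivative_TP:
  assumes X: "\<And>x. x \<in> TP \<Longrightarrow> X x = tvec_at x (\<Xi> x)"
    and m: "y \<in> model k" "v \<in> model k" "w \<in> model k"
    and dv: "((\<lambda>t. reduce k (\<Xi> (of_coords (y + t *\<^sub>R v)))) has_vector_derivative dv) (at 0)"
    and dw: "((\<lambda>t. reduce k (\<Xi> (of_coords (y + t *\<^sub>R w)))) has_vector_derivative dw) (at 0)"
  defines "p \<equiv> softmax (fst y)" and "\<xi> \<equiv> \<Xi> (of_coords y)"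
  shows "lie_derivative_coord TP_kahler (theta_chart k) X (metric TP_kahler) y v w =
     cov3 p (fst \<xi>) (fst v) (fst w) + cov3 p (fst \<xi>) (snd v) (snd w)
     + cov p (fst dv) (fst w) + cov p (snd dv) (snd w) + cov p (fst v) (fst dw) + cov p (snd v) (snd dw)"
proof -
  have sub: "z + t *\<^sub>R u \<in> model k" if "z \<in> model k" "u \<in> model k" for z u t
    using that subspace_model subspace_add subspace_scale by blast
  define \<xi>' where "\<xi>' z = differential (theta_map k) (X (inv_into TP (theta_map k) z))" for z
  define G where "G z a b = metric TP_kahler (coord_vec TP_kahler (theta_chart k) z a) (coord_vec TP_kahler (theta_chart k) z b)" for z a b
  have \<xi>': "\<xi>' z = reduce k (\<Xi> (of_coords z))" if "z \<in> model k" for z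
    using that by (simp add: \<xi>'_def inv_into_theta_map X of_coords_in_TP differential_theta_map)
  have G: "G z a b = cov (softmax (fst z)) (fst a) (fst b) + cov (softmax (fst z)) (snd a) (snd b)"
    if "z \<in> model k" "a \<in> model k" "b \<in> model k" for z a b
    using that by (simp add: G_def coord_vec_TP metric_TP of_coords_in_TP) (simp add: of_coords_def)
  have p: "p \<in> prob_pos" by (simp add: p_def softmax_in_prob_pos)
  define z where "z = \<xi>' y"
  have zm: "z \<in> model k" by (simp add: z_def \<xi>' m reduce_in_model)
  have F: "((\<lambda>t. fst y + t *\<^sub>R fst z) has_vector_derivative fst z) (at 0)" by (auto intro!: derivative_eq_intros)
  have c: "((\<lambda>t. a) has_vector_derivative 0) (at 0)" for a :: "real^'a" by simp
  have "((\<lambda>t. cov (softmax (fst y + t *\<^sub>R fst z)) (fst v) (fst w) + cov (softmax (fst y + t *\<^sub>R fst z)) (snd v) (snd w))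
     has_real_derivative cov3 p (fst z) (fst v) (fst w) + cov3 p (fst z) (snd v) (snd w)) (at 0)"
    using DERIV_add[OF cov_softmax_derivative[OF F c] cov_softmax_derivative[OF F c]] by (simp add: p_def)
  moreover have "(\<lambda>t. G (y + t *\<^sub>R z) v w) = (\<lambda>t. cov (softmax (fst y + t *\<^sub>R fst z)) (fst v) (fst w) + cov (softmax (fst y + t *\<^sub>R fst z)) (snd v) (snd w))"
    by (rule ext) (simp add: G sub m zm)
  ultimately have 1: "vector_derivative (\<lambda>t. G (y + t *\<^sub>R z) v w) (at 0) = cov3 p (fst z) (fst v) (fst w) + cov3 p (fst z) (snd v) (snd w)"
    by (simp add: vector_derivative_at has_real_derivative_iff_has_vector_derivative)
  have "cov3 p (fst z) a b = cov3 p (fst \<xi>) a b" for a b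
    using m by (simp add: z_def \<xi>' cov3_def cov_reduce[OF p] \<xi>_def)
  moreover have "vector_derivative (\<lambda>t. \<xi>' (y + t *\<^sub>R v)) (at 0) = dv" "vector_derivative (\<lambda>t. \<xi>' (y + t *\<^sub>R w)) (at 0) = dw"
    using dv dw by (simp_all add: \<xi>' sub m vector_derivative_at)
  moreover have "dv \<in> model k" "dw \<in> model k" by (rule vector_derivative_in_model[OF dv], rule vector_derivative_in_model[OF dw])
  ultimately show ?thesis
    unfolding lie_derivative_coord_def theta_chart_eq
    using 1 unfolding G_def \<xi>'_def z_def theta_chart_eq
    by (simp add: Let_def G[unfolded G_def theta_chart_eq] m p_def[symmetric] )
qed

section \<open>Periodicity of Kaehler functions\<close>

abbreviation vshift :: "real^'n \<Rightarrow> 'n::finite tvec \<Rightarrow> 'n tvec" where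
  "vshift m y \<equiv> y + (0, (4 * pi) *\<^sub>R m)"

text \<open>
  The function oscillates around \<open>4 L\<close> with frequency \<open>1/2\<close>.
\<close>

lemma periodic_of_oscillator:
  fixes a g :: "real \<Rightarrow> real"
  assumes a: "\<And>t. (a has_real_derivative g t) (at t)" and g: "\<And>t. (g has_real_derivative L - a t / 4) (at t)"
  shows "a (4 * pi) = a 0"
proof -
  \<comment> \<open>with \<open>sin (t/2)\<close> equal to 0 and \<open>cos (t/2)\<close> to 1 at both ends, this first integral compares the two values\<close>
  define A where "A t = (a t - 4 * L) * cos (t/2) - 2 * g t * sin (t/2)" for t
  have "(A has_real_derivative 0) (at t)" for t
    unfolding A_def[abs_def]
    by (rule derivative_eq_intros a g refl | simp)+ (simp add: field_simps)
  hence "A (4 * pi) = A 0" by (metis DERIV_isconst_all)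
  thus ?thesis by (simp add: A_def)
qed

text \<open>
  The first equation for \<open>fv\<close> makes it a product \<open>\<rho>(s) g(t)\<close> with \<open>\<rho> = \<surd>(p (1 - p))\<close>.  Hence \<open>H\<close> is \<open>\<rho>(s) a(t)\<close> plus a function of
  \<open>s\<close>, and the second equation becomes the oscillator equation for \<open>a\<close>, because
  \<open>\<rho>'' - (1 - 2 p) \<rho>' = - \<rho>/4\<close>.
\<close>

lemma kahler_pde_periodic:
  fixes H fv ft ftt fvv :: "real \<Rightarrow> real \<Rightarrow> real" and p :: "real \<Rightarrow> real"
  assumes p: "\<And>s. (p has_real_derivative p s * (1 - p s)) (at s)" "\<And>s. 0 < p s" "\<And>s. p s < 1"
    and Hv: "\<And>s t. (H s has_real_derivative fv s t) (at t)"
    and Ht: "\<And>s t. ((\<lambda>s. H s t) has_real_derivative ft s t) (at s)"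
    and fvt: "\<And>s t. ((\<lambda>s. fv s t) has_real_derivative (1 - 2 * p s) * fv s t / 2) (at s)"
    and ftt: "\<And>s t. ((\<lambda>s. ft s t) has_real_derivative ftt s t) (at s)"
    and fvv: "\<And>s t. (fv s has_real_derivative fvv s t) (at t)"
    and pde: "\<And>s t. ftt s t - fvv s t = (1 - 2 * p s) * ft s t"
  shows "H 0 (4 * pi) = H 0 0"
proof -
  define \<rho> where "\<rho> s = sqrt (p s * (1 - p s))" for s
  have pos: "p s * (1 - p s) > 0" for s using p(2,3)[of s] by simp
  hence \<rho>pos: "\<rho> s > 0" for s by (simp add: \<rho>_def)
  have \<rho>sq: "p s * (1 - p s) = \<rho> s * \<rho> s" for s using pos[of s] by (simp add: \<rho>_def)
  have d\<rho>: "(\<rho> has_real_derivative (1 - 2 * p s) * \<rho> s / 2) (at s)" for s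
  proof -
    have "((\<lambda>s. p s * (1 - p s)) has_real_derivative (1 - 2 * p s) * (\<rho> s * \<rho> s)) (at s)"
      unfolding \<rho>sq[symmetric] by (rule derivative_eq_intros p refl)+ (simp add: algebra_simps)
    from DERIV_chain'[OF this DERIV_real_sqrt[OF pos]]
    have "(\<rho> has_real_derivative inverse (\<rho> s) / 2 * ((1 - 2 * p s) * (\<rho> s * \<rho> s))) (at s)"
      unfolding \<rho>_def[symmetric] \<rho>_def[abs_def, symmetric] .
    moreover have "inverse (\<rho> s) / 2 * ((1 - 2 * p s) * (\<rho> s * \<rho> s)) = (1 - 2 * p s) * \<rho> s / 2"
    proof -
      have "inverse (\<rho> s) * \<rho> s = 1" using \<rho>pos[of s] by simp
      thus ?thesis by algebra
    qed
    ultimately show ?thesis by metis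
  qed
  \<comment> \<open>normalised to 1 at the base point, so that \<open>fv\<close> there is the other factor\<close>
  define r where "r s = \<rho> s / \<rho> 0" for s
  have r0: "r 0 = 1" using \<rho>pos[of 0] by (simp add: r_def)
  have dr: "(r has_real_derivative (1 - 2 * p s) * r s / 2) (at s)" for s
    using DERIV_cdivide[OF d\<rho>[of s], of "\<rho> 0"] by (simp add: r_def[abs_def] field_simps)
  have fv: "fv s t = r s * fv 0 t" for s t
  proof -
    have "((\<lambda>s. fv s t / \<rho> s) has_real_derivative 0) (at s)" for s
      by (rule derivative_eq_intros fvt d\<rho> refl)+ (use \<rho>pos[of s] in auto)
    hence "fv s t / \<rho> s = fv 0 t / \<rho> 0" by (metis (no_types, lifting) DERIV_isconst_all)
    thus ?thesis using \<rho>pos[of s] \<rho>pos[of 0] by (simp add: r_def field_simps)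
  qed
  define a where "a t = H 0 t - H 0 0" for t
  have a: "(a has_real_derivative fv 0 t) (at t)" for t
    unfolding a_def[abs_def] by (rule derivative_eq_intros Hv refl)+ simp
  have H: "H s t = H s 0 + r s * a t" for s t
  proof -
    have "((\<lambda>t. H s t - r s * a t) has_real_derivative 0) (at t)" for t
      by (rule derivative_eq_intros Hv a refl)+ (simp add: fv[of s t])
    hence "H s t - r s * a t = H s 0 - r s * a 0" by (metis (no_types, lifting) DERIV_isconst_all)
    thus ?thesis by (simp add: a_def)
  qed
  have ft: "ft s t = ft s 0 + (1 - 2 * p s) * r s / 2 * a t" for s t
  proof -
    have "((\<lambda>s. H s 0 + r s * a t) has_real_derivative ft s 0 + (1 - 2 * p s) * r s / 2 * a t) (at s)"
      by (rule derivative_eq_intros Ht dr refl)+ simp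
    thus ?thesis unfolding H[symmetric] using Ht DERIV_unique by blast
  qed
  define r2 where "r2 = - p 0 * (1 - p 0) + (1 - 2 * p 0) * (1 - 2 * p 0) / 4"
  have ftt0: "ftt 0 t = ftt 0 0 + r2 * a t" for t
  proof -
    have "((\<lambda>s. ft s 0 + (1 - 2 * p s) * r s / 2 * a t) has_real_derivative ftt 0 0 + r2 * a t) (at 0)"
      by (rule derivative_eq_intros ftt dr p refl | simp)+ (simp add: r2_def r0 field_simps)
    thus ?thesis unfolding ft[symmetric] using ftt DERIV_unique by blast
  qed
  have "fvv 0 t = (ftt 0 0 - (1 - 2 * p 0) * ft 0 0) - a t / 4" for t
    using pde[of 0 t] ftt0[of t] ft[of 0 t] by (simp add: r2_def r0 field_simps)
  hence "(fv 0 has_real_derivative (ftt 0 0 - (1 - 2 * p 0) * ft 0 0) - a t / 4) (at t)" for t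
    using fvv[of 0 t] by simp
  hence "a (4 * pi) = a 0" by (rule periodic_of_oscillator[OF a])
  thus ?thesis by (simp add: a_def)
qed

text \<open>
  Let \<open>\<xi>\<close> be the Hamiltonian field in coordinates.  Pairing it with \<open>\<partial>/\<partial>\<theta>\<^sub>i\<close> and \<open>\<partial>/\<partial>v\<^sub>i\<close> returns the first derivatives of
  \<open>f\<close>; differentiating these pairings expresses the covariances of the derivatives of \<open>\<xi>\<close> by second
  derivatives of \<open>f\<close> and a third cumulant.  The components of the Lie derivative along
  \<open>(\<partial>/\<partial>\<theta>\<^sub>i, \<partial>/\<partial>\<theta>\<^sub>i)\<close> and \<open>(\<partial>/\<partial>\<theta>\<^sub>i, \<partial>/\<partial>v\<^sub>i)\<close> are then the two equations \<open>2 f\<^bsub>v\<theta>\<^esub> = (1 - 2 p\<^sub>i) f\<^sub>v\<close> and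
  \<open>f\<^bsub>\<theta>\<theta>\<^esub> - f\<^bsub>vv\<^esub> = (1 - 2 p\<^sub>i) f\<^sub>\<theta>\<close> in the plane of \<open>\<theta>\<^sub>i\<close> and \<open>v\<^sub>i\<close>.
\<close>

lemma kahler_function_unit_translation:
  fixes i k :: "'n::finite"
  assumes f: "f \<in> kahler_functions TP_kahler" and ik: "i \<noteq> k" and y0: "y0 \<in> model k"
  shows "f (of_coords (y0 + (0, axis i (4 * pi)))) = f (of_coords y0)"
proof -
  define e1 :: "'n tvec" where "e1 = (axis i 1, 0)"
  define e2 :: "'n tvec" where "e2 = (0, axis i 1)"
  have em: "e1 \<in> model k" "e2 \<in> model k" using ik by (auto simp: e1_def e2_def model_def axis_def)
  obtain X where sf: "smooth_fun TP_kahler f"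
    and X: "\<And>x. x \<in> TP \<Longrightarrow> X x \<in> tangent_space TP_kahler x"
      "\<And>x Y. x \<in> TP \<Longrightarrow> Y \<in> tangent_space TP_kahler x \<Longrightarrow> symp TP_kahler (X x) Y = differential f Y"
    and lie: "lie_derivative_vanishes TP_kahler X (metric TP_kahler)"
    using f by (auto simp: kahler_functions_def)
  define \<Xi> where "\<Xi> x = (proj_push (X x), connector (X x))" for x
  have X\<Xi>: "X x = tvec_at x (\<Xi> x)" if "x \<in> TP" for x
    unfolding \<Xi>_def using tangent_eq_tvec_at(1)[OF X(1)[OF that]] .
  define fh where "fh z = f (of_coords z)" for z
  have Ck: "Ck_on (model k) j (model k) fh" for j
  proof (rule Ck_on_cong[OF subspace_model])
    show "Ck_on (model k) j (model k) (f \<circ> inv_into TP (theta_map k))"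
      using sf by (auto simp: smooth_fun_def theta_chart_eq theta_map_image smooth_on_def)
  qed (auto simp: fh_def inv_into_theta_map)
  obtain fd where fd: "\<And>v x. v \<in> model k \<Longrightarrow> x \<in> model k \<Longrightarrow> dir_deriv fh v x (fd v x)"
    "\<And>v. v \<in> model k \<Longrightarrow> Ck_on (model k) 1 (model k) (fd v)"
    using Ck_on_SucE[OF Ck[of "Suc 1"]] by metis
  have "\<exists>h. \<forall>v\<in>model k. \<forall>x\<in>model k. ((\<lambda>t. fd u (x + t *\<^sub>R v)) has_vector_derivative h v x) (at 0)" if "u \<in> model k" for u
    using Ck_on_SucE[OF fd(2)[OF that, unfolded One_nat_def]] by metis
  then obtain fdd where fdd: "\<And>u v x. u \<in> model k \<Longrightarrow> v \<in> model k \<Longrightarrow> x \<in> model k \<Longrightarrow>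
     ((\<lambda>t. fd u (x + t *\<^sub>R v)) has_vector_derivative fdd u v x) (at 0)"
    by metis
  have sub: "z + t *\<^sub>R u \<in> model k" if "z \<in> model k" "u \<in> model k" for z u t
    using that subspace_model subspace_add subspace_scale by blast
  have shift0: "((\<lambda>s. g (z + s *\<^sub>R u)) has_vector_derivative d) (at s)"
    if "((\<lambda>t. g ((z + s *\<^sub>R u) + t *\<^sub>R u)) has_vector_derivative d) (at 0)" for g :: "'n tvec \<Rightarrow> real" and z u s d
  proof -
    have "((\<lambda>t. g ((z + s *\<^sub>R u) + t *\<^sub>R u)) \<circ> (\<lambda>t. t - s) has_vector_derivative 1 *\<^sub>R d) (at s)"
      by (rule vector_diff_chain_at) (use that in \<open>auto intro!: derivative_eq_intros\<close>)
    moreover have "(\<lambda>t. g ((z + s *\<^sub>R u) + t *\<^sub>R u)) \<circ> (\<lambda>t. t - s) = (\<lambda>s. g (z + s *\<^sub>R u))"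
      by (auto simp: algebra_simps o_def)
    ultimately show ?thesis by simp
  qed
  define P where "P z = softmax (fst z)" for z :: "'n tvec"
  have P: "P z \<in> prob_pos" for z by (simp add: P_def softmax_in_prob_pos)
  define \<xi> where "\<xi> z = reduce k (\<Xi> (of_coords z))" for z
  \<comment> \<open>the symplectic form pairs the field with a coordinate direction\<close>
  have grad: "cov (P z) (fst (\<xi> z)) (snd b) - cov (P z) (snd (\<xi> z)) (fst b) = fd b z" if z: "z \<in> model k" and b: "b \<in> model k" for z b
  proof -
    note T = of_coords_in_TP[of z]
    obtain D where D: "dir_deriv fh b z D" "differential f (tvec_at (of_coords z) b) = D"
      using differential_smooth_fun_TP[OF sf, of z b] unfolding fh_def by blast
    have "D = fd b z" using vector_derivative_unique_at[OF D(1) fd(1)[OF b z]] .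
    hence "symp TP_kahler (X (of_coords z)) (tvec_at (of_coords z) b) = fd b z"
      using X(2)[OF T tvec_at_facts(1)[OF T]] D(2) by simp
    thus ?thesis by (simp add: X\<Xi> T metric_TP \<xi>_def cov_reduce P) (simp add: of_coords_def P_def)
  qed
  have gr: "cov (P z) (fst (\<xi> z)) (axis j 1) = fd (reduce k (0, axis j 1)) z"
    "cov (P z) (snd (\<xi> z)) (axis j 1) = - fd (reduce k (axis j 1, 0)) z" if z: "z \<in> model k" for z j
    using grad[OF z reduce_in_model[of k "(0, axis j 1)"]] grad[OF z reduce_in_model[of k "(axis j 1, 0)"]]
    by (auto simp: cov_reduce[OF P])
  \<comment> \<open>the pairings above determine the field up to a constant, which the normalisation in the chart fixes; the formula shows that the field is differentiable\<close>
  have \<xi>_explicit: "\<xi> z = (\<chi> j. fd (reduce k (0, axis j 1)) z / P z $ j - fd (reduce k (0, axis k 1)) z / P z $ k,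
       \<chi> j. - fd (reduce k (axis j 1, 0)) z / P z $ j + fd (reduce k (axis k 1, 0)) z / P z $ k)" if z: "z \<in> model k" for z
  proof -
    have nz: "P z $ j \<noteq> 0" for j using prob_posD(1)[OF P] by (metis less_irrefl)
    have 0: "fst (\<xi> z) $ k = 0" "snd (\<xi> z) $ k = 0" by (auto simp: \<xi>_def reduce_def)
    have 1: "fst (\<xi> z) $ j - expect (P z) (fst (\<xi> z)) = fd (reduce k (0, axis j 1)) z / P z $ j" for j
      using gr(1)[OF z, of j] nz[of j] by (simp add: cov_axis' field_simps)
    have 2: "snd (\<xi> z) $ j - expect (P z) (snd (\<xi> z)) = - fd (reduce k (axis j 1, 0)) z / P z $ j" for j
      using gr(2)[OF z, of j] nz[of j] by (simp add: cov_axis' field_simps)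
    have "fst (\<xi> z) $ j = fd (reduce k (0, axis j 1)) z / P z $ j - fd (reduce k (0, axis k 1)) z / P z $ k"
      "snd (\<xi> z) $ j = - fd (reduce k (axis j 1, 0)) z / P z $ j + fd (reduce k (axis k 1, 0)) z / P z $ k" for j
      using 1[of j] 1[of k] 2[of j] 2[of k] 0 by auto
    thus ?thesis by (simp add: prod_eq_iff vec_eq_iff)
  qed
  have P_der: "((\<lambda>t. P (z + t *\<^sub>R v)) has_vector_derivative (\<chi> j. P z $ j * centre (P z) (fst v) $ j)) (at 0)" for z v
  proof -
    have "((\<lambda>t. fst z + t *\<^sub>R fst v) has_vector_derivative fst v) (at 0)" by (auto intro!: derivative_eq_intros)
    from softmax_has_vector_derivative[OF this] show ?thesis by (simp add: P_def)
  qed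
  have \<xi>_diff: "\<exists>d. dir_deriv \<xi> v z d" if z: "z \<in> model k" and v: "v \<in> model k" for z v
  proof -
    define q where "q b j t = fd b (z + t *\<^sub>R v) / P (z + t *\<^sub>R v) $ j" for b j t
    have nz: "P z $ j \<noteq> 0" for j using prob_posD(1)[OF P] by (metis less_irrefl)
    have "\<exists>d. (q b j has_real_derivative d) (at 0)" if "b \<in> model k" for b j
      unfolding q_def[abs_def]
      by (rule exI, rule DERIV_divide[OF fdd[OF that v z, folded has_real_derivative_iff_has_vector_derivative] has_real_derivative_nth[OF P_der]])
        (use nz in simp)
    then obtain q' where q': "\<And>b j. b \<in> model k \<Longrightarrow> (q b j has_vector_derivative q' b j) (at 0)"
      unfolding has_real_derivative_iff_has_vector_derivative by metis
    have 1: "((\<lambda>t. \<chi> j. q (reduce k (0, axis j 1)) j t - q (reduce k (0, axis k 1)) k t) has_vector_derivative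
       (\<chi> j. q' (reduce k (0, axis j 1)) j - q' (reduce k (0, axis k 1)) k)) (at 0)"
      unfolding has_vector_derivative_vec by (auto intro!: has_vector_derivative_diff q' reduce_in_model)
    have 2: "((\<lambda>t. \<chi> j. - q (reduce k (axis j 1, 0)) j t + q (reduce k (axis k 1, 0)) k t) has_vector_derivative
       (\<chi> j. - q' (reduce k (axis j 1, 0)) j + q' (reduce k (axis k 1, 0)) k)) (at 0)"
      unfolding has_vector_derivative_vec vec_lambda_beta
      by (intro allI has_vector_derivative_add has_vector_derivative_minus q' reduce_in_model)
    have "(\<lambda>t. \<xi> (z + t *\<^sub>R v)) = (\<lambda>t. (\<chi> j. q (reduce k (0, axis j 1)) j t - q (reduce k (0, axis k 1)) k t,
       \<chi> j. - q (reduce k (axis j 1, 0)) j t + q (reduce k (axis k 1, 0)) k t))"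
      by (rule ext) (simp add: \<xi>_explicit[OF sub[OF z v]] q_def)
    from has_vector_derivative_Pair[OF 1 2, folded this] show ?thesis ..
  qed
  define \<xi>d where "\<xi>d v z = vector_derivative (\<lambda>t. \<xi> (z + t *\<^sub>R v)) (at 0)" for v z
  have \<xi>d: "dir_deriv \<xi> v z (\<xi>d v z)" if "z \<in> model k" "v \<in> model k" for z v
    using \<xi>_diff[OF that] unfolding \<xi>d_def by (auto simp: vector_derivative_at)
  \<comment> \<open>derivatives of the pairings in a direction \<open>v\<close>\<close>
  have rel: "cov3 (P z) (fst v) (fst (\<xi> z)) (axis i 1) + cov (P z) (fst (\<xi>d v z)) (axis i 1) = fdd e2 v z"
    "cov3 (P z) (fst v) (snd (\<xi> z)) (axis i 1) + cov (P z) (snd (\<xi>d v z)) (axis i 1) = - fdd e1 v z"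
    if z: "z \<in> model k" and v: "v \<in> model k" for z v
  proof -
    have F: "((\<lambda>t. fst z + t *\<^sub>R fst v) has_vector_derivative fst v) (at 0)" by (auto intro!: derivative_eq_intros)
    have r: "reduce k (0, axis i 1) = e2" "reduce k (axis i 1, 0) = e1"
      using reduce_id[OF em(1)] reduce_id[OF em(2)] by (auto simp: e1_def e2_def)
    have "((\<lambda>t. cov (P (z + t *\<^sub>R v)) (fst (\<xi> (z + t *\<^sub>R v))) (axis i 1)) has_real_derivative
        cov3 (P z) (fst v) (fst (\<xi> z)) (axis i 1) + cov (P z) (fst (\<xi>d v z)) (axis i 1)) (at 0)"
      using cov_softmax_derivative[OF F bounded_linear.has_vector_derivative[OF bounded_linear_fst \<xi>d[OF z v]]] by (simp add: P_def)
    hence "((\<lambda>t. fd e2 (z + t *\<^sub>R v)) has_vector_derivative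
        cov3 (P z) (fst v) (fst (\<xi> z)) (axis i 1) + cov (P z) (fst (\<xi>d v z)) (axis i 1)) (at 0)"
      by (simp add: gr sub z v r has_real_derivative_iff_has_vector_derivative)
    from vector_derivative_unique_at[OF this fdd[OF em(2) v z]]
    show "cov3 (P z) (fst v) (fst (\<xi> z)) (axis i 1) + cov (P z) (fst (\<xi>d v z)) (axis i 1) = fdd e2 v z" .
    have "((\<lambda>t. cov (P (z + t *\<^sub>R v)) (snd (\<xi> (z + t *\<^sub>R v))) (axis i 1)) has_real_derivative
        cov3 (P z) (fst v) (snd (\<xi> z)) (axis i 1) + cov (P z) (snd (\<xi>d v z)) (axis i 1)) (at 0)"
      using cov_softmax_derivative[OF F bounded_linear.has_vector_derivative[OF bounded_linear_snd \<xi>d[OF z v]]] by (simp add: P_def)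
    hence "((\<lambda>t. - fd e1 (z + t *\<^sub>R v)) has_vector_derivative
        cov3 (P z) (fst v) (snd (\<xi> z)) (axis i 1) + cov (P z) (snd (\<xi>d v z)) (axis i 1)) (at 0)"
      by (simp add: gr sub z v r has_real_derivative_iff_has_vector_derivative)
    from vector_derivative_unique_at[OF this has_vector_derivative_minus[OF fdd[OF em(1) v z]]]
    show "cov3 (P z) (fst v) (snd (\<xi> z)) (axis i 1) + cov (P z) (snd (\<xi>d v z)) (axis i 1) = - fdd e1 v z" .
  qed
  have L: "lie_derivative_coord TP_kahler (theta_chart k) X (metric TP_kahler) z v w = 0"
    if "z \<in> model k" "v \<in> model k" "w \<in> model k" for z v w
  proof -
    have "(TP, theta_map k, model k) \<in> charts TP_kahler" by (simp add: theta_chart_eq[symmetric])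
    with lie that show ?thesis unfolding lie_derivative_vanishes_def theta_chart_eq
      by (fastforce simp: theta_map_image)
  qed
  have LL: "cov3 (P z) (fst (\<xi> z)) (fst v) (fst w) + cov3 (P z) (fst (\<xi> z)) (snd v) (snd w)
     + cov (P z) (fst (\<xi>d v z)) (fst w) + cov (P z) (snd (\<xi>d v z)) (snd w) + cov (P z) (fst v) (fst (\<xi>d w z)) + cov (P z) (snd v) (snd (\<xi>d w z)) = 0"
    if z: "z \<in> model k" and v: "v \<in> model k" and w: "w \<in> model k" for z v w
  proof -
    have "cov3 (P z) (fst (\<xi> z)) a b = cov3 (P z) (fst (\<Xi> (of_coords z))) a b" for a b
      by (simp add: \<xi>_def cov3_def cov_reduce[OF P])
    thus ?thesis
      using lie_derivative_TP[OF X\<Xi> z v w \<xi>d[OF z v, unfolded \<xi>_def] \<xi>d[OF z w, unfolded \<xi>_def]] L[OF z v w]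
      by (simp add: P_def)
  qed
  have pde1: "2 * fdd e2 e1 z = (1 - 2 * P z $ i) * fd e2 z" if z: "z \<in> model k" for z
  proof -
    have c: "cov (P z) (fst (\<xi> z)) (axis i 1) = fd e2 z"
      using gr(1)[OF z, of i] reduce_id[OF em(2)] by (simp add: e2_def)
    have "(1 - 2 * P z $ i) * fd e2 z + 2 * cov (P z) (fst (\<xi>d e1 z)) (axis i 1) = 0"
      using LL[OF z em(1) em(1)] c cov_sym[of "P z" "axis i 1"] by (simp add: e1_def cov3_axis_axis)
    moreover have "(1 - 2 * P z $ i) * fd e2 z + cov (P z) (fst (\<xi>d e1 z)) (axis i 1) = fdd e2 e1 z"
      using rel(1)[OF z em(1)] c by (simp add: e1_def cov3_axis_last)
    ultimately show ?thesis by (simp add: algebra_simps)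
  qed
  have pde2: "fdd e1 e1 z - fdd e2 e2 z = (1 - 2 * P z $ i) * fd e1 z" if z: "z \<in> model k" for z
  proof -
    have c: "cov (P z) (snd (\<xi> z)) (axis i 1) = - fd e1 z"
      using gr(2)[OF z, of i] reduce_id[OF em(1)] by (simp add: e1_def)
    have "cov (P z) (snd (\<xi>d e1 z)) (axis i 1) + cov (P z) (fst (\<xi>d e2 z)) (axis i 1) = 0"
      using LL[OF z em(1) em(2)] cov_sym[of "P z" "axis i 1"] by (simp add: e1_def e2_def)
    moreover have "cov (P z) (fst (\<xi>d e2 z)) (axis i 1) = fdd e2 e2 z"
      using rel(1)[OF z em(2)] by (simp add: e2_def)
    moreover have "- (1 - 2 * P z $ i) * fd e1 z + cov (P z) (snd (\<xi>d e1 z)) (axis i 1) = - fdd e1 e1 z"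
      using rel(2)[OF z em(1)] c by (simp add: e1_def cov3_axis_last algebra_simps)
    ultimately show ?thesis by (simp add: algebra_simps)
  qed
  define z where "z s t = y0 + s *\<^sub>R e1 + t *\<^sub>R e2" for s t
  have zm: "z s t \<in> model k" for s t unfolding z_def using sub em y0 by blast
  have zs: "z s t = (y0 + t *\<^sub>R e2) + s *\<^sub>R e1" for s t by (simp add: z_def algebra_simps)
  have Ds: "((\<lambda>s. g (z s t)) has_real_derivative d) (at s)"
    if "((\<lambda>h. g (z s t + h *\<^sub>R e1)) has_vector_derivative d) (at 0)" for g s t d
    using shift0[of g "y0 + t *\<^sub>R e2" s e1 d] that unfolding zs[symmetric] has_real_derivative_iff_has_vector_derivative .
  have Dt: "((\<lambda>t. g (z s t)) has_real_derivative d) (at t)"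
    if "((\<lambda>h. g (z s t + h *\<^sub>R e2)) has_vector_derivative d) (at 0)" for g s t d
    using shift0[of g "y0 + s *\<^sub>R e1" t e2 d] that unfolding z_def[symmetric] has_real_derivative_iff_has_vector_derivative .
  define p where "p s = P (z s 0) $ i" for s
  have Pz: "P (z s t) $ i = p s" for s t by (simp add: p_def P_def z_def e2_def)
  have "fh (z 0 (4 * pi)) = fh (z 0 0)"
  proof (rule kahler_pde_periodic[where p=p and H="\<lambda>s t. fh (z s t)" and fv="\<lambda>s t. fd e2 (z s t)" and ft="\<lambda>s t. fd e1 (z s t)"
        and fvv="\<lambda>s t. fdd e2 e2 (z s t)" and ftt="\<lambda>s t. fdd e1 e1 (z s t)"])
    fix s t
    show "(p has_real_derivative p s * (1 - p s)) (at s)"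
    proof -
      have "((\<lambda>s. P (z s 0) $ i) has_real_derivative P (z s 0) $ i * centre (P (z s 0)) (fst e1) $ i) (at s)"
        by (rule Ds[of "\<lambda>z. P z $ i"]) (use P_der[of "z s 0" e1] in \<open>simp add: has_vector_derivative_vec\<close>)
      moreover have "centre (P (z s 0)) (fst e1) $ i = 1 - p s"
        by (simp add: e1_def centre_def expect_axis p_def)
      ultimately show ?thesis by (simp add: p_def[abs_def])
    qed
    show "0 < p s" using prob_posD(1)[OF P] by (simp add: p_def)
    have "p s + P (z s 0) $ k \<le> (\<Sum>j\<in>UNIV. P (z s 0) $ j)"
      using sum_mono2[of UNIV "{i, k}" "\<lambda>j. P (z s 0) $ j"] ik prob_posD(1)[OF P[of "z s 0"], THEN less_imp_le] by (simp add: p_def)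
    thus "p s < 1" using prob_posD[OF P[of "z s 0"]] by (smt (verit))
    show "((\<lambda>t. fh (z s t)) has_real_derivative fd e2 (z s t)) (at t)"
      by (rule Dt, rule fd(1)) (use em zm in auto)
    show "((\<lambda>s. fh (z s t)) has_real_derivative fd e1 (z s t)) (at s)"
      by (rule Ds, rule fd(1)) (use em zm in auto)
    have "((\<lambda>s. fd e2 (z s t)) has_real_derivative fdd e2 e1 (z s t)) (at s)"
      by (rule Ds, rule fdd) (use em zm in auto)
    thus "((\<lambda>s. fd e2 (z s t)) has_real_derivative (1 - 2 * p s) * fd e2 (z s t) / 2) (at s)"
      by (rule DERIV_cong) (use pde1[OF zm[of s t]] in \<open>simp add: Pz\<close>)
    show "((\<lambda>s. fd e1 (z s t)) has_real_derivative fdd e1 e1 (z s t)) (at s)"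
      by (rule Ds, rule fdd) (use em zm in auto)
    show "((\<lambda>t. fd e2 (z s t)) has_real_derivative fdd e2 e2 (z s t)) (at t)"
      by (rule Dt, rule fdd) (use em zm in auto)
    show "fdd e1 e1 (z s t) - fdd e2 e2 (z s t) = (1 - 2 * p s) * fd e1 (z s t)"
      using pde2[OF zm[of s t]] by (simp add: Pz)
  qed
  moreover have "(4 * pi) *\<^sub>R e2 = (0, axis i (4 * pi))" by (simp add: e2_def axis_def vec_eq_iff)
  ultimately show ?thesis by (simp add: fh_def z_def)
qed

text \<open>
  Subtracting \<open>m\<^sub>k\<close> from all components of \<open>m\<close> does not change the point, and the remaining
  translation is a finite composition of unit translations in directions other than \<open>k\<close>.
\<close>

lemma kahler_function_lattice_translation:
  fixes m :: "real^'n::finite"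
  assumes f: "f \<in> kahler_functions TP_kahler" and m: "\<And>i. m $ i \<in> \<int>"
  shows "f (of_coords (vshift m y)) = f (of_coords y)"
proof -
  fix k :: 'n
  have one: "f (of_coords (z + (0, axis i (4 * pi * of_int l)))) = f (of_coords z)"
    if ik: "i \<noteq> k" and z: "z \<in> model k" for i l z
    using z
  proof (induction l arbitrary: z rule: int_induct[where k=0])
    case base
    have "axis i (0::real) = (0 :: real^'n)" by (simp add: axis_def vec_eq_iff)
    then show ?case by (simp only: of_int_0 mult_zero_right zero_prod_def[symmetric] add_0_right)
  next
    case (step1 l)
    have m: "z + (0, axis i (4 * pi * of_int l)) \<in> model k"
      using step1.prems ik by (cases z) (auto simp: model_def axis_def)
    have "z + (0, axis i (4 * pi * of_int (l + 1))) = (z + (0, axis i (4 * pi * of_int l))) + (0, axis i (4 * pi))"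
      by (simp add: prod_eq_iff vec_eq_iff axis_def algebra_simps)
    then show ?case using kahler_function_unit_translation[OF f ik m] step1.IH[OF step1.prems] by (simp only:)
  next
    case (step2 l)
    have m: "z + (0, axis i (4 * pi * of_int (l - 1))) \<in> model k"
      using step2.prems ik by (cases z) (auto simp: model_def axis_def)
    have "z + (0, axis i (4 * pi * of_int l)) = (z + (0, axis i (4 * pi * of_int (l - 1)))) + (0, axis i (4 * pi))"
      by (simp add: prod_eq_iff vec_eq_iff axis_def algebra_simps)
    then show ?case using kahler_function_unit_translation[OF f ik m] step2.IH[OF step2.prems] by (simp only:)
  qed
  define r where "r i = m $ i - m $ k" for i
  have r: "r i \<in> \<int>" for i unfolding r_def using m by auto
  define z where "z = reduce k y"
  have zm: "z \<in> model k" by (simp add: z_def reduce_in_model)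
  have "f (of_coords (z + (0, \<Sum>i\<in>S. axis i (4 * pi * r i)))) = f (of_coords z)" if "finite S" "S \<subseteq> UNIV - {k}" for S
    using that
  proof (induction S rule: finite_induct)
    case empty show ?case by (simp add: zero_prod_def[symmetric])
  next
    case (insert i S)
    have mo: "z + (0, \<Sum>i\<in>S. axis i (4 * pi * r i)) \<in> model k"
      using zm insert.prems by (cases z) (auto simp: model_def axis_def intro!: sum.neutral)
    obtain l where l: "r i = of_int l" using r[of i] by (auto elim: Ints_cases)
    have "z + (0, \<Sum>i\<in>insert i S. axis i (4 * pi * r i)) = (z + (0, \<Sum>i\<in>S. axis i (4 * pi * r i))) + (0, axis i (4 * pi * of_int l))"
      using insert.hyps by (simp add: l prod_eq_iff algebra_simps)
    moreover have "i \<noteq> k" "S \<subseteq> UNIV - {k}" using insert.prems by auto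
    ultimately show ?case using one[OF _ mo, of i l] insert.IH by (simp only: simp_thms)
  qed
  from this[of "UNIV - {k}"] have "f (of_coords (z + (0, \<Sum>i\<in>UNIV - {k}. axis i (4 * pi * r i)))) = f (of_coords z)" by simp
  moreover have "reduce k (vshift m y) = z + (0, \<Sum>i\<in>UNIV - {k}. axis i (4 * pi * r i))"
  proof -
    have "(\<Sum>i\<in>UNIV - {k}. axis i (4 * pi * r i)) $ j = 4 * pi * r j" for j
    proof -
      have "(\<Sum>i\<in>UNIV - {k}. axis i (4 * pi * r i)) $ j = (\<Sum>i\<in>UNIV - {k}. if i = j then 4 * pi * r j else 0)"
        by (simp add: axis_def)
      also have "\<dots> = 4 * pi * r j" by (simp add: r_def)
      finally show ?thesis .
    qed
    thus ?thesis by (simp add: z_def reduce_def prod_eq_iff vec_eq_iff r_def algebra_simps)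
  qed
  ultimately show ?thesis by (metis of_coords_reduce z_def)
qed

section \<open>Kaehler functions separating the orbits\<close>

text \<open>
  The pull-back along the covering map of \<open>Re (e\<^bsup>i c/2\<^esup> z\<^sub>a cnj z\<^sub>b) / \<langle>z, z\<rangle>\<close>, a quotient of Hermitian forms.
\<close>

definition interference :: "'n \<Rightarrow> 'n \<Rightarrow> real \<Rightarrow> 'n::finite tvec \<Rightarrow> real" where
  "interference a b c = (\<lambda>(p, u). sqrt (p $ a * p $ b) * cos ((u $ a - u $ b + c) / 2))"

lemma interference_of_coords:
  "interference a b c (of_coords y) =
     exp ((fst y $ a + fst y $ b) / 2) / (\<Sum>j\<in>UNIV. exp (fst y $ j)) * cos ((snd y $ a - snd y $ b + c) / 2)"
proof -
  define S where "S = (\<Sum>j\<in>UNIV. exp (fst y $ j))"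
  have S: "S > 0" unfolding S_def by (rule sum_exp_pos)
  have "softmax (fst y) $ a * softmax (fst y) $ b = (exp ((fst y $ a + fst y $ b) / 2) / S)\<^sup>2"
    by (simp add: softmax_def S_def power2_eq_square exp_add[symmetric])
  hence "sqrt (softmax (fst y) $ a * softmax (fst y) $ b) = exp ((fst y $ a + fst y $ b) / 2) / S"
    using S by simp
  thus ?thesis by (simp add: interference_def of_coords_def centre_def S_def)
qed

text \<open>
  Redundant coordinates of the Hamiltonian field of \<^const>\<open>interference\<close>.  Inverting the metric divides derivatives by
  \<open>p\<^sub>a\<close> and \<open>p\<^sub>b\<close>, and in redundant coordinates the derivative of the normalisation drops out.  Only the ratio
  \<open>p\<^sub>b / p\<^sub>a = e\<^bsup>\<theta>\<^sub>b - \<theta>\<^sub>a\<^esup>\<close> and the angle remain, hence the field is holomorphic in \<open>\<theta> + i v\<close>.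
\<close>

definition interference_gradient :: "'n \<Rightarrow> 'n \<Rightarrow> real \<Rightarrow> 'n::finite tvec \<Rightarrow> 'n tvec" where
  "interference_gradient a b c = (\<lambda>(p, u).
     let A = (u $ a - u $ b + c) / 2 in
     ((- sqrt (p $ b / p $ a) * sin A / 2) *\<^sub>R axis a 1 + (sqrt (p $ a / p $ b) * sin A / 2) *\<^sub>R axis b 1,
      (- sqrt (p $ b / p $ a) * cos A / 2) *\<^sub>R axis a 1 + (- sqrt (p $ a / p $ b) * cos A / 2) *\<^sub>R axis b 1))"

lemma interference_gradient_of_coords:
  fixes y :: "'n::finite tvec"
  shows "interference_gradient a b c (of_coords y) =
    (let A = (snd y $ a - snd y $ b + c) / 2 in
     ((- exp ((fst y $ b - fst y $ a) / 2) * sin A / 2) *\<^sub>R axis a 1 + (exp ((fst y $ a - fst y $ b) / 2) * sin A / 2) *\<^sub>R axis b 1,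
      (- exp ((fst y $ b - fst y $ a) / 2) * cos A / 2) *\<^sub>R axis a 1 + (- exp ((fst y $ a - fst y $ b) / 2) * cos A / 2) *\<^sub>R axis b 1))"
proof -
  have "sqrt (softmax (fst y) $ i / softmax (fst y) $ j) = exp ((fst y $ i - fst y $ j) / 2)" for i j
  proof -
    have "softmax (fst y) $ i / softmax (fst y) $ j = (exp ((fst y $ i - fst y $ j) / 2))\<^sup>2"
      using sum_exp_pos[of "fst y"] by (simp add: softmax_def power2_eq_square exp_add[symmetric] exp_diff)
    thus ?thesis by simp
  qed
  thus ?thesis by (simp add: interference_gradient_def of_coords_def centre_def)
qed

lemma interference_smooth: "smooth_fun TP_kahler (interference a b c)"
proof -
  have "Ck_on (model k) j (model k) (interference a b c \<circ> inv_into TP (theta_map k))" for k j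
  proof (rule Ck_on_cong[OF subspace_model])
    note [simp] = openin_subtopology_self
    note S = subspace_model[of k]
    have O: "openin (top_of_set (model k)) (model k)" by simp
    have l1: "Ck_on (model k) j (model k) (\<lambda>y. fst y $ i)" for i j
      by (intro Ck_on_bounded_linear bounded_linear_compose[OF bounded_linear_vec_nth bounded_linear_fst])
    have l2: "Ck_on (model k) j (model k) (\<lambda>y. snd y $ i)" for i j
      by (intro Ck_on_bounded_linear bounded_linear_compose[OF bounded_linear_vec_nth bounded_linear_snd])
    have h1: "Ck_on (model k) j (model k) (\<lambda>y. exp ((fst y $ a + fst y $ b) / 2))"
      by (intro Ck_on_exp[OF S O] Ck_on_bounded_linear_compose[OF bounded_linear_divide] Ck_on_add l1)
    have h2: "Ck_on (model k) j (model k) (\<lambda>y. inverse (\<Sum>j\<in>UNIV. exp (fst y $ j)))"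
      by (intro Ck_on_inverse[OF S O] Ck_on_sum Ck_on_exp[OF S O] l1)
        (use sum_exp_pos in \<open>metis less_irrefl\<close>)
    have h3: "Ck_on (model k) j (model k) (\<lambda>y. (snd y $ a + (- (snd y $ b)) + c) / 2)"
      by (intro Ck_on_bounded_linear_compose[OF bounded_linear_divide] Ck_on_add Ck_on_const l2
          Ck_on_bounded_linear_compose[OF bounded_linear_minus[OF bounded_linear_ident]])
    have h4: "Ck_on (model k) j (model k) (\<lambda>y. Re (exp (\<i> * complex_of_real ((snd y $ a + (- (snd y $ b)) + c) / 2))))"
      by (intro Ck_on_bounded_linear_compose[OF bounded_linear_Re] Ck_on_exp[OF S O]
          Ck_on_bounded_linear_compose[OF bounded_linear_mult_right] Ck_on_bounded_linear_compose[OF bounded_linear_of_real] h3)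
    show "Ck_on (model k) j (model k) (\<lambda>y. exp ((fst y $ a + fst y $ b) / 2) * inverse (\<Sum>j\<in>UNIV. exp (fst y $ j)) *
       Re (exp (\<i> * complex_of_real ((snd y $ a + (- (snd y $ b)) + c) / 2))))"
      by (intro Ck_on_bilinear[OF S O bounded_bilinear_mult] h1 h2 h4)
    fix y :: "'a tvec" assume "y \<in> model k"
    thus "exp ((fst y $ a + fst y $ b) / 2) * inverse (\<Sum>j\<in>UNIV. exp (fst y $ j)) *
       Re (exp (\<i> * complex_of_real ((snd y $ a + (- (snd y $ b)) + c) / 2))) = (interference a b c \<circ> inv_into TP (theta_map k)) y"
      by (simp add: inv_into_theta_map interference_of_coords Re_exp divide_inverse[of "exp _" "sum _ _"])
  qed simp
  thus ?thesis by (auto simp: smooth_fun_def smooth_on_def theta_chart_eq theta_map_image)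
qed

text \<open>
  The Lie derivative for the field above, divided by \<open>\<surd>(p\<^sub>a p\<^sub>b)\<close>: \<open>S\<close> and \<open>C\<close> are the sine and cosine of the angle, the
  letters \<open>v, w\<close> stand for centred components at \<open>a\<close> and \<open>b\<close>, and \<open>K, L\<close> for the covariances in the cumulants.
\<close>

lemma interference_lie_identity:
  fixes S C K L va vb va' vb' wa wb wa' wb' :: real
  shows "(- S / 2 * (va * wa - K) + S / 2 * (vb * wb - K)) + (- S / 2 * (va' * wa' - L) + S / 2 * (vb' * wb' - L))
    + (- ((vb - va) / 2 * S + (va' - vb') / 2 * C) / 2 * wa + ((va - vb) / 2 * S + (va' - vb') / 2 * C) / 2 * wb)
    + (- ((vb - va) / 2 * C - (va' - vb') / 2 * S) / 2 * wa' + (- ((va - vb) / 2 * C) + (va' - vb') / 2 * S) / 2 * wb')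
    + (- ((wb - wa) / 2 * S + (wa' - wb') / 2 * C) / 2 * va + ((wa - wb) / 2 * S + (wa' - wb') / 2 * C) / 2 * vb)
    + (- ((wb - wa) / 2 * C - (wa' - wb') / 2 * S) / 2 * va' + (- ((wa - wb) / 2 * C) + (wa' - wb') / 2 * S) / 2 * vb') = 0"
  by (simp add: field_simps)

lemma interference_kahler: "interference a b c \<in> kahler_functions (TP_kahler :: ('n::finite tvec, 'n tvec) kahler)"
proof -
  define f :: "'n tvec \<Rightarrow> real" where "f = interference a b c"
  define X where "X x = tvec_at x (interference_gradient a b c x)" for x :: "'n tvec"
  define A where "A z = (snd z $ a - snd z $ b + c) / 2" for z :: "'n tvec"
  define P where "P z = softmax (fst z)" for z :: "'n tvec"
  define R where "R z = exp ((fst z $ a + fst z $ b) / 2) / (\<Sum>j\<in>UNIV. exp (fst z $ j))" for z :: "'n tvec"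
  have PE: "P z $ a * exp ((fst z $ b - fst z $ a) / 2) = R z" "P z $ b * exp ((fst z $ a - fst z $ b) / 2) = R z" for z
    by (simp_all add: P_def softmax_def R_def exp_add[symmetric] field_simps)
  have Pp: "P z \<in> prob_pos" for z by (simp add: P_def softmax_in_prob_pos)
  define g1 where "g1 s u = (- s / 2) *\<^sub>R axis a (1::real) + (u / 2) *\<^sub>R (axis b 1 :: real^'n)" for s u
  have grad: "interference_gradient a b c (of_coords z) =
      (g1 (exp ((fst z $ b - fst z $ a) / 2) * sin (A z)) (exp ((fst z $ a - fst z $ b) / 2) * sin (A z)),
       g1 (exp ((fst z $ b - fst z $ a) / 2) * cos (A z)) (- exp ((fst z $ a - fst z $ b) / 2) * cos (A z)))" for z
    by (simp add: interference_gradient_of_coords g1_def A_def Let_def)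
  have cov_g1: "cov p (g1 s u) w = - (p $ a * s) / 2 * (w $ a - expect p w) + (p $ b * u) / 2 * (w $ b - expect p w)" for p s u w
    unfolding g1_def cov_add cov_scale cov_axis by (simp add: field_simps)
  have cov3_g1: "cov3 p (g1 s u) v w = - (p $ a * s) / 2 * ((v $ a - expect p v) * (w $ a - expect p w) - cov p v w)
     + (p $ b * u) / 2 * ((v $ b - expect p v) * (w $ b - expect p w) - cov p v w)" for p s u v w
    unfolding g1_def cov3_add cov3_scale cov3_axis by (simp add: field_simps)
  define Ea where "Ea z = exp ((fst z $ b - fst z $ a) / 2)" for z :: "'n tvec"
  define Eb where "Eb z = exp ((fst z $ a - fst z $ b) / 2)" for z :: "'n tvec"
  have PE': "P z $ a * (Ea z * s) = R z * s" "P z $ b * (Eb z * s) = R z * s" for z s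
    unfolding mult.assoc[symmetric] Ea_def Eb_def PE by (rule refl)+
  \<comment> \<open>the factors \<open>Ea, Eb\<close> turn the weights \<open>p\<^sub>a, p\<^sub>b\<close> of a covariance into their geometric mean \<open>R\<close>\<close>
  have covE: "cov (P z) (g1 (Ea z * s) (Eb z * u)) w = R z * (- s / 2 * (w $ a - expect (P z) w) + u / 2 * (w $ b - expect (P z) w))" for z s u w
    unfolding cov_g1 PE' by (simp add: field_simps)
  have cov3E: "cov3 (P z) (g1 (Ea z * s) (Eb z * u)) v w = R z * (- s / 2 * ((v $ a - expect (P z) v) * (w $ a - expect (P z) w) - cov (P z) v w)
     + u / 2 * ((v $ b - expect (P z) v) * (w $ b - expect (P z) w) - cov (P z) v w))" for z s u v w
    unfolding cov3_g1 PE' by (simp add: field_simps)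
  have grad': "interference_gradient a b c (of_coords z) =
      (g1 (Ea z * sin (A z)) (Eb z * sin (A z)), g1 (Ea z * cos (A z)) (Eb z * (- cos (A z))))" for z
    by (simp add: grad Ea_def Eb_def)
  have lin: "((\<lambda>t. fst (z + t *\<^sub>R v) $ j) has_real_derivative fst v $ j) (at 0)"
    "((\<lambda>t. snd (z + t *\<^sub>R v) $ j) has_real_derivative snd v $ j) (at 0)" for z v :: "'n tvec" and j
    by (auto intro!: derivative_eq_intros)
  have Ad: "((\<lambda>t. A (z + t *\<^sub>R v)) has_real_derivative (snd v $ a - snd v $ b) / 2) (at 0)" for z v
    unfolding A_def by (rule derivative_eq_intros lin refl)+ simp_all
  have Ead: "((\<lambda>t. Ea (z + t *\<^sub>R v)) has_real_derivative Ea z * ((fst v $ b - fst v $ a) / 2)) (at 0)" for z v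
    unfolding Ea_def using DERIV_fun_exp[OF DERIV_cdivide[OF DERIV_diff[OF lin(1)[of z v b] lin(1)[of z v a]], of 2]] by simp
  have Ebd: "((\<lambda>t. Eb (z + t *\<^sub>R v)) has_real_derivative Eb z * ((fst v $ a - fst v $ b) / 2)) (at 0)" for z v
    unfolding Eb_def using DERIV_fun_exp[OF DERIV_cdivide[OF DERIV_diff[OF lin(1)[of z v a] lin(1)[of z v b]], of 2]] by simp
  have symp: "symp TP_kahler (X x) Y = differential f Y" if x: "x \<in> TP" and Y: "Y \<in> tangent_space TP_kahler x" for x Y
  proof -
    define z where "z = log_coords x"
    have xz: "x = of_coords z" using x by (simp add: z_def of_coords_log_coords)
    define \<beta> where "\<beta> = (proj_push Y, connector Y)"
    have Y': "Y = tvec_at (of_coords z) \<beta>" using tangent_eq_tvec_at(1)[OF Y] by (simp add: \<beta>_def xz)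
    define E1 where "E1 = expect (P z) (fst \<beta>)"
    define S where "S w = (\<Sum>j\<in>UNIV. exp (fst w $ j))" for w :: "'n tvec"
    have S: "S w > 0" for w unfolding S_def by (rule sum_exp_pos)
    have "E1 = (\<Sum>j\<in>UNIV. exp (fst z $ j) * fst \<beta> $ j) / S z"
      by (simp add: E1_def expect_def P_def softmax_def S_def sum_divide_distrib)
    hence E1S: "(\<Sum>j\<in>UNIV. exp (fst z $ j) * fst \<beta> $ j) = E1 * S z" using S[of z] by (simp add: field_simps)
    have dS: "((\<lambda>t. S (z + t *\<^sub>R \<beta>)) has_real_derivative E1 * S z) (at 0)"
      unfolding S_def E1S[symmetric, unfolded S_def]
      by (rule DERIV_sum) (use DERIV_fun_exp[OF lin(1)[of z \<beta>]] in simp)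
    have Rz: "R w = exp ((fst w $ a + fst w $ b) / 2) / S w" for w by (simp add: R_def S_def)
    have N: "((\<lambda>t. exp ((fst (z + t *\<^sub>R \<beta>) $ a + fst (z + t *\<^sub>R \<beta>) $ b) / 2)) has_real_derivative
        exp ((fst z $ a + fst z $ b) / 2) * ((fst \<beta> $ a + fst \<beta> $ b) / 2)) (at 0)"
      using DERIV_fun_exp[OF DERIV_cdivide[OF DERIV_add[OF lin(1)[of z \<beta> a] lin(1)[of z \<beta> b]], of 2]] by simp
    have dR: "((\<lambda>t. R (z + t *\<^sub>R \<beta>)) has_real_derivative R z * ((fst \<beta> $ a + fst \<beta> $ b) / 2 - E1)) (at 0)"
      unfolding Rz
    proof (rule DERIV_cong[OF DERIV_divide[OF N dS]])
      show "S (z + 0 *\<^sub>R \<beta>) \<noteq> 0" using S[of z] by simp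
      define e where "e = exp ((fst z $ a + fst z $ b) / 2)"
      have "e * x * s - e * (y * s) = (e / s * (x - y)) * (s * s)" if "s > 0" for s x y :: real
        using that by (simp add: field_simps)
      from this[OF S[of z]] S[of z]
      show "(exp ((fst z $ a + fst z $ b) / 2) * ((fst \<beta> $ a + fst \<beta> $ b) / 2) * S (z + 0 *\<^sub>R \<beta>)
          - exp ((fst (z + 0 *\<^sub>R \<beta>) $ a + fst (z + 0 *\<^sub>R \<beta>) $ b) / 2) * (E1 * S z)) / (S (z + 0 *\<^sub>R \<beta>) * S (z + 0 *\<^sub>R \<beta>))
        = exp ((fst z $ a + fst z $ b) / 2) / S z * ((fst \<beta> $ a + fst \<beta> $ b) / 2 - E1)"
        by (simp only: scaleR_zero_left add_0_right e_def[symmetric]) simp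
    qed
    have "((\<lambda>t. f (of_coords (z + t *\<^sub>R \<beta>))) has_real_derivative
       R z * ((fst \<beta> $ a + fst \<beta> $ b) / 2 - E1) * cos (A z) - R z * (sin (A z) * ((snd \<beta> $ a - snd \<beta> $ b) / 2))) (at 0)"
      unfolding f_def interference_of_coords R_def[symmetric] A_def[symmetric]
      by (rule derivative_eq_intros dR Ad refl)+ simp_all
    moreover obtain D where "((\<lambda>t. f (of_coords (z + t *\<^sub>R \<beta>))) has_vector_derivative D) (at 0)" "differential f Y = D"
      using differential_smooth_fun_TP[OF interference_smooth, of a b c z \<beta>] unfolding Y' f_def by blast
    ultimately have d: "differential f Y = R z * ((fst \<beta> $ a + fst \<beta> $ b) / 2 - E1) * cos (A z) - R z * (sin (A z) * ((snd \<beta> $ a - snd \<beta> $ b) / 2))"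
      by (simp add: has_real_derivative_iff_has_vector_derivative vector_derivative_unique_at)
    have P: "fst (of_coords z) = P z" by (simp add: of_coords_def P_def)
    have "symp TP_kahler (X x) Y = cov (P z) (g1 (Ea z * sin (A z)) (Eb z * sin (A z))) (snd \<beta>)
        - cov (P z) (g1 (Ea z * cos (A z)) (Eb z * (- cos (A z)))) (fst \<beta>)"
      unfolding X_def Y' xz metric_TP(2)[OF of_coords_in_TP] grad' P by simp
    also have "\<dots> = differential f Y" unfolding covE d E1_def by (simp add: field_simps)
    finally show ?thesis .
  qed
  have lie: "lie_derivative_coord TP_kahler (theta_chart k) X (metric TP_kahler) y v w = 0"
    if m: "y \<in> model k" "v \<in> model k" "w \<in> model k" for k y v w
  proof -
    define s1 where "s1 u = (fst u $ b - fst u $ a) / 2 * sin (A y) + (snd u $ a - snd u $ b) / 2 * cos (A y)" for u :: "'n tvec"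
    define u1 where "u1 u = (fst u $ a - fst u $ b) / 2 * sin (A y) + (snd u $ a - snd u $ b) / 2 * cos (A y)" for u :: "'n tvec"
    define s2 where "s2 u = (fst u $ b - fst u $ a) / 2 * cos (A y) - (snd u $ a - snd u $ b) / 2 * sin (A y)" for u :: "'n tvec"
    define u2 where "u2 u = - ((fst u $ a - fst u $ b) / 2 * cos (A y)) + (snd u $ a - snd u $ b) / 2 * sin (A y)" for u :: "'n tvec"
    \<comment> \<open>the derivative of the field in the direction \<open>u\<close>\<close>
    define d where "d u = (g1 (Ea y * s1 u) (Eb y * u1 u), g1 (Ea y * s2 u) (Eb y * u2 u))" for u
    have g1d: "((\<lambda>t. g1 (p t) (q t)) has_vector_derivative g1 p' q') (at 0)"
      if "(p has_real_derivative p') (at 0)" "(q has_real_derivative q') (at 0)" for p q p' q'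
      unfolding g1_def using that
      by (intro has_vector_derivative_add bounded_linear.has_vector_derivative[OF bounded_linear_scaleR_left])
        (auto intro!: derivative_eq_intros simp: has_real_derivative_iff_has_vector_derivative[symmetric])
    have d: "((\<lambda>t. reduce k (interference_gradient a b c (of_coords (y + t *\<^sub>R u)))) has_vector_derivative reduce k (d u)) (at 0)" for u
    proof (rule bounded_linear.has_vector_derivative[OF bounded_linear_reduce])
      show "((\<lambda>t. interference_gradient a b c (of_coords (y + t *\<^sub>R u))) has_vector_derivative d u) (at 0)"
        unfolding grad' d_def
        by (intro has_vector_derivative_Pair g1d; (rule derivative_eq_intros Ead Ebd Ad refl)+;
            simp add: s1_def s2_def u1_def u2_def field_simps)
    qed
    have X: "X x = tvec_at x (interference_gradient a b c x)" for x by (simp add: X_def)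
    note * = lie_derivative_TP[OF X m d d, folded P_def, unfolded cov_reduce[OF Pp]]
    have "lie_derivative_coord TP_kahler (theta_chart k) X (metric TP_kahler) y v w =
       cov3 (P y) (g1 (Ea y * sin (A y)) (Eb y * sin (A y))) (fst v) (fst w)
     + cov3 (P y) (g1 (Ea y * sin (A y)) (Eb y * sin (A y))) (snd v) (snd w)
     + cov (P y) (g1 (Ea y * s1 v) (Eb y * u1 v)) (fst w) + cov (P y) (g1 (Ea y * s2 v) (Eb y * u2 v)) (snd w)
     + cov (P y) (g1 (Ea y * s1 w) (Eb y * u1 w)) (fst v) + cov (P y) (g1 (Ea y * s2 w) (Eb y * u2 w)) (snd v)"
      unfolding * grad' d_def fst_conv snd_conv
      using cov_sym[of "P y" "fst v"] cov_sym[of "P y" "snd v"] by simp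
    also have "\<dots> = 0"
    proof -
      define va where "va = fst v $ a - expect (P y) (fst v)"
      define vb where "vb = fst v $ b - expect (P y) (fst v)"
      define va' where "va' = snd v $ a - expect (P y) (snd v)"
      define vb' where "vb' = snd v $ b - expect (P y) (snd v)"
      define wa where "wa = fst w $ a - expect (P y) (fst w)"
      define wb where "wb = fst w $ b - expect (P y) (fst w)"
      define wa' where "wa' = snd w $ a - expect (P y) (snd w)"
      define wb' where "wb' = snd w $ b - expect (P y) (snd w)"
      have e: "fst v $ b - fst v $ a = vb - va" "fst v $ a - fst v $ b = va - vb" "snd v $ a - snd v $ b = va' - vb'"
        "fst w $ b - fst w $ a = wb - wa" "fst w $ a - fst w $ b = wa - wb" "snd w $ a - snd w $ b = wa' - wb'"
        by (simp_all add: va_def vb_def va'_def vb'_def wa_def wb_def wa'_def wb'_def)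
      show ?thesis
        unfolding covE cov3E s1_def s2_def u1_def u2_def e
        unfolding va_def[symmetric] vb_def[symmetric] va'_def[symmetric] vb'_def[symmetric]
          wa_def[symmetric] wb_def[symmetric] wa'_def[symmetric] wb'_def[symmetric]
          distrib_left[symmetric] interference_lie_identity by simp
    qed
    finally show ?thesis .
  qed
  have "lie_derivative_vanishes TP_kahler X (metric TP_kahler)"
    using theta_map_image by (fastforce simp: lie_derivative_vanishes_def theta_chart_eq intro!: lie[unfolded theta_chart_eq])
  moreover have "X x \<in> tangent_space TP_kahler x" if "x \<in> TP" for x
    unfolding X_def by (rule tvec_at_facts(1)[OF that])
  ultimately show ?thesis
    unfolding kahler_functions_def TP_kahler_simps
    by (intro CollectI conjI exI[of _ X] ballI interference_smooth symp[unfolded f_def])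
qed

section \<open>Complex projective space\<close>

lemma line_eqD:
  assumes "z \<noteq> 0" "w \<noteq> 0" "line z = line w"
  obtains c where "c \<noteq> 0" "w = c *s z"
proof -
  have "vec.span {z} = vec.span {w}"
    using assms unfolding line_def by (subst (asm) Abs_cproj_inject) auto
  moreover have "w \<in> vec.span {w}" by (simp add: vec.span_base)
  ultimately obtain c where "w = c *s z" unfolding vec.span_singleton by auto
  moreover have "c \<noteq> 0" using calculation assms(2) by auto
  ultimately show thesis using that by blast
qed

lemma line_scale:
  assumes "c \<noteq> 0"
  shows "line (c *s z) = line z"
proof -
  have "range (\<lambda>k. k *s (c *s z)) = range (\<lambda>k. k *s z)"
  proof (intro equalityI image_subsetI)
    fix k
    show "k *s (c *s z) \<in> range (\<lambda>k. k *s z)" by auto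
    have "k *s z = (k / c) *s (c *s z)" using assms by simp
    thus "k *s z \<in> range (\<lambda>k. k *s (c *s z))" by blast
  qed
  thus ?thesis by (simp add: line_def vec.span_singleton)
qed

lemma line_cases: obtains z where "z \<noteq> 0" "L = line z"
  by (cases L) (auto simp: line_def)

lemma herm_add: "herm u (z + w) = herm u z + herm u w"
  by (simp add: herm_def sum.distrib algebra_simps)

lemma herm_diff: "herm u (z - w) = herm u z - herm u w"
  by (simp add: herm_def sum_subtractf algebra_simps)

lemma herm_scale: "herm u (c *s z) = c * herm u z"
  by (simp add: herm_def sum_distrib_left algebra_simps)

lemma herm_scaleR: "herm u (r *\<^sub>R z) = r *\<^sub>R herm u z"
  by (simp add: herm_def scaleR_sum_right)

lemma herm_zero [simp]: "herm u 0 = 0" by (simp add: herm_def)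

lemma herm_self: "herm u u = complex_of_real ((norm u)\<^sup>2)"
proof -
  have "(norm u)\<^sup>2 = (\<Sum>i\<in>UNIV. (cmod (u $ i))\<^sup>2)"
    by (simp add: norm_vec_def L2_set_def sum_nonneg)
  thus ?thesis by (simp add: herm_def complex_norm_square mult.commute del: of_real_power)
qed

lemma bounded_linear_herm: "bounded_linear (herm u)"
  unfolding linear_conv_bounded_linear[symmetric]
  by (rule linearI) (auto simp: herm_add herm_scaleR)

lemma norm_vec_complex_scale: "norm (c *s (z :: complex^'n)) = cmod c * norm z"
  by (simp add: norm_vec_def L2_set_def norm_mult power_mult_distrib sum_distrib_left[symmetric] real_sqrt_mult)

lemma unit_representative: obtains u where "norm u = 1" "line u = L"
proof -
  obtain z where z: "z \<noteq> 0" "L = line z" by (rule line_cases)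
  have "norm ((1 / complex_of_real (norm z)) *s z) = 1" using z by (simp add: norm_vec_complex_scale norm_divide)
  moreover have "line ((1 / complex_of_real (norm z)) *s z) = L" using z by (simp add: line_scale)
  ultimately show thesis using that by blast
qed

lemma unit_chart_map_line:
  assumes "z \<noteq> 0"
  shows "unit_chart_map u (line z) = (1 / herm u z) *s z - u"
proof -
  define w where "w = (SOME w. w \<noteq> 0 \<and> line w = line z)"
  have "w \<noteq> 0 \<and> line w = line z" unfolding w_def by (rule someI[of _ z]) (use assms in simp)
  then obtain c where c: "c \<noteq> 0" "w = c *s z" using line_eqD[of z w] assms by metis
  thus ?thesis unfolding unit_chart_map_def w_def[symmetric] by (simp add: Let_def herm_scale)
qed

definition perp :: "complex^'n::finite \<Rightarrow> (complex^'n) set" where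
  "perp u = {\<xi>. herm u \<xi> = 0}"

text \<open>
  A chart domain of the projective space, cut down to the lines without vanishing coordinates.
\<close>

definition unit_dom :: "complex^'n::finite \<Rightarrow> 'n cproj set" where
  "unit_dom u = {line z |z. herm u z \<noteq> 0} \<inter> cproj_units"

definition unit_image :: "complex^'n::finite \<Rightarrow> (complex^'n) set" where
  "unit_image u = {\<xi> \<in> perp u. \<forall>i. (u + \<xi>) $ i \<noteq> 0}"

lemma subspace_perp: "subspace (perp u)"
  by (auto simp: subspace_def perp_def herm_add herm_scaleR)

lemma all_nonzero_imp_nonzero: "(\<And>i. z $ i \<noteq> 0) \<Longrightarrow> z \<noteq> (0::complex^'n)"
  by auto

lemma line_in_units_iff:
  assumes "z \<noteq> 0"
  shows "line z \<in> cproj_units \<longleftrightarrow> (\<forall>i. z $ i \<noteq> 0)"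
proof
  assume "line z \<in> cproj_units"
  then obtain w where w: "line z = line w" "\<forall>i. w $ i \<noteq> 0" by (auto simp: cproj_units_def)
  have "w \<noteq> 0" using w(2) all_nonzero_imp_nonzero by blast
  from line_eqD[OF assms this w(1)] w(2) show "\<forall>i. z $ i \<noteq> 0" by (metis mult_zero_right vector_smult_component)
qed (auto simp: cproj_units_def)

lemma line_in_unit_dom_iff:
  assumes "\<And>i. z $ i \<noteq> 0"
  shows "line z \<in> unit_dom u \<longleftrightarrow> herm u z \<noteq> 0"
proof
  have z: "z \<noteq> 0" using all_nonzero_imp_nonzero assms by blast
  assume "line z \<in> unit_dom u"
  then obtain w where w: "line z = line w" "herm u w \<noteq> 0" by (auto simp: unit_dom_def)
  have "w \<noteq> 0" using w(2) by auto
  from line_eqD[OF z this w(1)] w(2) show "herm u z \<noteq> 0" by (metis herm_scale mult_zero_right)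
qed (use assms in \<open>auto simp: unit_dom_def cproj_units_def\<close>)

lemma unit_image_nonzero: "\<xi> \<in> unit_image u \<Longrightarrow> u + \<xi> \<noteq> 0"
  by (auto simp: unit_image_def intro!: all_nonzero_imp_nonzero)

lemma herm_unit_image: "norm u = 1 \<Longrightarrow> \<xi> \<in> unit_image u \<Longrightarrow> herm u (u + \<xi>) = 1"
  by (simp add: unit_image_def perp_def herm_add herm_self)

lemma line_unit_image: "norm u = 1 \<Longrightarrow> \<xi> \<in> unit_image u \<Longrightarrow> line (u + \<xi>) \<in> unit_dom u"
  by (subst line_in_unit_dom_iff) (auto simp: herm_unit_image, auto simp: unit_image_def)

lemma unit_chart_map_line_image: "norm u = 1 \<Longrightarrow> \<xi> \<in> unit_image u \<Longrightarrow> unit_chart_map u (line (u + \<xi>)) = \<xi>"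
  by (simp add: unit_chart_map_line unit_image_nonzero herm_unit_image)

lemma unit_dom_cases:
  assumes u: "norm u = 1" and L: "L \<in> unit_dom u"
  shows "unit_chart_map u L \<in> unit_image u" "line (u + unit_chart_map u L) = L"
proof -
  obtain z where z: "L = line z" "herm u z \<noteq> 0" "L \<in> cproj_units" using L by (auto simp: unit_dom_def)
  have z0: "z \<noteq> 0" using z(2) by auto
  hence zi: "\<And>i. z $ i \<noteq> 0" using line_in_units_iff z by blast
  have e: "unit_chart_map u L = (1 / herm u z) *s z - u" using z0 z(1) unit_chart_map_line by simp
  show "unit_chart_map u L \<in> unit_image u"
    using z(2) zi u by (auto simp: e unit_image_def perp_def herm_diff herm_scale herm_self)
  show "line (u + unit_chart_map u L) = L" unfolding e by (simp add: z(1,2) line_scale)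
qed

lemma unit_chart_map_inj: "norm u = 1 \<Longrightarrow> inj_on (unit_chart_map u) (unit_dom u)"
  by (rule inj_on_inverseI[of _ "\<lambda>\<xi>. line (u + \<xi>)"]) (rule unit_dom_cases(2))

lemma unit_chart_map_image: "norm u = 1 \<Longrightarrow> unit_chart_map u ` unit_dom u = unit_image u"
  by (auto simp: unit_dom_cases(1) intro!: rev_image_eqI line_unit_image simp: unit_chart_map_line_image)

lemma inv_into_unit_chart_map:
  "norm u = 1 \<Longrightarrow> \<xi> \<in> unit_image u \<Longrightarrow> inv_into (unit_dom u) (unit_chart_map u) \<xi> = line (u + \<xi>)"
  by (rule inv_into_f_eq[OF unit_chart_map_inj]) (auto simp: line_unit_image unit_chart_map_line_image)

lemma openin_unit_image:
  fixes u :: "complex^'n::finite"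
  shows "openin (top_of_set (perp u)) (unit_image u)"
proof -
  have "open {\<xi> :: complex^'n. \<forall>i. (u + \<xi>) $ i \<noteq> 0}"
  proof -
    have "{\<xi> :: complex^'n. \<forall>i. (u + \<xi>) $ i \<noteq> 0} = (\<Inter>i. {\<xi>. (u + \<xi>) $ i \<noteq> 0})" by auto
    moreover have "open (\<Inter>i. {\<xi> :: complex^'n. (u + \<xi>) $ i \<noteq> 0})"
      by (intro open_INT finite ballI open_Collect_neq continuous_intros)
    ultimately show ?thesis by simp
  qed
  moreover have "unit_image u = perp u \<inter> {\<xi>. \<forall>i. (u + \<xi>) $ i \<noteq> 0}" by (auto simp: unit_image_def)
  ultimately show ?thesis by (metis openin_open_Int)
qed

definition units_kahler :: "('n::finite cproj, complex^'n) kahler" where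
  "units_kahler = rescale 4 (open_submanifold fubini_study cproj_units)"

lemma units_kahler_simps:
  "points units_kahler = cproj_units"
  "charts units_kahler = {(unit_dom u, unit_chart_map u, perp u) |u. norm u = 1}"
  "metric units_kahler X Y = 4 * Re (herm (horizontal X) (horizontal Y))"
  "symp units_kahler X Y = 4 * Im (herm (horizontal X) (horizontal Y))"
  by (auto simp: units_kahler_def rescale_def open_submanifold_def fubini_study_def cproj_manifold_def
      unit_chart_def unit_dom_def perp_def image_def)

lemma unit_dom_units: "L \<in> unit_dom u \<Longrightarrow> L \<in> cproj_units"
  by (simp add: unit_dom_def)

lemma units_chartI: "norm u = 1 \<Longrightarrow> (unit_dom u, unit_chart_map u, perp u) \<in> charts units_kahler"
  by (auto simp: units_kahler_simps)

lemma units_atlas: "manifold_atlas (units_kahler :: ('n::finite cproj, complex^'n) kahler)"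
proof -
  have *: "\<exists>u. norm u = 1 \<and> L \<in> unit_dom u" if L: "L \<in> cproj_units" for L :: "'n cproj"
  proof -
    obtain u where u: "norm u = 1" "line u = L" by (rule unit_representative)
    moreover have "u \<noteq> 0" using u by auto
    ultimately have "\<And>i. u $ i \<noteq> 0" using line_in_units_iff L by blast
    thus ?thesis using u line_in_unit_dom_iff[of u u] by (auto simp: herm_self)
  qed
  show ?thesis
    unfolding manifold_atlas_def
  proof (intro conjI ballI)
    fix L :: "'n cproj" assume "L \<in> points units_kahler"
    hence "L \<in> cproj_units" by (simp add: units_kahler_simps)
    with * obtain u where u: "norm u = 1" "L \<in> unit_dom u" by blast
    show "\<exists>(U, \<phi>, W)\<in>charts units_kahler. L \<in> U"
      by (rule bexI[OF _ units_chartI[OF u(1)]]) (simp add: u(2))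
  qed (auto simp: units_kahler_simps subspace_perp unit_chart_map_inj unit_chart_map_image openin_unit_image unit_dom_units)
qed

lemma Ck_on_unit_chart:
  fixes Z :: "'e::euclidean_space \<Rightarrow> complex^'n"
  assumes W: "subspace W" and S: "openin (top_of_set W) S" and Z: "Ck_on W k S Z"
    and nz: "\<And>x. x \<in> S \<Longrightarrow> herm u (Z x) \<noteq> 0"
  shows "Ck_on W k S (\<lambda>x. (1 / herm u (Z x)) *s Z x - u)"
proof (rule Ck_on_vec)
  fix i
  have "Ck_on W k S (\<lambda>x. inverse (herm u (Z x)) * Z x $ i + (- u $ i))"
    by (intro Ck_on_add Ck_on_const Ck_on_bilinear[OF W S bounded_bilinear_mult] Ck_on_inverse[OF W S nz]
        Ck_on_bounded_linear_compose[OF bounded_linear_herm] Ck_on_bounded_linear_compose[OF bounded_linear_vec_nth] Z)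
  thus "Ck_on W k S (\<lambda>x. ((1 / herm u (Z x)) *s Z x - u) $ i)"
    by (simp add: divide_inverse)
qed

text \<open>In homogeneous coordinates \<open>Z\<close>, the map after a projective chart is \<open>Z\<close> divided by a linear form in \<open>Z\<close>.\<close>

lemma smooth_map_to_units:
  fixes M :: "('a, 'e::euclidean_space, 'm) manifold_scheme" and f :: "'a \<Rightarrow> 'n::finite cproj"
  assumes M: "manifold_atlas M"
    and Z: "\<And>U \<phi> W. (U, \<phi>, W) \<in> charts M \<Longrightarrow> \<exists>Z. (\<forall>k. Ck_on W k (\<phi> ` U) Z) \<and>
       (\<forall>y\<in>\<phi> ` U. (\<forall>i. Z y $ i \<noteq> 0) \<and> f (inv_into U \<phi> y) = line (Z y))"
  shows "smooth_map M units_kahler f"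
  unfolding smooth_map_def
proof (intro conjI ballI, goal_cases)
  case 1
  have "f x \<in> cproj_units" if x: "x \<in> points M" for x
  proof -
    obtain U \<phi> W where ch: "(U, \<phi>, W) \<in> charts M" "x \<in> U" using manifold_atlas_chart_at[OF M x] .
    obtain Z where "\<forall>y\<in>\<phi> ` U. (\<forall>i. Z y $ i \<noteq> 0) \<and> f (inv_into U \<phi> y) = line (Z y)" using Z[OF ch(1)] by blast
    hence "\<forall>i. Z (\<phi> x) $ i \<noteq> 0" "f x = line (Z (\<phi> x))" using ch(2) manifold_atlasD(3)[OF M ch(1)] by auto
    thus ?thesis by (auto simp: cproj_units_def)
  qed
  then show ?case by (auto simp: units_kahler_simps)
next
  case (2 \<kappa>)
  obtain U \<phi> W where k: "\<kappa> = (U, \<phi>, W)" by (cases \<kappa>)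
  note ch = 2[unfolded k]
  note a = manifold_atlasD[OF M ch]
  obtain Z where Z: "\<And>k. Ck_on W k (\<phi> ` U) Z" "\<And>y i. y \<in> \<phi> ` U \<Longrightarrow> Z y $ i \<noteq> 0"
    "\<And>y. y \<in> \<phi> ` U \<Longrightarrow> f (inv_into U \<phi> y) = line (Z y)" using assms(2)[OF ch] by blast
  have main: "openin (top_of_set W) (\<phi> ` (U \<inter> f -` unit_dom u)) \<and>
      smooth_on W (\<phi> ` (U \<inter> f -` unit_dom u)) (unit_chart_map u \<circ> f \<circ> inv_into U \<phi>)" for u
  proof -
    define S where "S = \<phi> ` (U \<inter> f -` unit_dom u)"
    have S: "S = \<phi> ` U \<inter> (\<lambda>y. herm u (Z y)) -` (- {0})"
    proof -
      have "f x \<in> unit_dom u \<longleftrightarrow> herm u (Z (\<phi> x)) \<noteq> 0" if "x \<in> U" for x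
        using that Z(2,3)[of "\<phi> x"] a(3) line_in_unit_dom_iff[of "Z (\<phi> x)" u] by auto
      thus ?thesis by (auto simp: S_def)
    qed
    have "continuous_on (\<phi> ` U) (\<lambda>y. herm u (Z y))"
      using Ck_on_bounded_linear_compose[OF bounded_linear_herm Z(1)[of 0]] by simp
    hence "openin (top_of_set (\<phi> ` U)) S"
      unfolding S by (intro continuous_openin_preimage_gen) auto
    hence oS: "openin (top_of_set W) S" using a(4) openin_trans by blast
    have "Ck_on W k S (unit_chart_map u \<circ> f \<circ> inv_into U \<phi>)" for k
    proof (rule Ck_on_cong[OF a(1) oS])
      show "Ck_on W k S (\<lambda>y. (1 / herm u (Z y)) *s Z y - u)"
        by (rule Ck_on_unit_chart[OF a(1) oS Ck_on_subset[OF Z(1)]]) (auto simp: S)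
      fix y assume "y \<in> S"
      hence y: "y \<in> \<phi> ` U" by (simp add: S)
      moreover have "Z y \<noteq> 0" using Z(2)[OF y] by (intro all_nonzero_imp_nonzero)
      ultimately show "(1 / herm u (Z y)) *s Z y - u = (unit_chart_map u \<circ> f \<circ> inv_into U \<phi>) y"
        by (simp add: Z(3) unit_chart_map_line)
    qed
    with oS show ?thesis by (simp add: S_def smooth_on_def)
  qed
  show ?case unfolding k using main by (auto simp: units_kahler_simps)
qed

lemma units_diff_manifold: "diff_manifold (units_kahler :: ('n::finite cproj, complex^'n) kahler)"
proof -
  have "smooth_map (units_kahler :: ('n cproj, complex^'n) kahler) units_kahler (\<lambda>x. x)"
  proof (rule smooth_map_to_units[OF units_atlas])
    fix U \<phi> W assume "(U, \<phi>, W) \<in> charts (units_kahler :: ('n cproj, complex^'n) kahler)"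
    then obtain u where u: "norm u = 1" "U = unit_dom u" "\<phi> = unit_chart_map u" "W = perp u" by (auto simp: units_kahler_simps)
    have "Ck_on W k (\<phi> ` U) (\<lambda>\<xi>. u + \<xi>)" for k
      by (intro Ck_on_add Ck_on_const Ck_on_bounded_linear bounded_linear_ident)
    thus "\<exists>Z. (\<forall>k. Ck_on W k (\<phi> ` U) Z) \<and> (\<forall>y\<in>\<phi> ` U. (\<forall>i. Z y $ i \<noteq> 0) \<and> inv_into U \<phi> y = line (Z y))"
      using u by (intro exI[of _ "\<lambda>\<xi>. u + \<xi>"]) (auto simp: unit_chart_map_image inv_into_unit_chart_map, auto simp: unit_image_def)
  qed
  thus ?thesis using smooth_map_imp_diff_map[OF units_atlas] units_atlas by (auto simp: diff_manifold_def)
qed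

subsection \<open>Tangent vectors of the open submanifold\<close>

text \<open>
  A smooth curve that starts in an open subset stays there for a short time.
\<close>

lemma tangent_space_open_submanifold:
  fixes M :: "('a, 'e::euclidean_space) kahler"
  assumes M: "\<And>U \<phi> W. (U, \<phi>, W) \<in> charts M \<Longrightarrow> inj_on \<phi> U \<and> \<phi> ` U \<subseteq> W \<and> openin (top_of_set W) (\<phi> ` (U \<inter> S))"
    and x: "x \<in> S"
  shows "tangent_space (open_submanifold M S) x = tangent_space M x"
proof -
  have ch: "charts (open_submanifold M S) = (\<lambda>(U, \<phi>, W). (U \<inter> S, \<phi>, W)) ` charts M"
    by (simp add: open_submanifold_def)
  have sc: "smooth_curve (open_submanifold M S) c \<longleftrightarrow> smooth_curve M c" if c0: "c 0 \<in> S" for c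
  proof
    assume "smooth_curve (open_submanifold M S) c"
    then obtain U \<phi> W \<epsilon> where k: "(U, \<phi>, W) \<in> charts M" "\<epsilon> > 0" "c ` {-\<epsilon><..<\<epsilon>} \<subseteq> U \<inter> S" "smooth_on UNIV {-\<epsilon><..<\<epsilon>} (\<phi> \<circ> c)"
      unfolding smooth_curve_def ch by auto
    thus "smooth_curve M c" unfolding smooth_curve_def by (intro bexI[OF _ k(1)]) auto
  next
    assume "smooth_curve M c"
    then obtain U \<phi> W \<epsilon> where k: "(U, \<phi>, W) \<in> charts M" "\<epsilon> > 0" "c ` {-\<epsilon><..<\<epsilon>} \<subseteq> U" "smooth_on UNIV {-\<epsilon><..<\<epsilon>} (\<phi> \<circ> c)"
      by (auto simp: smooth_curve_def)
    obtain A where A: "open A" "\<phi> ` (U \<inter> S) = W \<inter> A" using M[OF k(1)] by (auto simp: openin_open)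
    have "Ck_on UNIV 0 {-\<epsilon><..<\<epsilon>} (\<phi> \<circ> c)" using k(4) unfolding smooth_on_def by blast
    hence "continuous_on {-\<epsilon><..<\<epsilon>} (\<phi> \<circ> c)" by simp
    hence "open ({-\<epsilon><..<\<epsilon>} \<inter> (\<phi> \<circ> c) -` A)" using A(1) by (intro continuous_open_preimage) auto
    moreover have "0 \<in> {-\<epsilon><..<\<epsilon>} \<inter> (\<phi> \<circ> c) -` A" using c0 k A by force
    ultimately obtain \<delta> where \<delta>: "\<delta> > 0" "\<And>t. \<bar>t\<bar> < \<delta> \<Longrightarrow> t \<in> {-\<epsilon><..<\<epsilon>} \<inter> (\<phi> \<circ> c) -` A"
      unfolding open_dist by (metis dist_0_norm dist_commute real_norm_def)
    have "c t \<in> U \<inter> S" if "\<bar>t\<bar> < \<delta>" for t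
    proof -
      have ct: "c t \<in> U" "\<phi> (c t) \<in> A" using \<delta>(2)[OF that] k(3) by auto
      hence "\<phi> (c t) \<in> \<phi> ` (U \<inter> S)" using A(2) M[OF k(1)] by auto
      with ct M[OF k(1)] show ?thesis by (metis IntI image_iff inj_on_def IntD1 IntD2)
    qed
    hence "c ` {-\<delta><..<\<delta>} \<subseteq> U \<inter> S" by auto
    moreover have "smooth_on UNIV {-\<delta><..<\<delta>} (\<phi> \<circ> c)"
    proof -
      have "{-\<delta><..<\<delta>} \<subseteq> {-\<epsilon><..<\<epsilon>}" using \<delta>(2) by (auto simp: abs_less_iff)
      thus ?thesis using k(4) Ck_on_subset unfolding smooth_on_def by blast
    qed
    moreover have "(U \<inter> S, \<phi>, W) \<in> (\<lambda>(U, \<phi>, W). (U \<inter> S, \<phi>, W)) ` charts M" using k(1) by (rule rev_image_eqI) simp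
    ultimately show "smooth_curve (open_submanifold M S) c"
      unfolding smooth_curve_def ch using \<delta>(1) by (intro bexI) auto
  qed
  have v: "velocity (open_submanifold M S) c = velocity M c" if c0: "c 0 \<in> S" for c
    unfolding velocity_def ch using c0 sc by (auto 0 4 split: prod.splits)
  show ?thesis
  proof (intro equalityI subsetI)
    fix X assume "X \<in> tangent_space (open_submanifold M S) x"
    then obtain c where "X = velocity (open_submanifold M S) c" "smooth_curve (open_submanifold M S) c" "c 0 = x"
      by (auto simp: tangent_space_def)
    thus "X \<in> tangent_space M x" using x sc v unfolding tangent_space_def by auto
  next
    fix X assume "X \<in> tangent_space M x"
    then obtain c where c: "X = velocity M c" "smooth_curve M c" "c 0 = x"
      by (auto simp: tangent_space_def)
    hence "X = velocity (open_submanifold M S) c" "smooth_curve (open_submanifold M S) c" using x sc v by auto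
    thus "X \<in> tangent_space (open_submanifold M S) x" using c(3) unfolding tangent_space_def by blast
  qed
qed

text \<open>
  The complex structure of the open submanifold is the restriction of that of the projective space and therefore
  searches for its value among the tangent vectors of the latter.
\<close>

lemma tangent_space_units:
  fixes L :: "'n::finite cproj"
  assumes "L \<in> cproj_units"
  shows "tangent_space cproj_manifold L = tangent_space units_kahler L"
proof -
  have 1: "tangent_space (cproj_manifold :: ('n::finite cproj, complex^'n) manifold) = tangent_space (fubini_study :: ('n cproj, complex^'n) kahler)"
    by (rule charts_eq_imp_same_tangents) (simp add: fubini_study_def)
  have 2: "tangent_space (units_kahler :: ('n::finite cproj, complex^'n) kahler) = tangent_space (open_submanifold fubini_study cproj_units)"
    by (rule charts_eq_imp_same_tangents) (simp add: units_kahler_def rescale_def)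
  have "tangent_space (open_submanifold fubini_study cproj_units) L = tangent_space (fubini_study :: ('n cproj, complex^'n) kahler) L"
  proof (rule tangent_space_open_submanifold[OF _ assms])
    fix U \<phi> W assume "(U, \<phi>, W) \<in> charts (fubini_study :: ('n cproj, complex^'n) kahler)"
    then obtain u where u: "norm u = 1" "U = {line z |z. herm u z \<noteq> 0}" "\<phi> = unit_chart_map u" "W = perp u"
      by (auto simp: fubini_study_def cproj_manifold_def unit_chart_def perp_def)
    have rep: "\<exists>z. z \<noteq> 0 \<and> herm u z \<noteq> 0 \<and> L = line z" if "L \<in> U" for L
    proof -
      from that obtain z where "L = line z" "herm u z \<noteq> 0" using u(2) by auto
      moreover have "z \<noteq> 0" using calculation by auto
      ultimately show ?thesis by blast
    qed
    have m: "unit_chart_map u L \<in> perp u \<and> line (u + unit_chart_map u L) = L" if L: "L \<in> U" for L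
    proof -
      obtain z where z: "z \<noteq> 0" "herm u z \<noteq> 0" "L = line z" using rep[OF L] by blast
      thus ?thesis by (simp add: unit_chart_map_line perp_def herm_diff herm_scale herm_self u(1) line_scale)
    qed
    have "inj_on \<phi> U" unfolding u(3) by (rule inj_on_inverseI[of _ "\<lambda>\<xi>. line (u + \<xi>)"]) (use m in blast)
    moreover have "U \<inter> cproj_units = unit_dom u" by (simp add: u(2) unit_dom_def)
    ultimately show "inj_on \<phi> U \<and> \<phi> ` U \<subseteq> W \<and> openin (top_of_set W) (\<phi> ` (U \<inter> cproj_units))"
      using u(1,3,4) m openin_unit_image by (auto simp: unit_chart_map_image)
  qed
  with 1 2 show ?thesis by simp
qed

text \<open>
  The representative chosen in the definition of \<^const>\<open>horizontal\<close>.
\<close>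

definition unit_rep :: "'n::finite cproj \<Rightarrow> complex^'n" where
  "unit_rep L = (SOME u. norm u = 1 \<and> line u = L)"

lemma unit_rep: "norm (unit_rep L) = 1" "line (unit_rep L) = L"
proof -
  obtain u where "norm u = 1 \<and> line u = L" using unit_representative by blast
  hence "norm (unit_rep L) = 1 \<and> line (unit_rep L) = L" unfolding unit_rep_def by (rule someI)
  thus "norm (unit_rep L) = 1" "line (unit_rep L) = L" by auto
qed

lemma unit_rep_units:
  assumes "L \<in> cproj_units"
  shows "unit_rep L $ i \<noteq> 0" "L \<in> unit_dom (unit_rep L)"
proof -
  have "unit_rep L \<noteq> 0" using unit_rep(1)[of L] by auto
  thus *: "unit_rep L $ i \<noteq> 0" for i using line_in_units_iff[of "unit_rep L"] unit_rep(2)[of L] assms by simp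
  show "L \<in> unit_dom (unit_rep L)"
    using line_in_unit_dom_iff[of "unit_rep L" "unit_rep L"] * unit_rep[of L] by (simp add: herm_self)
qed

lemma horizontal_velocity:
  assumes L: "c 0 \<in> cproj_units"
    and c: "chart_velocity (unit_dom (unit_rep (c 0)), unit_chart_map (unit_rep (c 0)), perp (unit_rep (c 0))) c v"
  shows "horizontal (velocity units_kahler c) = v"
proof -
  let ?\<kappa> = "(unit_dom (unit_rep (c 0)), unit_chart_map (unit_rep (c 0)), perp (unit_rep (c 0)))"
  have k: "?\<kappa> \<in> charts units_kahler" by (rule units_chartI[OF unit_rep(1)])
  hence d: "diff_curve units_kahler c" using c by (auto simp: diff_curve_def)
  let ?X = "velocity units_kahler c"
  have "chart_velocity ?\<kappa> (curve_of ?X) v"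
    by (rule velocity_memD(3)[OF units_diff_manifold d curve_of_velocity[OF units_diff_manifold d] k c])
  moreover have "base_point ?X = c 0" by (rule base_point_velocity[OF units_diff_manifold d])
  ultimately show ?thesis
    by (simp add: horizontal_def unit_rep_def[symmetric] differential_def chart_velocity_def o_def vector_derivative_at)
qed

text \<open>
  The horizontal part is the differential of a chart around the line, so it determines the tangent vector.
\<close>

lemma horizontal_tangent:
  assumes X: "X \<in> tangent_space units_kahler L"
  shows "horizontal X \<in> perp (unit_rep L)"
    "Y \<in> tangent_space units_kahler L \<Longrightarrow> horizontal X = horizontal Y \<Longrightarrow> X = Y"
proof -
  let ?\<kappa> = "(unit_dom (unit_rep L), unit_chart_map (unit_rep L), perp (unit_rep L))"
  have L: "L \<in> cproj_units" using tangent_space_empty_off_points[OF units_atlas X] by (simp add: units_kahler_simps)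
  have k: "?\<kappa> \<in> charts units_kahler" by (rule units_chartI[OF unit_rep(1)])
  have v: "\<exists>v. chart_velocity ?\<kappa> (curve_of Z) v \<and> horizontal Z = v \<and> curve_of Z 0 = L" if Z: "Z \<in> tangent_space units_kahler L" for Z
  proof -
    note t = tangent_spaceD[OF units_diff_manifold Z]
    obtain v where v: "chart_velocity ?\<kappa> (curve_of Z) v"
      using diff_curve_velocity_in_chart[OF units_diff_manifold t(2) k] unit_rep_units(2)[OF L] t(3) by auto
    have "horizontal (velocity units_kahler (curve_of Z)) = v"
      by (rule horizontal_velocity) (use L t(3) v in auto)
    with v t(3,5) show ?thesis by auto
  qed
  from v[OF X] show "horizontal X \<in> perp (unit_rep L)"
    using chart_velocity_in_model_space[OF units_atlas k] by blast
  assume Y: "Y \<in> tangent_space units_kahler L" and e: "horizontal X = horizontal Y"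
  from v[OF X] v[OF Y] e have "velocity units_kahler (curve_of X) = velocity units_kahler (curve_of Y)"
    by (intro velocity_eqI[OF units_diff_manifold k]) auto
  thus "X = Y" using tangent_spaceD(5)[OF units_diff_manifold X] tangent_spaceD(5)[OF units_diff_manifold Y] by simp
qed

lemma cplx_units_eqI:
  assumes X: "X \<in> tangent_space units_kahler L" and Y: "Y \<in> tangent_space units_kahler L"
    and h: "horizontal Y = \<i> *s horizontal X"
  shows "cplx units_kahler X = Y"
proof -
  have L: "L \<in> cproj_units" using tangent_space_empty_off_points[OF units_atlas X] by (simp add: units_kahler_simps)
  have "cplx units_kahler X = (THE Y. Y \<in> tangent_space cproj_manifold (base_point X) \<and> horizontal Y = \<i> *s horizontal X)"
    by (simp add: units_kahler_def rescale_def open_submanifold_def fubini_study_def)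
  also have "\<dots> = Y"
    unfolding tangent_spaceD(4)[OF units_diff_manifold X] tangent_space_units[OF L]
  proof (rule the_equality)
    fix Y' assume Y': "Y' \<in> tangent_space units_kahler L \<and> horizontal Y' = \<i> *s horizontal X"
    show "Y' = Y" by (rule horizontal_tangent(2)[OF _ Y]) (use Y' h in auto)
  qed (use Y h in auto)
  finally show ?thesis .
qed

section \<open>Derivative of the covering map\<close>

text \<open>
  The covering map in affine coordinates.  The normalisations of the probability vector and of the
  tangent vector only multiply it by a complex number.
\<close>

definition expvec :: "'n::finite tvec \<Rightarrow> complex^'n" where
  "expvec y = (\<chi> i. exp (Complex (fst y $ i / 2) (snd y $ i / 2)))"

lemma expvec_nonzero [simp]: "expvec y $ i \<noteq> 0" "expvec y \<noteq> 0"
  by (auto simp: expvec_def intro!: all_nonzero_imp_nonzero)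

lemma tau_of_coords: "tau (of_coords y) = line (expvec y)"
proof -
  define S where "S = (\<Sum>j\<in>UNIV. exp (fst y $ j))"
  have S: "S > 0" unfolding S_def by (rule sum_exp_pos)
  define e where "e = expect (softmax (fst y)) (snd y)"
  define c where "c = complex_of_real (1 / sqrt S) * exp (- \<i> * complex_of_real e / 2)"
  have c: "c \<noteq> 0" using S by (simp add: c_def)
  have "complex_of_real (sqrt (softmax (fst y) $ k)) * exp (\<i> * complex_of_real (centre (softmax (fst y)) (snd y) $ k) / 2) = c * expvec y $ k" for k
  proof -
    have "sqrt (softmax (fst y) $ k) = exp (fst y $ k / 2) / sqrt S"
    proof -
      have "exp (fst y $ k) = (exp (fst y $ k / 2))\<^sup>2" by (simp add: power2_eq_square exp_add[symmetric])
      thus ?thesis by (simp add: softmax_def S_def real_sqrt_divide)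
    qed
    moreover have "exp (Complex (fst y $ k / 2) (snd y $ k / 2)) = complex_of_real (exp (fst y $ k / 2)) * exp (\<i> * complex_of_real (snd y $ k) / 2)"
    proof -
      have "Complex (fst y $ k / 2) (snd y $ k / 2) = complex_of_real (fst y $ k / 2) + \<i> * complex_of_real (snd y $ k) / 2"
        by (simp add: complex_eq_iff)
      thus ?thesis by (simp only: exp_add exp_of_real)
    qed
    moreover have "exp (\<i> * complex_of_real (centre (softmax (fst y)) (snd y) $ k) / 2)
      = exp (\<i> * complex_of_real (snd y $ k) / 2) * exp (- \<i> * complex_of_real e / 2)"
      by (simp add: centre_def e_def exp_add[symmetric] algebra_simps diff_divide_distrib)
    ultimately show ?thesis by (simp add: expvec_def c_def)
  qed
  hence "tau (of_coords y) = line (c *s expvec y)"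
    by (simp add: tau_def of_coords_def vector_scalar_mult_def)
  thus ?thesis using line_scale[OF c] by simp
qed

lemma Ck_on_expvec:
  assumes "subspace W" "openin (top_of_set W) S"
  shows "Ck_on W k S expvec"
proof (rule Ck_on_vec)
  fix i
  have "Ck_on W k S (\<lambda>y. exp (complex_of_real (fst y $ i / 2) + \<i> * complex_of_real (snd y $ i / 2)))"
    by (intro Ck_on_exp[OF assms] Ck_on_add Ck_on_bounded_linear_compose[OF bounded_linear_of_real]
        Ck_on_bounded_linear_compose[OF bounded_linear_mult_right] Ck_on_bounded_linear_compose[OF bounded_linear_divide]
        Ck_on_bounded_linear bounded_linear_compose[OF bounded_linear_vec_nth] bounded_linear_fst bounded_linear_snd)
  thus "Ck_on W k S (\<lambda>y. expvec y $ i)" by (simp add: expvec_def Complex_eq)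
qed

lemma tau_smooth: "smooth_map TP_kahler units_kahler tau"
proof (rule smooth_map_to_units[OF TP_atlas])
  fix U \<phi> W assume "(U, \<phi>, W) \<in> charts (TP_kahler :: ('n::finite tvec, 'n tvec) kahler)"
  then obtain k where k: "U = TP" "\<phi> = theta_map k" "W = model k" by (auto simp: theta_chart_eq)
  show "\<exists>Z. (\<forall>j. Ck_on W j (\<phi> ` U) Z) \<and> (\<forall>y\<in>\<phi> ` U. (\<forall>i. Z y $ i \<noteq> 0) \<and> tau (inv_into U \<phi> y) = line (Z y))"
    unfolding k theta_map_image
    by (intro exI[of _ expvec]) (auto simp: Ck_on_expvec subspace_model inv_into_theta_map tau_of_coords)
qed

lemma tau_diff_map: "diff_map TP_kahler units_kahler tau"
  by (rule smooth_map_imp_diff_map[OF TP_atlas tau_smooth])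

lemma tau_in_units: "x \<in> TP \<Longrightarrow> tau x \<in> cproj_units"
  using diff_map_in[OF tau_diff_map, of x] by (simp add: units_kahler_simps)

text \<open>
  Normalising \<^const>\<open>expvec\<close> to length 1 divides the squared moduli \<open>e\<^bsup>\<theta>\<^sub>i\<^esup>\<close> by their sum.
\<close>

lemma unit_rep_tau:
  assumes x: "x \<in> TP"
  shows "(cmod (unit_rep (tau x) $ i))\<^sup>2 = fst x $ i"
    "\<exists>c. c \<noteq> 0 \<and> unit_rep (tau x) = c *s expvec (log_coords x)"
proof -
  define y where "y = log_coords x"
  have xy: "x = of_coords y" using x by (simp add: y_def of_coords_log_coords)
  define u where "u = unit_rep (tau x)"
  have u: "norm u = 1" "line u = line (expvec y)" using unit_rep[of "tau x"] by (auto simp: u_def xy tau_of_coords)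
  have "u \<noteq> 0" using u by auto
  from line_eqD[OF expvec_nonzero(2) this u(2)[symmetric]] obtain c where c: "c \<noteq> 0" "u = c *s expvec y" by blast
  show "\<exists>c. c \<noteq> 0 \<and> unit_rep (tau x) = c *s expvec (log_coords x)"
    using c unfolding u_def y_def by blast
  have e: "(cmod (u $ i))\<^sup>2 = (cmod c)\<^sup>2 * exp (fst y $ i)" for i
  proof -
    have "(cmod (expvec y $ i))\<^sup>2 = exp (fst y $ i)"
      by (simp add: expvec_def power2_eq_square exp_add[symmetric])
    thus ?thesis by (simp add: c(2) norm_mult power_mult_distrib)
  qed
  have "(\<Sum>i\<in>UNIV. (cmod (u $ i))\<^sup>2) = (norm u)\<^sup>2" by (simp add: norm_vec_def L2_set_def sum_nonneg)
  hence "(cmod c)\<^sup>2 * (\<Sum>j\<in>UNIV. exp (fst y $ j)) = 1" unfolding e sum_distrib_left[symmetric] by (simp add: u)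
  hence "(cmod c)\<^sup>2 = 1 / (\<Sum>j\<in>UNIV. exp (fst y $ j))" using sum_exp_pos[of "fst y"] by (simp add: field_simps)
  thus "(cmod (unit_rep (tau x) $ i))\<^sup>2 = fst x $ i"
    using e[of i] by (simp add: u_def xy of_coords_def softmax_def)
qed

abbreviation tau_push :: "'n::finite tvec tangent \<Rightarrow> 'n cproj tangent" where
  "tau_push \<equiv> pushforward units_kahler tau"

text \<open>
  Along the curve, \<open>z\<^sub>i = exp ((\<theta>\<^sub>i + i v\<^sub>i)/2)\<close> has derivative \<open>z\<^sub>i (\<alpha>\<^sub>i + i \<beta>\<^sub>i)/2\<close>.  The affine chart projects it to the
  orthogonal complement of \<open>z\<close>, which amounts to centring since \<open>\<bar>u\<^sub>i\<bar>\<^sup>2 = p\<^sub>i\<close>.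
\<close>

lemma horizontal_tau_push:
  assumes x: "x \<in> TP"
  shows "horizontal (tau_push (tvec_at x \<alpha>)) =
    (\<chi> i. unit_rep (tau x) $ i * Complex (centre (fst x) (fst \<alpha>) $ i) (centre (fst x) (snd \<alpha>) $ i) / 2)"
proof -
  define y where "y = log_coords x"
  define c where "c t = of_coords (y + t *\<^sub>R \<alpha>)" for t
  define u where "u = unit_rep (tau x)"
  have c0: "c 0 = x" using x by (simp add: c_def y_def of_coords_log_coords)
  have dc: "diff_curve TP_kahler c" unfolding c_def[abs_def] by (rule diff_curve_of_coords)
  have X: "tau_push (tvec_at x \<alpha>) = velocity units_kahler (tau \<circ> c)"
    unfolding tvec_at_def y_def[symmetric] c_def[symmetric, abs_def]
    by (rule pushforward_velocity[OF TP_diff_manifold units_diff_manifold tau_diff_map dc])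
  have tau0: "(tau \<circ> c) 0 = tau x" by (simp add: c0)
  have dtc: "diff_curve units_kahler (tau \<circ> c)"
    by (rule diff_curve_compose[OF TP_atlas units_atlas tau_diff_map dc])
  obtain v where v: "chart_velocity (unit_dom u, unit_chart_map u, perp u) (tau \<circ> c) v"
    using diff_curve_velocity_in_chart[OF units_diff_manifold dtc units_chartI[OF unit_rep(1)]]
      unit_rep_units(2)[OF tau_in_units[OF x]] tau0 unfolding u_def by metis
  have hv: "horizontal (velocity units_kahler (tau \<circ> c)) = v"
    by (rule horizontal_velocity) (use v tau0 tau_in_units[OF x] in \<open>auto simp: u_def\<close>)
  define Z where "Z t = expvec (y + t *\<^sub>R \<alpha>)" for t
  define \<gamma> where "\<gamma> i = Complex (fst \<alpha> $ i) (snd \<alpha> $ i)" for i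
  have Zd: "((\<lambda>t. Z t $ i) has_vector_derivative Z 0 $ i * \<gamma> i / 2) (at 0)" for i
  proof -
    have "((\<lambda>t. exp (Complex (fst y $ i / 2) (snd y $ i / 2) + complex_of_real t * (\<gamma> i / 2))) has_vector_derivative
       (\<gamma> i / 2) * exp (Complex (fst y $ i / 2) (snd y $ i / 2) + complex_of_real 0 * (\<gamma> i / 2))) (at 0)"
    proof (rule field_vector_diff_chain_at[of _ _ _ exp, unfolded o_def])
      have "((\<lambda>t. Complex (fst y $ i / 2) (snd y $ i / 2) + t *\<^sub>R (\<gamma> i / 2)) has_vector_derivative \<gamma> i / 2) (at 0)"
        by (auto intro!: derivative_eq_intros)
      thus "((\<lambda>t. Complex (fst y $ i / 2) (snd y $ i / 2) + complex_of_real t * (\<gamma> i / 2)) has_vector_derivative \<gamma> i / 2) (at 0)"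
        by (simp add: scaleR_conv_of_real)
    qed (rule DERIV_exp)
    moreover have "Z t $ i = exp (Complex (fst y $ i / 2) (snd y $ i / 2) + complex_of_real t * (\<gamma> i / 2))" for t
    proof -
      have "Complex (fst (y + t *\<^sub>R \<alpha>) $ i / 2) (snd (y + t *\<^sub>R \<alpha>) $ i / 2)
        = Complex (fst y $ i / 2) (snd y $ i / 2) + complex_of_real t * (\<gamma> i / 2)"
        by (simp add: complex_eq_iff \<gamma>_def add_divide_distrib)
      thus ?thesis by (simp only: Z_def expvec_def vec_lambda_beta)
    qed
    ultimately show ?thesis by (simp add: Z_def expvec_def mult.commute)
  qed
  obtain \<mu> where \<mu>: "\<mu> \<noteq> 0" "u = \<mu> *s Z 0" using unit_rep_tau(2)[OF x] unfolding u_def Z_def y_def by auto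
  have nu: "norm u = 1" by (simp add: u_def unit_rep)
  have h0: "herm u (Z 0) = 1 / \<mu>"
  proof -
    have "\<mu> * herm u (Z 0) = herm u u" using \<mu>(2) by (simp add: herm_scale)
    thus ?thesis using nu \<mu>(1) by (simp add: herm_self field_simps)
  qed
  define h' where "h' = (\<Sum>i\<in>UNIV. cnj (u $ i) * (Z 0 $ i * \<gamma> i / 2))"
  have hd: "((\<lambda>t. herm u (Z t)) has_vector_derivative h') (at 0)"
    unfolding herm_def h'_def
    by (intro has_vector_derivative_sum bounded_linear.has_vector_derivative[OF bounded_linear_mult_right Zd])
  have inv: "((\<lambda>t. 1 / herm u (Z t)) has_vector_derivative h' * (- (\<mu> * \<mu>))) (at 0)"
  proof -
    have "(inverse has_field_derivative - (\<mu> * \<mu>)) (at (herm u (Z 0)))"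
      using DERIV_inverse[of "herm u (Z 0)"] \<mu>(1) unfolding h0 by (simp add: power2_eq_square)
    from field_vector_diff_chain_at[OF hd this] show ?thesis by (simp add: o_def divide_inverse)
  qed
  have comp: "((\<lambda>t. 1 / herm u (Z t) * Z t $ i - u $ i) has_vector_derivative
      (\<mu> * (Z 0 $ i * \<gamma> i / 2) + h' * (- (\<mu> * \<mu>)) * Z 0 $ i)) (at 0)" for i
    using has_vector_derivative_mult[OF inv Zd[of i]] h0 \<mu>(1) by (simp add: has_vector_derivative_diff_const)
  have "v $ i = \<mu> * (Z 0 $ i * \<gamma> i / 2) + h' * (- (\<mu> * \<mu>)) * Z 0 $ i" for i
  proof -
    have e: "unit_chart_map u (tau (c t)) = (1 / herm u (Z t)) *s Z t - u" for t
      by (simp add: c_def tau_of_coords Z_def unit_chart_map_line)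
    have "((\<lambda>t. unit_chart_map u (tau (c t))) has_vector_derivative v) (at 0)" using v by (simp add: chart_velocity_def)
    from bounded_linear.has_vector_derivative[OF bounded_linear_vec_nth this, of i]
    have "((\<lambda>t. 1 / herm u (Z t) * Z t $ i - u $ i) has_vector_derivative v $ i) (at 0)" unfolding e by simp
    from vector_derivative_unique_at[OF this comp] show ?thesis .
  qed
  moreover have "\<mu> * h' = Complex (expect (fst x) (fst \<alpha>)) (expect (fst x) (snd \<alpha>)) / 2"
  proof -
    have "\<mu> * h' = (\<Sum>i\<in>UNIV. complex_of_real (fst x $ i) * \<gamma> i / 2)"
    proof -
      have "\<mu> * (cnj (u $ i) * (Z 0 $ i * \<gamma> i / 2)) = complex_of_real (fst x $ i) * \<gamma> i / 2" for i
      proof -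
        have "cnj (u $ i) * u $ i = complex_of_real (fst x $ i)"
          using unit_rep_tau(1)[OF x, of i] by (metis complex_norm_square mult.commute u_def)
        moreover have "u $ i = \<mu> * Z 0 $ i" using \<mu>(2) by simp
        ultimately show ?thesis by (metis (no_types, lifting) mult.assoc mult.left_commute times_divide_eq_right)
      qed
      thus ?thesis unfolding h'_def sum_distrib_left by (simp only:)
    qed
    also have "\<dots> = Complex (expect (fst x) (fst \<alpha>)) (expect (fst x) (snd \<alpha>)) / 2"
      by (simp add: complex_eq_iff \<gamma>_def expect_def sum_divide_distrib)
    finally show ?thesis .
  qed
  ultimately have "v $ i = u $ i * Complex (centre (fst x) (fst \<alpha>) $ i) (centre (fst x) (snd \<alpha>) $ i) / 2" for i
  proof -
    assume v: "\<And>i. v $ i = \<mu> * (Z 0 $ i * \<gamma> i / 2) + h' * (- (\<mu> * \<mu>)) * Z 0 $ i"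
      and m: "\<mu> * h' = Complex (expect (fst x) (fst \<alpha>)) (expect (fst x) (snd \<alpha>)) / 2"
    have "v $ i = u $ i * (\<gamma> i / 2 - \<mu> * h')" unfolding v \<mu>(2) by (simp add: algebra_simps)
    moreover have "\<gamma> i / 2 - \<mu> * h' = Complex (centre (fst x) (fst \<alpha>) $ i) (centre (fst x) (snd \<alpha>) $ i) / 2"
      unfolding m by (simp add: complex_eq_iff \<gamma>_def centre_def diff_divide_distrib)
    ultimately show ?thesis by simp
  qed
  thus ?thesis unfolding X hv u_def[symmetric] by (simp add: vec_eq_iff)
qed

lemma tau_push_tangent:
  assumes "A \<in> tangent_space TP_kahler x"
  shows "tau_push A \<in> tangent_space units_kahler (tau x)"
  by (rule pushforward_in_tangent_space[OF TP_diff_manifold units_diff_manifold tau_diff_map assms])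

text \<open>
  The factor 4 of the rescaled Fubini-Study structure compensates the two factors 1/2 in the lemma above; real and imaginary part of
  \<open>\<Sum>\<^sub>i p\<^sub>i (\<alpha>\<^sub>i - i \<beta>\<^sub>i) (\<alpha>'\<^sub>i + i \<beta>'\<^sub>i)\<close> are the metric and the symplectic form of the tangent bundle.
\<close>

lemma herm_horizontal_tau:
  assumes A: "A \<in> tangent_space TP_kahler x" and B: "B \<in> tangent_space TP_kahler x"
  shows "4 * herm (horizontal (tau_push A)) (horizontal (tau_push B))
    = Complex (metric TP_kahler A B) (symp TP_kahler A B)"
proof -
  note a = tangent_eq_tvec_at[OF A] note b = tangent_eq_tvec_at[OF B]
  define p where "p = fst x"
  define a1 a2 b1 b2 where defs: "a1 = proj_push A" "a2 = connector A" "b1 = proj_push B" "b2 = connector B"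
  define u where "u = unit_rep (tau x)"
  have hA: "horizontal (tau_push A) = (\<chi> i. u $ i * Complex (a1 $ i) (a2 $ i) / 2)"
    using horizontal_tau_push[OF a(4), of "(a1, a2)"] a by (simp add: defs u_def centre_centred)
  have hB: "horizontal (tau_push B) = (\<chi> i. u $ i * Complex (b1 $ i) (b2 $ i) / 2)"
    using horizontal_tau_push[OF b(4), of "(b1, b2)"] b by (simp add: defs u_def centre_centred)
  have bp: "base_point A = x" using tangent_spaceD(4)[OF TP_diff_manifold A] .
  have "4 * herm (horizontal (tau_push A)) (horizontal (tau_push B))
     = (\<Sum>i\<in>UNIV. complex_of_real (p $ i) * (cnj (Complex (a1 $ i) (a2 $ i)) * Complex (b1 $ i) (b2 $ i)))"
    unfolding hA hB herm_def sum_distrib_left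
  proof (rule sum.cong[OF refl])
    fix i
    have "cnj (u $ i) * u $ i = complex_of_real (p $ i)"
      using unit_rep_tau(1)[OF a(4), of i] by (metis complex_norm_square mult.commute u_def p_def)
    thus "4 * (cnj ((\<chi> i. u $ i * Complex (a1 $ i) (a2 $ i) / 2) $ i) * (\<chi> i. u $ i * Complex (b1 $ i) (b2 $ i) / 2) $ i)
      = complex_of_real (p $ i) * (cnj (Complex (a1 $ i) (a2 $ i)) * Complex (b1 $ i) (b2 $ i))"
      by (simp add: mult_ac)
  qed
  also have "\<dots> = Complex (metric TP_kahler A B) (symp TP_kahler A B)"
    by (simp add: complex_eq_iff TP_kahler_def Let_def bp p_def[symmetric] defs[symmetric] fisher_def
        sum.distrib[symmetric] sum_subtractf[symmetric] algebra_simps)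
  finally show ?thesis .
qed

lemma tau_push_isometry:
  assumes A: "A \<in> tangent_space TP_kahler x" and B: "B \<in> tangent_space TP_kahler x"
  shows "metric units_kahler (tau_push A) (tau_push B) = metric TP_kahler A B"
    "symp units_kahler (tau_push A) (tau_push B) = symp TP_kahler A B"
  using arg_cong[OF herm_horizontal_tau[OF A B], of Re] arg_cong[OF herm_horizontal_tau[OF A B], of Im]
  by (simp_all add: units_kahler_simps)

lemma cplx_TP_tangent: "A \<in> tangent_space TP_kahler x \<Longrightarrow> cplx TP_kahler A \<in> tangent_space TP_kahler x"
  using cplx_TP[of A x] tvec_at_facts(1)[of x] tangent_eq_tvec_at(4)[of A x] by simp

lemma tau_push_cplx:
  assumes A: "A \<in> tangent_space TP_kahler x"
  shows "tau_push (cplx TP_kahler A) = cplx units_kahler (tau_push A)"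
proof -
  note a = tangent_eq_tvec_at[OF A]
  have n: "expect (fst x) (- connector A) = 0" using a(3) expect_scale[of "fst x" "-1" "connector A"] by simp
  have 1: "horizontal (tau_push A) =
      (\<chi> i. unit_rep (tau x) $ i * Complex (proj_push A $ i) (connector A $ i) / 2)"
    using horizontal_tau_push[OF a(4), of "(proj_push A, connector A)"] a by (simp add: centre_centred)
  have 2: "horizontal (tau_push (cplx TP_kahler A)) =
      (\<chi> i. unit_rep (tau x) $ i * Complex (- connector A $ i) (proj_push A $ i) / 2)"
    unfolding cplx_TP[OF A] horizontal_tau_push[OF a(4)] using a n by (simp add: centre_centred)
  have "horizontal (tau_push (cplx TP_kahler A)) = \<i> *s horizontal (tau_push A)"
  proof -
    have "Complex (- s) r = \<i> * Complex r s" for r s by (simp add: complex_eq_iff)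
    thus ?thesis unfolding 1 2 by (simp add: vec_eq_iff)
  qed
  from cplx_units_eqI[OF tau_push_tangent[OF A] tau_push_tangent[OF cplx_TP_tangent[OF A]] this]
  show ?thesis by simp
qed

lemma tau_push_inj:
  assumes A: "A \<in> tangent_space TP_kahler x" and B: "B \<in> tangent_space TP_kahler x"
    and e: "tau_push A = tau_push B"
  shows "A = B"
proof -
  note a = tangent_eq_tvec_at[OF A] note b = tangent_eq_tvec_at[OF B]
  have "unit_rep (tau x) $ i * Complex (proj_push A $ i) (connector A $ i) / 2 = unit_rep (tau x) $ i * Complex (proj_push B $ i) (connector B $ i) / 2" for i
    using horizontal_tau_push[OF a(4), of "(proj_push A, connector A)"] horizontal_tau_push[OF a(4), of "(proj_push B, connector B)"] a b e
    by (simp add: centre_centred vec_eq_iff)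
  hence "proj_push A $ i = proj_push B $ i \<and> connector A $ i = connector B $ i" for i
    using unit_rep_units(1)[OF tau_in_units[OF a(4)]] by (metis complex.inject divide_cancel_right mult_cancel_left zero_neq_numeral)
  hence "proj_push A = proj_push B" "connector A = connector B" by (auto simp: vec_eq_iff)
  thus ?thesis using a(1) b(1) by simp
qed

text \<open>
  The components of the unit representative do not vanish, so the formula for the horizontal part can be solved.
\<close>

lemma tau_push_surj:
  assumes x: "x \<in> TP" and Y: "Y \<in> tangent_space units_kahler (tau x)"
  obtains A where "A \<in> tangent_space TP_kahler x" "tau_push A = Y"
proof -
  define u where "u = unit_rep (tau x)"
  define \<eta> where "\<eta> = horizontal Y"
  have \<eta>: "herm u \<eta> = 0" using horizontal_tangent(1)[OF Y] by (simp add: perp_def u_def \<eta>_def)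
  have u: "u $ i \<noteq> 0" for i unfolding u_def by (rule unit_rep_units(1)[OF tau_in_units[OF x]])
  define \<gamma> where "\<gamma> i = 2 * \<eta> $ i / u $ i" for i
  define \<alpha> where "\<alpha> = ((\<chi> i. Re (\<gamma> i)) :: real^'a, (\<chi> i. Im (\<gamma> i)) :: real^'a)"
  have "(\<Sum>i\<in>UNIV. complex_of_real (fst x $ i) * \<gamma> i) = 2 * herm u \<eta>"
    unfolding herm_def sum_distrib_left
  proof (rule sum.cong[OF refl])
    fix i
    have "cnj (u $ i) * u $ i = complex_of_real (fst x $ i)"
      using unit_rep_tau(1)[OF x, of i] by (metis complex_norm_square mult.commute u_def)
    thus "complex_of_real (fst x $ i) * \<gamma> i = 2 * (cnj (u $ i) * \<eta> $ i)"
      using u[of i] by (simp add: \<gamma>_def flip: \<open>cnj (u $ i) * u $ i = _\<close>)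
  qed
  hence z: "(\<Sum>i\<in>UNIV. complex_of_real (fst x $ i) * \<gamma> i) = 0" using \<eta> by simp
  have "expect (fst x) (fst \<alpha>) = 0" "expect (fst x) (snd \<alpha>) = 0"
    using arg_cong[OF z, of Re] arg_cong[OF z, of Im] by (simp_all add: expect_def \<alpha>_def)
  hence "horizontal (tau_push (tvec_at x \<alpha>)) = (\<chi> i. u $ i * \<gamma> i / 2)"
    unfolding horizontal_tau_push[OF x] by (simp add: centre_centred u_def \<alpha>_def)
  also have "\<dots> = \<eta>" using u by (simp add: \<gamma>_def vec_eq_iff)
  finally have "horizontal (tau_push (tvec_at x \<alpha>)) = horizontal Y" by (simp add: \<eta>_def)
  from horizontal_tangent(2)[OF tau_push_tangent[OF tvec_at_facts(1)[OF x]] Y this]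
  show thesis using that tvec_at_facts(1)[OF x] by blast
qed

section \<open>Sheets of the covering map\<close>

lemma of_coords_eq_iff: "of_coords y = of_coords w \<longleftrightarrow> reduce k y = reduce k w"
  by (metis of_coords_reduce theta_map_of_coords)

lemma of_coords_log_coords_add: "of_coords (log_coords (of_coords y) + d) = of_coords (y + d)"
proof -
  fix k :: 'a
  have "reduce k (log_coords (of_coords y)) = reduce k y"
    using theta_map_eq[OF of_coords_in_TP, of k y] by (simp add: theta_map_of_coords)
  hence "reduce k (log_coords (of_coords y) + d) = reduce k (y + d)"
    by (simp add: linear_add[OF linear_reduce])
  thus ?thesis using of_coords_eq_iff by blast
qed

lemma continuous_on_line: "continuous_on {z. z \<noteq> 0} (line :: complex^'n::finite \<Rightarrow> 'n cproj)"
proof (subst continuous_on_open_vimage)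
  show "open {z :: complex^'n. z \<noteq> 0}" by (simp add: open_Collect_neq)
  show "\<forall>B. open B \<longrightarrow> open (line -` B \<inter> {z :: complex^'n. z \<noteq> 0})"
    by (auto simp: open_cproj_def vimage_def Int_def conj_commute)
qed

text \<open>
  The projective space carries the quotient topology.
\<close>

lemma continuous_on_from_cproj:
  fixes A :: "'n::finite cproj set" and g :: "'n cproj \<Rightarrow> 'b::topological_space"
  assumes A: "open A" and g: "continuous_on {z. z \<noteq> 0 \<and> line z \<in> A} (\<lambda>z. g (line z))"
  shows "continuous_on A g"
proof (subst continuous_on_open_vimage[OF A], intro allI impI)
  fix B :: "'b set" assume "open B"
  moreover have "open {z :: complex^'n. z \<noteq> 0 \<and> line z \<in> A}" using A by (simp add: open_cproj_def)
  ultimately have "open ((\<lambda>z. g (line z)) -` B \<inter> {z. z \<noteq> 0 \<and> line z \<in> A})"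
    using g by (subst (asm) continuous_on_open_vimage) auto
  moreover have "(\<lambda>z. g (line z)) -` B \<inter> {z. z \<noteq> 0 \<and> line z \<in> A} = {z. z \<noteq> 0 \<and> line z \<in> g -` B \<inter> A}" by auto
  ultimately show "open (g -` B \<inter> A)" unfolding open_cproj_def by simp
qed

lemma continuous_on_tau: "continuous_on TP tau"
proof -
  have "continuous_on TP (\<lambda>x. expvec (log_coords x))"
    unfolding expvec_def log_coords_def Complex_eq
    by (intro continuous_intros) (auto simp: TP_iff prob_posD less_imp_neq[symmetric])
  hence "continuous_on TP (\<lambda>x. line (expvec (log_coords x)))"
    by (rule continuous_on_compose2[OF continuous_on_line]) auto
  thus ?thesis by (rule continuous_on_eq) (metis of_coords_log_coords tau_of_coords)
qed

definition int_lattice :: "(real^'n) set" where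
  "int_lattice = {m. \<forall>i. m $ i \<in> \<int>}"

definition translate :: "real^'n \<Rightarrow> 'n::finite tvec \<Rightarrow> 'n tvec" where
  "translate m = restrict (\<lambda>x. of_coords (log_coords x + (0, (4 * pi) *\<^sub>R m))) TP"

lemma translate_of_coords: "translate m (of_coords y) = of_coords (vshift m y)"
  by (simp add: translate_def of_coords_in_TP of_coords_log_coords_add)

lemma translate_TP: "x \<in> TP \<Longrightarrow> translate m x \<in> TP"
  by (simp add: translate_def of_coords_in_TP)

lemma TP_cases: assumes "x \<in> TP" obtains y where "x = of_coords y"
  using of_coords_log_coords[OF assms] by metis

lemma translate_translate: "x \<in> TP \<Longrightarrow> translate m (translate m' x) = translate (m + m') x"
  by (elim TP_cases) (simp add: translate_of_coords algebra_simps)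

lemma translate_zero: "x \<in> TP \<Longrightarrow> translate 0 x = x"
  by (elim TP_cases) (simp add: translate_of_coords zero_prod_def[symmetric])

lemma translate_eqD:
  assumes e: "translate m x = translate m' x" and x: "x \<in> TP"
  shows "translate m = translate m'"
proof -
  fix k :: 'a
  obtain y where y: "x = of_coords y" using x by (rule TP_cases)
  have "reduce k (vshift m y) = reduce k (vshift m' y)"
    using e unfolding y translate_of_coords of_coords_eq_iff[of _ _ k] .
  hence r: "reduce k (0, (4 * pi) *\<^sub>R m) = reduce k (0, (4 * pi) *\<^sub>R m')"
    by (simp add: linear_add[OF linear_reduce])
  have "translate m z = translate m' z" if z: "z \<in> TP" for z
  proof -
    obtain w where w: "z = of_coords w" using z by (rule TP_cases)
    show ?thesis unfolding w translate_of_coords of_coords_eq_iff[of _ _ k] linear_add[OF linear_reduce] r ..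
  qed
  thus ?thesis by (intro extensionalityI[of _ TP]) (auto simp: translate_def)
qed

lemma expvec_lattice: "m \<in> int_lattice \<Longrightarrow> expvec (vshift m y) = expvec y"
proof -
  assume m: "m \<in> int_lattice"
  have "exp (Complex (fst y $ i / 2) ((snd y $ i + 4 * pi * m $ i) / 2)) = exp (Complex (fst y $ i / 2) (snd y $ i / 2))" for i
  proof -
    obtain l where l: "m $ i = of_int l" using m by (auto simp: int_lattice_def elim: Ints_cases)
    show ?thesis unfolding exp_eq by (intro exI[of _ l]) (simp add: complex_eq_iff l add_divide_distrib)
  qed
  thus ?thesis by (simp add: expvec_def vec_eq_iff)
qed

lemma tau_translate: "m \<in> int_lattice \<Longrightarrow> x \<in> TP \<Longrightarrow> tau (translate m x) = tau x"
  by (elim TP_cases) (simp add: translate_of_coords tau_of_coords expvec_lattice)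

lemma lattice_minus: "m \<in> int_lattice \<Longrightarrow> - m \<in> int_lattice"
  and lattice_add: "m \<in> int_lattice \<Longrightarrow> m' \<in> int_lattice \<Longrightarrow> m + m' \<in> int_lattice"
  and lattice_zero: "0 \<in> int_lattice"
  by (auto simp: int_lattice_def)

text \<open>
  Proportional vectors \<open>exp (w\<^sub>i/2)\<close> have exponents \<open>w\<^sub>i/2\<close> that differ by a common constant and multiples of \<open>2 \<pi> i\<close>; the
  constant is lost in the redundancy of the coordinates.
\<close>

lemma tau_fibre:
  assumes x: "x \<in> TP" "x' \<in> TP" and e: "tau x = tau x'"
  obtains m where "m \<in> int_lattice" "x' = translate m x"
proof -
  fix k :: 'a
  obtain y where y: "x = of_coords y" using x(1) by (rule TP_cases)
  obtain y' where y': "x' = of_coords y'" using x(2) by (rule TP_cases)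
  have "line (expvec y) = line (expvec y')" using e by (simp add: y y' tau_of_coords)
  from line_eqD[OF expvec_nonzero(2) expvec_nonzero(2) this]
  obtain c where c: "c \<noteq> 0" "expvec y' = c *s expvec y" by blast
  define w where "w = Ln c"
  have "exp (Complex (fst y' $ i / 2) (snd y' $ i / 2)) = exp (w + Complex (fst y $ i / 2) (snd y $ i / 2))" for i
    using arg_cong[OF c(2), of "\<lambda>v. v $ i"] c(1) by (simp add: expvec_def w_def exp_add)
  hence "\<exists>n::int. Complex (fst y' $ i / 2) (snd y' $ i / 2) = w + Complex (fst y $ i / 2) (snd y $ i / 2) + (of_int (2 * n) * pi) * \<i>" for i
    unfolding exp_eq by auto
  then obtain n :: "'a \<Rightarrow> int" where n: "\<And>i. Complex (fst y' $ i / 2) (snd y' $ i / 2) = w + Complex (fst y $ i / 2) (snd y $ i / 2) + (of_int (2 * n i) * pi) * \<i>"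
    by metis
  define m where "m = (\<chi> i. real_of_int (n i))"
  have 1: "fst y' $ i = fst y $ i + 2 * Re w" "snd y' $ i = snd y $ i + 2 * Im w + 4 * pi * m $ i" for i
    using n[of i] by (auto simp: complex_eq_iff m_def)
  have "reduce k y' = reduce k (vshift m y)"
    by (simp add: reduce_def 1 vec_eq_iff)
  hence "x' = translate m x" unfolding y y' translate_of_coords of_coords_eq_iff[of _ _ k] .
  moreover have "m \<in> int_lattice" by (simp add: int_lattice_def m_def)
  ultimately show thesis using that by blast
qed

subsection \<open>Local sections\<close>

text \<open>
  \<open>exp ((w\<^sub>i - w\<^sub>k - y\<^sub>i + y\<^sub>k)/2)\<close> for \<open>z = exp (w/2)\<close>: the position of the line through \<open>z\<close> relative to the
  base point with coordinates \<open>y\<close>.  It depends on the line only.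
\<close>

definition ratio :: "'n \<Rightarrow> 'n::finite tvec \<Rightarrow> complex^'n \<Rightarrow> 'n \<Rightarrow> complex" where
  "ratio k y z i = (z $ i / z $ k) * (expvec y $ k / expvec y $ i)"

text \<open>
  The lift of the line through \<open>z\<close> that is close to \<open>y\<close>.
\<close>

definition lift :: "'n \<Rightarrow> 'n::finite tvec \<Rightarrow> complex^'n \<Rightarrow> 'n tvec" where
  "lift k y z = y + (\<chi> i. 2 * Re (Ln (ratio k y z i)), \<chi> i. 2 * Im (Ln (ratio k y z i)))"

text \<open>
  By the half-width \<open>\<pi>\<close> in \<open>v\<close>, the imaginary part of the logarithm of \<^const>\<open>ratio\<close> is smaller than \<open>\<pi>/2\<close>, so the ratio
  has positive real part and the principal branch applies; two translates of a sheet by lattice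
  vectors coincide or are disjoint, since different translates are \<open>4 \<pi>\<close> apart in some direction.
\<close>

definition sheet :: "'n \<Rightarrow> 'n::finite tvec \<Rightarrow> 'n tvec set" where
  "sheet k y = {x \<in> TP. \<forall>i. \<bar>snd (theta_map k x) $ i - snd (reduce k y) $ i\<bar> < pi}"

lemma ratio_nonzero: "(\<And>i. z $ i \<noteq> 0) \<Longrightarrow> ratio k y z i \<noteq> 0"
  by (simp add: ratio_def)

lemma ratio_self: "z $ k \<noteq> 0 \<Longrightarrow> ratio k y z k = 1"
  by (simp add: ratio_def)

lemma ratio_scale: "c \<noteq> 0 \<Longrightarrow> ratio k y (c *s z) i = ratio k y z i"
  by (simp add: ratio_def)

lemma tau_lift:
  assumes z: "\<And>i. z $ i \<noteq> 0"
  shows "tau (of_coords (lift k y z)) = line z"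
proof -
  have "expvec (lift k y z) $ i = (expvec y $ k / z $ k) * z $ i" for i
  proof -
    have "Complex (fst (lift k y z) $ i / 2) (snd (lift k y z) $ i / 2) = Complex (fst y $ i / 2) (snd y $ i / 2) + Ln (ratio k y z i)"
      by (simp add: lift_def complex_eq_iff)
    hence "expvec (lift k y z) $ i = expvec y $ i * ratio k y z i"
      using ratio_nonzero[OF z] by (simp add: expvec_def exp_add)
    thus ?thesis by (simp add: ratio_def)
  qed
  hence "expvec (lift k y z) = (expvec y $ k / z $ k) *s z" by (simp add: vec_eq_iff)
  thus ?thesis using z[of k] by (simp add: tau_of_coords line_scale)
qed

lemma lift_in_sheet:
  assumes z: "\<And>i. z $ i \<noteq> 0" and r: "\<And>i. Re (ratio k y z i) > 0"
  shows "of_coords (lift k y z) \<in> sheet k y"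
proof -
  have "\<bar>Im (Ln (ratio k y z i))\<bar> < pi / 2" for i using Re_Ln_pos_lt[OF ratio_nonzero[OF z]] r by blast
  from this[THEN mult_strict_left_mono, of 2] have "\<bar>2 * Im (Ln (ratio k y z i))\<bar> < pi" for i by (simp add: abs_mult)
  moreover have "snd (reduce k (lift k y z)) $ i - snd (reduce k y) $ i = 2 * Im (Ln (ratio k y z i))" for i
    using ratio_self[OF z[of k], of y] by (simp add: reduce_def lift_def)
  ultimately show ?thesis by (simp add: sheet_def of_coords_in_TP theta_map_of_coords)
qed

lemma sheet_lift:
  assumes x: "of_coords w \<in> sheet k y"
  shows "Re (ratio k y (expvec w) i) > 0" "of_coords (lift k y (expvec w)) = of_coords w"
proof -
  define d where "d i = Complex ((fst w $ i - fst w $ k - (fst y $ i - fst y $ k)) / 2) ((snd w $ i - snd w $ k - (snd y $ i - snd y $ k)) / 2)" for i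
  have rat: "ratio k y (expvec w) i = exp (d i)" for i
  proof -
    have "d i = (Complex (fst w $ i / 2) (snd w $ i / 2) - Complex (fst w $ k / 2) (snd w $ k / 2))
      + (Complex (fst y $ k / 2) (snd y $ k / 2) - Complex (fst y $ i / 2) (snd y $ i / 2))"
      by (simp add: d_def complex_eq_iff diff_divide_distrib)
    thus ?thesis by (simp add: ratio_def expvec_def exp_add exp_diff)
  qed
  have a: "\<bar>Im (d i)\<bar> < pi / 2" for i
    using x by (simp add: sheet_def theta_map_of_coords reduce_def d_def)
  have im: "- (pi / 2) < Im (d i)" "Im (d i) < pi / 2" for i using a[of i] unfolding abs_less_iff by linarith+
  have ln: "Ln (exp (d i)) = d i" for i using im[of i] pi_gt_zero by (intro Ln_exp) linarith+
  show "Re (ratio k y (expvec w) i) > 0"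
    unfolding rat Re_exp using cos_gt_zero_pi[OF im] by simp
  have "reduce k (lift k y (expvec w)) = reduce k w"
    unfolding lift_def rat ln by (simp add: reduce_def d_def vec_eq_iff diff_divide_distrib)
  thus "of_coords (lift k y (expvec w)) = of_coords w" using of_coords_eq_iff by blast
qed

lemma tau_sheet: "tau ` sheet k y = {line z |z. (\<forall>i. z $ i \<noteq> 0) \<and> (\<forall>i. Re (ratio k y z i) > 0)}"
proof (intro equalityI subsetI)
  fix L assume "L \<in> tau ` sheet k y"
  then obtain x where x: "x \<in> sheet k y" "L = tau x" by blast
  obtain w where w: "x = of_coords w" using x(1) by (auto simp: sheet_def elim: TP_cases)
  show "L \<in> {line z |z. (\<forall>i. z $ i \<noteq> 0) \<and> (\<forall>i. Re (ratio k y z i) > 0)}"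
    using sheet_lift(1)[of w k y] x by (auto simp: w tau_of_coords intro!: exI[of _ "expvec w"])
next
  fix L assume "L \<in> {line z |z. (\<forall>i. z $ i \<noteq> 0) \<and> (\<forall>i. Re (ratio k y z i) > 0)}"
  then obtain z where z: "L = line z" "\<And>i. z $ i \<noteq> 0" "\<And>i. Re (ratio k y z i) > 0" by blast
  show "L \<in> tau ` sheet k y"
    using imageI[OF lift_in_sheet[OF z(2,3)], of tau] by (simp only: tau_lift[OF z(2)] z(1))
qed

lemma line_in_tau_sheet:
  assumes "z \<noteq> 0"
  shows "line z \<in> tau ` sheet k y \<longleftrightarrow> (\<forall>i. z $ i \<noteq> 0) \<and> (\<forall>i. Re (ratio k y z i) > 0)"
proof
  assume "line z \<in> tau ` sheet k y"
  then obtain w where w: "line z = line w" "\<forall>i. w $ i \<noteq> 0" "\<forall>i. Re (ratio k y w i) > 0" unfolding tau_sheet by blast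
  have "w \<noteq> 0" using w(2) by (intro all_nonzero_imp_nonzero) auto
  from line_eqD[OF assms this w(1)] obtain c where c: "c \<noteq> 0" "w = c *s z" by blast
  show "(\<forall>i. z $ i \<noteq> 0) \<and> (\<forall>i. Re (ratio k y z i) > 0)" using w(2,3) c by (simp add: ratio_scale)
qed (auto simp: tau_sheet)

lemma tau_sheet_vectors:
  "{z. z \<noteq> 0 \<and> line z \<in> tau ` sheet k y} = {z. (\<forall>i. z $ i \<noteq> 0) \<and> (\<forall>i. Re (ratio k y z i) > 0)}"
proof (intro Collect_cong iffI)
  fix z :: "complex^'a"
  assume "z \<noteq> 0 \<and> line z \<in> tau ` sheet k y"
  thus "(\<forall>i. z $ i \<noteq> 0) \<and> (\<forall>i. Re (ratio k y z i) > 0)" using line_in_tau_sheet[of z k y] by simp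
next
  fix z :: "complex^'a"
  assume z: "(\<forall>i. z $ i \<noteq> 0) \<and> (\<forall>i. Re (ratio k y z i) > 0)"
  hence "z \<noteq> 0" by (intro all_nonzero_imp_nonzero) auto
  thus "z \<noteq> 0 \<and> line z \<in> tau ` sheet k y" using z line_in_tau_sheet[of z k y] by simp
qed

lemma continuous_on_ratio: "continuous_on {z. \<forall>i. z $ i \<noteq> 0} (\<lambda>z. ratio k y z i)"
  unfolding ratio_def by (intro continuous_intros) auto

lemma open_all_nonzero: "open {z :: complex^'n. \<forall>i. z $ i \<noteq> 0}"
proof -
  have "{z :: complex^'n. \<forall>i. z $ i \<noteq> 0} = (\<Inter>i. {z. z $ i \<noteq> 0})" by auto
  moreover have "open (\<Inter>i. {z :: complex^'n. z $ i \<noteq> 0})"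
    by (intro open_INT finite ballI open_Collect_neq continuous_intros)
  ultimately show ?thesis by simp
qed

lemma open_ratio_pos: "open {z :: complex^'n::finite. (\<forall>i. z $ i \<noteq> 0) \<and> (\<forall>i. Re (ratio k y z i) > 0)}"
proof -
  have "open {z :: complex^'n. \<forall>i. z $ i \<noteq> 0}" by (rule open_all_nonzero)
  hence "open ({z. \<forall>i. z $ i \<noteq> 0} \<inter> (\<lambda>z. Re (ratio k y z i)) -` {0<..})" for i
    by (intro continuous_open_preimage continuous_intros continuous_on_ratio) auto
  hence "open (\<Inter>i. {z. \<forall>i. z $ i \<noteq> 0} \<inter> (\<lambda>z. Re (ratio k y z i)) -` {0<..})"
    by (intro open_INT) auto
  moreover have "(\<Inter>i. {z. \<forall>i. z $ i \<noteq> 0} \<inter> (\<lambda>z. Re (ratio k y z i)) -` {0<..}) = {z. (\<forall>i. z $ i \<noteq> 0) \<and> (\<forall>i. Re (ratio k y z i) > 0)}"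
    by auto
  ultimately show ?thesis by simp
qed

lemma open_tau_sheet: "open (tau ` sheet k y)"
  unfolding open_cproj_def tau_sheet_vectors by (rule open_ratio_pos)

lemma openin_sheet: "openin (top_of_set TP) (sheet k y)"
proof -
  have "continuous_on TP (\<lambda>x. snd (theta_map k x) $ i - snd (reduce k y) $ i)" for i
    by (intro continuous_intros continuous_on_compose2[OF continuous_on_snd[OF continuous_on_id] continuous_on_theta_map]) auto
  hence c: "continuous_on TP (\<lambda>x. \<bar>snd (theta_map k x) $ i - snd (reduce k y) $ i\<bar>)" for i
    by (intro continuous_on_rabs)
  have "openin (top_of_set TP) (TP \<inter> (\<lambda>x. \<bar>snd (theta_map k x) $ i - snd (reduce k y) $ i\<bar>) -` {..<pi})" for i
    by (intro continuous_openin_preimage_gen[OF c]) auto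
  hence "openin (top_of_set TP) (\<Inter>i. TP \<inter> (\<lambda>x. \<bar>snd (theta_map k x) $ i - snd (reduce k y) $ i\<bar>) -` {..<pi})"
    by (intro openin_INT2) auto
  moreover have "(\<Inter>i. TP \<inter> (\<lambda>x. \<bar>snd (theta_map k x) $ i - snd (reduce k y) $ i\<bar>) -` {..<pi}) = sheet k y"
    by (auto simp: sheet_def)
  ultimately show ?thesis by simp
qed

lemma sheet_self: "of_coords y \<in> sheet k y"
  by (simp add: sheet_def of_coords_in_TP theta_map_of_coords)

lemma sheet_translate: "translate m x \<in> sheet k (vshift m y) \<longleftrightarrow> x \<in> sheet k y" if x: "x \<in> TP"
  using that by (elim TP_cases) (simp add: translate_of_coords sheet_def of_coords_in_TP theta_map_of_coords reduce_def algebra_simps)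

lemma continuous_on_lift: "continuous_on {z. (\<forall>i. z $ i \<noteq> 0) \<and> (\<forall>i. Re (ratio k y z i) > 0)} (lift k y)"
proof -
  have c: "continuous_on {z. (\<forall>i. z $ i \<noteq> 0) \<and> (\<forall>i. Re (ratio k y z i) > 0)} (\<lambda>z. ratio k y z i)" for i
    by (rule continuous_on_subset[OF continuous_on_ratio]) auto
  have np: "ratio k y z i \<notin> \<real>\<^sub>\<le>\<^sub>0" if "\<forall>i. Re (ratio k y z i) > 0" for z i
    using that by (auto simp: complex_nonpos_Reals_iff not_le)
  show ?thesis unfolding lift_def[abs_def] by (intro continuous_intros c) (use np in auto)
qed

lemma homeomorphism_sheet:
  fixes y :: "'n::finite tvec"
  shows "\<exists>q. homeomorphism (sheet k y) (tau ` sheet k y) tau q"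
proof -
  define q where "q L = of_coords (lift k y (unit_rep L))" for L
  have q: "q (line z) = of_coords (lift k y z)" if z: "z \<noteq> 0" for z
  proof -
    have "unit_rep (line z) \<noteq> 0" using unit_rep(1)[of "line z"] by auto
    from line_eqD[OF z this unit_rep(2)[symmetric]] obtain c where "c \<noteq> 0" "unit_rep (line z) = c *s z" by blast
    thus ?thesis by (simp add: q_def lift_def ratio_scale)
  qed
  have qt: "q (tau x) = x" if x: "x \<in> sheet k y" for x
  proof -
    obtain w where "x = of_coords w" using x by (auto simp: sheet_def elim: TP_cases)
    thus ?thesis using sheet_lift(2)[of w k y] x by (simp add: tau_of_coords q)
  qed
  have "continuous_on (tau ` sheet k y) q"
  proof (rule continuous_on_from_cproj[OF open_tau_sheet])
    have "continuous_on {z. z \<noteq> 0 \<and> line z \<in> tau ` sheet k y} (\<lambda>z. of_coords (lift k y z))"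
      unfolding tau_sheet_vectors by (rule continuous_on_compose2[OF continuous_on_of_coords continuous_on_lift subset_refl])
    thus "continuous_on {z. z \<noteq> 0 \<and> line z \<in> tau ` sheet k y} (\<lambda>z. q (line z))"
      by (rule continuous_on_eq) (simp add: q)
  qed
  moreover have "continuous_on (sheet k y) tau"
    by (rule continuous_on_subset[OF continuous_on_tau]) (auto simp: sheet_def)
  ultimately have "homeomorphism (sheet k y) (tau ` sheet k y) tau q"
    by (intro homeomorphismI) (auto simp: qt)
  thus ?thesis using exI[of "homeomorphism (sheet k y) (tau ` sheet k y) tau" q] by simp
qed

lemma tau_image: "tau ` TP = (cproj_units :: 'n::finite cproj set)"
proof
  show "tau ` TP \<subseteq> (cproj_units :: 'n cproj set)" using tau_in_units by blast
  show "(cproj_units :: 'n cproj set) \<subseteq> tau ` TP"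
  proof
    fix L :: "'n cproj" assume "L \<in> cproj_units"
    then obtain z where "L = line z" "\<And>i. z $ i \<noteq> 0" by (auto simp: cproj_units_def)
    thus "L \<in> tau ` TP" using tau_lift of_coords_in_TP by (metis image_eqI)
  qed
qed

text \<open>
  An integer of modulus less than 1 is 0.
\<close>

lemma lattice_separation:
  assumes m: "m \<in> int_lattice" "m' \<in> int_lattice"
    and close: "\<And>i. \<bar>4 * pi * ((m $ i - m $ k) - (m' $ i - m' $ k))\<bar> < 4 * pi"
  shows "reduce k (vshift m y) = reduce k (vshift m' y)"
proof -
  have "m $ i - m $ k = m' $ i - m' $ k" for i
  proof -
    have "(m $ i - m $ k) - (m' $ i - m' $ k) \<in> \<int>" using m unfolding int_lattice_def by auto
    then obtain l where l: "(m $ i - m $ k) - (m' $ i - m' $ k) = of_int l" by (auto elim: Ints_cases)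
    have "\<bar>real_of_int l\<bar> < 1" using close[of i] unfolding l by (simp add: abs_mult)
    hence "l = 0" by linarith
    thus ?thesis using l by simp
  qed
  hence "4 * pi * m $ i - 4 * pi * m $ k = 4 * pi * m' $ i - 4 * pi * m' $ k" for i
    by (metis (no_types) mult.assoc right_diff_distrib)
  thus ?thesis by (auto simp: reduce_def vec_eq_iff algebra_simps)
qed

text \<open>
  In each coordinate the centres of both translates are closer than \<open>\<pi>\<close> to the common point, while different
  translates are \<open>4 \<pi>\<close> apart.
\<close>

lemma sheet_overlap:
  assumes x: "x \<in> TP" and m: "m \<in> int_lattice" "m' \<in> int_lattice"
    and s: "x \<in> sheet k (vshift m y)" "x \<in> sheet k (vshift m' y)"
  shows "translate m = translate m'" "sheet k (vshift m y) = sheet k (vshift m' y)"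
proof -
  have "\<bar>4 * pi * ((m $ i - m $ k) - (m' $ i - m' $ k))\<bar> < 4 * pi" for i
  proof -
    define e where "e = snd (theta_map k x) $ i - snd (reduce k y) $ i"
    have "\<bar>e - 4 * pi * (m $ i - m $ k)\<bar> < pi" "\<bar>e - 4 * pi * (m' $ i - m' $ k)\<bar> < pi"
      using s by (auto simp: sheet_def reduce_def e_def algebra_simps)
    thus ?thesis unfolding right_diff_distrib[of "4 * pi" "m $ i - m $ k"] by linarith
  qed
  note r = lattice_separation[OF m this]
  show "sheet k (vshift m y) = sheet k (vshift m' y)"
    by (simp add: sheet_def r)
  show "translate m = translate m'"
  proof (rule translate_eqD[OF _ x])
    obtain w where w: "x = of_coords w" using x by (rule TP_cases)
    show "translate m x = translate m' x" unfolding w translate_of_coords of_coords_eq_iff[of _ _ k] by (rule r)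
  qed
qed

text \<open>
  The neighbourhood of a line below \<open>y\<close> is the image of the sheet around \<open>y\<close>; its preimage consists of the
  translates of this sheet.
\<close>

proposition tau_covering_space: "covering_space (TP :: 'n::finite tvec set) tau cproj_units"
proof (rule covering_spaceI[OF continuous_on_tau tau_image])
  fix L :: "'n cproj" assume "L \<in> cproj_units"
  then obtain x0 where x0: "x0 \<in> TP" "L = tau x0" using tau_image by blast
  obtain y where y: "x0 = of_coords y" using x0(1) by (rule TP_cases)
  fix k :: 'n
  define s where "s m = sheet k (vshift m y)" for m
  define T where "T = tau ` sheet k y"
  have sTP: "s m \<subseteq> TP" for m by (auto simp: s_def sheet_def)
  have sT: "tau ` s m = T" if m: "m \<in> int_lattice" for m
  proof (intro equalityI subsetI)
    fix L assume "L \<in> tau ` s m"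
    then obtain x where x: "x \<in> s m" "L = tau x" by blast
    have xTP: "x \<in> TP" using x sTP by blast
    have "translate m (translate (- m) x) = x" using xTP by (simp add: translate_translate translate_zero)
    hence "translate (- m) x \<in> sheet k y" using sheet_translate[OF translate_TP[OF xTP], of m "- m" k y] x(1) by (simp add: s_def)
    thus "L \<in> T" using x(2) tau_translate[OF lattice_minus[OF m] xTP] unfolding T_def by (metis image_eqI)
  next
    fix L assume "L \<in> T"
    then obtain x where x: "x \<in> sheet k y" "L = tau x" unfolding T_def by blast
    have xTP: "x \<in> TP" using x by (simp add: sheet_def)
    have "translate m x \<in> s m" using sheet_translate[OF xTP] x(1) by (simp add: s_def)
    thus "L \<in> tau ` s m" using x(2) tau_translate[OF m xTP] by (metis image_eqI)
  qed
  have "\<Union> (s ` int_lattice) = TP \<inter> tau -` T"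
  proof (intro equalityI subsetI)
    fix x assume "x \<in> \<Union> (s ` int_lattice)"
    thus "x \<in> TP \<inter> tau -` T" using sT sTP by blast
  next
    fix x assume x: "x \<in> TP \<inter> tau -` T"
    then obtain x' where x': "x' \<in> sheet k y" "tau x' = tau x" unfolding T_def by auto
    have x'TP: "x' \<in> TP" using x' by (simp add: sheet_def)
    obtain m where "m \<in> int_lattice" "x = translate m x'" using tau_fibre[OF x'TP _ x'(2)] x by blast
    thus "x \<in> \<Union> (s ` int_lattice)" using sheet_translate[OF x'TP] x'(1) unfolding s_def by blast
  qed
  moreover have "pairwise disjnt (s ` int_lattice)"
  proof (rule pairwiseI)
    fix u u' assume "u \<in> s ` int_lattice" "u' \<in> s ` int_lattice" "u \<noteq> u'"
    then obtain m m' where m: "m \<in> int_lattice" "m' \<in> int_lattice" "u = s m" "u' = s m'" by blast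
    have "s m = s m'" if "x \<in> s m" "x \<in> s m'" for x
      using sheet_overlap(2)[OF _ m(1,2), of x k y] that sTP by (auto simp: s_def)
    thus "disjnt u u'" using m \<open>u \<noteq> u'\<close> by (auto simp: disjnt_def)
  qed
  moreover have "\<exists>q. homeomorphism u T tau q" if "u \<in> s ` int_lattice" for u
  proof -
    obtain m where m: "m \<in> int_lattice" "u = s m" using \<open>u \<in> s ` int_lattice\<close> by blast
    show ?thesis using homeomorphism_sheet[of k "y + (0, (4 * pi) *\<^sub>R m)"] sT[OF m(1)] by (simp add: m(2) s_def)
  qed
  moreover have "openin (top_of_set cproj_units) T"
  proof -
    have "T \<subseteq> cproj_units" using tau_image by (auto simp: T_def sheet_def)
    thus ?thesis using open_tau_sheet[of k y] by (simp add: T_def open_subset)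
  qed
  moreover have "L \<in> T" unfolding T_def x0(2) y by (rule imageI[OF sheet_self])
  ultimately show "\<exists>T. L \<in> T \<and> openin (top_of_set cproj_units) T \<and>
      (\<exists>v. \<Union>v = TP \<inter> tau -` T \<and> (\<forall>u\<in>v. openin (top_of_set TP) u) \<and> pairwise disjnt v \<and> (\<forall>u\<in>v. \<exists>q. homeomorphism u T tau q))"
    by (intro exI[of _ T] conjI exI[of _ "s ` int_lattice"]) (auto simp: s_def openin_sheet)
qed

section \<open>The deck transformation group\<close>

lemma continuous_on_translate: "continuous_on TP (translate m)"
proof -
  have "continuous_on TP (\<lambda>x. of_coords (log_coords x + (0, (4 * pi) *\<^sub>R m)))"
    unfolding log_coords_def
    by (rule continuous_on_compose2[OF continuous_on_of_coords[of UNIV]], intro continuous_intros)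
      (auto simp: TP_iff prob_posD less_imp_neq[symmetric])
  thus ?thesis by (rule continuous_on_eq) (simp add: translate_def)
qed

lemma homeomorphism_translate: "homeomorphism TP TP (translate m) (translate (- m))"
  by (rule homeomorphismI) (auto simp: continuous_on_translate translate_TP translate_translate translate_zero)

text \<open>
  Deck transformations and lattice translations are lifts of the covering map through itself.  A deck
  transformation agrees with some translation at one point, because the translations are transitive on
  fibres, and lifts from a connected space that agree at one point agree everywhere.
\<close>

lemma deck_group_eq: "deck_group TP tau = (translate ` int_lattice :: ('n::finite tvec \<Rightarrow> 'n tvec) set)"
proof (intro equalityI subsetI)
  fix \<phi> :: "'n tvec \<Rightarrow> 'n tvec" assume "\<phi> \<in> translate ` int_lattice"
  then obtain m where m: "m \<in> int_lattice" "\<phi> = translate m" by blast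
  show "\<phi> \<in> deck_group TP tau"
    unfolding deck_group_def m(2) using homeomorphism_translate tau_translate[OF m(1)] by (auto simp: translate_def)
next
  fix \<phi> :: "'n tvec \<Rightarrow> 'n tvec" assume "\<phi> \<in> deck_group TP tau"
  then obtain \<psi> where \<phi>: "\<phi> \<in> extensional TP" "homeomorphism TP TP \<phi> \<psi>" "\<And>x. x \<in> TP \<Longrightarrow> tau (\<phi> x) = tau x"
    by (auto simp: deck_group_def)
  have cont: "continuous_on TP \<phi>" and im: "\<And>x. x \<in> TP \<Longrightarrow> \<phi> x \<in> TP"
    using \<phi>(2) by (auto simp: homeomorphism_def)
  define x0 :: "'n tvec" where "x0 = of_coords 0"
  have x0: "x0 \<in> TP" by (simp add: x0_def of_coords_in_TP)
  obtain m where m: "m \<in> int_lattice" "\<phi> x0 = translate m x0"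
    using tau_fibre[OF x0 im[OF x0]] \<phi>(3)[OF x0] by metis
  have "\<phi> x = translate m x" if x: "x \<in> TP" for x
  proof (rule covering_space_lift_unique[where f=tau and T=TP and c=TP and p=tau and S=cproj_units and a=x0
        and ?g1.0=\<phi> and ?g2.0="translate m", OF tau_covering_space m(2) continuous_on_tau])
    show "connected (TP :: 'n tvec set)" by (rule simply_connected_imp_connected[OF simply_connected_TP])
  qed (use \<phi>(3) tau_translate[OF m(1)] im translate_TP cont continuous_on_translate x0 x tau_in_units in auto)
  hence "\<phi> = translate m"
    using \<phi>(1) by (intro extensionalityI[of _ TP]) (auto simp: translate_def)
  thus "\<phi> \<in> translate ` int_lattice" using m(1) by blast
qed

section \<open>The group of Kaehler symmetries\<close>

lemma translation_smooth:
  assumes g: "\<And>y. g (of_coords y) = of_coords (y + d)"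
  shows "smooth_map TP_kahler TP_kahler g"
proof -
  have im: "g x \<in> TP" if "x \<in> TP" for x using that by (elim TP_cases) (simp add: g of_coords_in_TP)
  have "Ck_on (model k) j (model k) (theta_map k' \<circ> g \<circ> inv_into TP (theta_map k))" for k k' j
  proof (rule Ck_on_cong[OF subspace_model])
    show "Ck_on (model k) j (model k) (\<lambda>y. reduce k' (y + d))"
      by (intro Ck_on_bounded_linear_compose[OF bounded_linear_reduce] Ck_on_add Ck_on_const Ck_on_bounded_linear bounded_linear_ident)
  qed (auto simp: inv_into_theta_map g theta_map_of_coords)
  moreover have "TP \<inter> g -` TP = TP" using im by auto
  ultimately show ?thesis
    using im by (auto simp: smooth_map_def theta_chart_eq theta_map_image smooth_on_def)
qed

lemma diffeo_translate: "diffeo TP_kahler TP_kahler (translate m)"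
proof -
  have bij: "bij_betw (translate m) TP TP"
    by (rule bij_betw_byWitness[where f'="translate (- m)"]) (auto simp: translate_translate translate_zero translate_TP)
  have inv: "inv_into TP (translate m) (of_coords y) = of_coords (vshift (- m) y)" for y
  proof (rule inv_into_f_eq)
    show "inj_on (translate m) TP" using bij by (simp add: bij_betw_def)
    show "translate m (of_coords (vshift (- m) y)) = of_coords y"
    proof -
      have "(vshift (- m) y) + (0, (4 * pi) *\<^sub>R m) = y" by (simp add: prod_eq_iff)
      thus ?thesis by (simp only: translate_of_coords)
    qed
  qed (rule of_coords_in_TP)
  show ?thesis
    unfolding diffeo_def using bij translation_smooth[OF translate_of_coords] translation_smooth[OF inv] by simp
qed

text \<open>
  Metric and complex structure can be transported to the projective space, where translations become invisible.
\<close>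

lemma tau_push_translate:
  assumes m: "m \<in> int_lattice" and A: "A \<in> tangent_space TP_kahler x"
  shows "tau_push (pushforward TP_kahler (translate m) A) = tau_push A"
    "pushforward TP_kahler (translate m) A \<in> tangent_space TP_kahler (translate m x)"
proof -
  have d: "diff_map TP_kahler TP_kahler (translate m)"
    by (rule smooth_map_imp_diff_map[OF TP_atlas translation_smooth[OF translate_of_coords]])
  have "tau_push (pushforward TP_kahler (translate m) A) = pushforward units_kahler (tau \<circ> translate m) A"
    by (rule pushforward_compose[OF TP_diff_manifold TP_diff_manifold units_diff_manifold d tau_diff_map A])
  also have "\<dots> = tau_push A"
    by (rule pushforward_cong[OF TP_diff_manifold units_diff_manifold _ _ A, symmetric, OF tau_diff_map]) (simp add: tau_translate[OF m])
  finally show "tau_push (pushforward TP_kahler (translate m) A) = tau_push A" .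
  show "pushforward TP_kahler (translate m) A \<in> tangent_space TP_kahler (translate m x)"
    by (rule pushforward_in_tangent_space[OF TP_diff_manifold TP_diff_manifold d A])
qed

text \<open>
  The functions with \<open>a = b\<close> return the probabilities; those with \<open>c = 0\<close> and \<open>c = - \<pi>\<close> return cosine and sine of
  \<open>(u\<^sub>a - u\<^sub>b)/2\<close>, hence all phases up to a common one.
\<close>

lemma tau_eq_of_interference:
  assumes x: "x \<in> TP" "x' \<in> TP" and e: "\<And>a b c. interference a b c x = interference a b c x'"
  shows "tau x = tau x'"
proof -
  fix k :: 'a
  obtain p u p' u' where xs: "x = (p, u)" "x' = (p', u')" by (cases x, cases x') auto
  have pos: "p $ a > 0" "p' $ a > 0" for a using x by (auto simp: xs TP_iff prob_posD)
  have pp: "p = p'"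
  proof -
    have "p $ a = p' $ a" for a using e[of a a 0] pos[of a] by (simp add: xs interference_def real_sqrt_mult_self)
    thus ?thesis by (simp add: vec_eq_iff)
  qed
  have c: "cos ((u $ a - u $ b + c) / 2) = cos ((u' $ a - u' $ b + c) / 2)" for a b c
    using e[of a b c] pos(1)[of a] pos(1)[of b] by (simp add: xs interference_def pp[symmetric])
  have ex: "exp (\<i> * complex_of_real ((u $ a - u $ k) / 2)) = exp (\<i> * complex_of_real ((u' $ a - u' $ k) / 2))" for a
  proof -
    have "(t + - pi) / 2 = t / 2 - pi / 2" for t :: real by (simp add: diff_divide_distrib)
    hence "sin ((u $ a - u $ k) / 2) = sin ((u' $ a - u' $ k) / 2)"
      using c[of a k "- pi"] by (simp add: cos_diff diff_divide_distrib)
    thus ?thesis using c[of a k 0] by (simp add: complex_eq_iff Re_exp Im_exp)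
  qed
  define \<mu> where "\<mu> = exp (\<i> * complex_of_real ((u' $ k - u $ k) / 2))"
  have "exp (\<i> * complex_of_real (u' $ a) / 2) = \<mu> * exp (\<i> * complex_of_real (u $ a) / 2)" for a
  proof -
    have "exp (\<i> * complex_of_real (u' $ a) / 2) = exp (\<i> * complex_of_real ((u' $ a - u' $ k) / 2)) * exp (\<i> * complex_of_real (u' $ k / 2))"
      by (simp add: exp_add[symmetric] algebra_simps diff_divide_distrib)
    also have "\<dots> = exp (\<i> * complex_of_real ((u $ a - u $ k) / 2)) * exp (\<i> * complex_of_real (u' $ k / 2))" by (simp only: ex)
    also have "\<dots> = \<mu> * exp (\<i> * complex_of_real (u $ a) / 2)"
      by (simp add: \<mu>_def exp_add[symmetric] algebra_simps diff_divide_distrib)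
    finally show ?thesis .
  qed
  hence *: "(\<chi> k. complex_of_real (sqrt (p' $ k)) * exp (\<i> * complex_of_real (u' $ k) / 2))
     = \<mu> *s (\<chi> k. complex_of_real (sqrt (p $ k)) * exp (\<i> * complex_of_real (u $ k) / 2))"
    by (simp add: vec_eq_iff pp)
  have "\<mu> \<noteq> 0" by (simp add: \<mu>_def)
  thus ?thesis unfolding tau_def xs prod.case * by (rule line_scale[symmetric])
qed

lemma smooth_TP_continuous:
  fixes g :: "'n::finite tvec \<Rightarrow> 'n tvec"
  assumes g: "smooth_map TP_kahler TP_kahler g"
  shows "continuous_on TP g"
proof -
  fix k :: 'n
  have im: "g x \<in> TP" if "x \<in> TP" for x using g that by (auto simp: smooth_map_def)
  have "smooth_on (model k) (theta_map k ` (TP \<inter> g -` TP)) (theta_map k \<circ> g \<circ> inv_into TP (theta_map k))"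
    using g by (auto simp: smooth_map_def theta_chart_eq)
  moreover have "TP \<inter> g -` TP = TP" using im by auto
  ultimately have "\<forall>j. Ck_on (model k) j (model k) (theta_map k \<circ> g \<circ> inv_into TP (theta_map k))"
    unfolding smooth_on_def by (metis theta_map_image)
  hence "Ck_on (model k) 0 (model k) (theta_map k \<circ> g \<circ> inv_into TP (theta_map k))" by blast
  hence c: "continuous_on (model k) (theta_map k \<circ> g \<circ> inv_into TP (theta_map k))" by simp
  have "continuous_on TP (\<lambda>x. of_coords ((theta_map k \<circ> g \<circ> inv_into TP (theta_map k)) (theta_map k x)))"
    by (rule continuous_on_compose2[OF continuous_on_of_coords continuous_on_compose2[OF c continuous_on_theta_map] subset_refl])
      (simp add: theta_map_image)
  thus ?thesis
    by (rule continuous_on_eq) (simp add: inv_into_f_f[OF theta_map_inj] of_coords_theta_map im)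
qed

text \<open>
  An element of the group preserves all interference functions, so it preserves the fibres.  A deck
  transformation is a lattice translation: it preserves the tensors because the covering map does
  and is injective on tangent spaces, and it preserves Kaehler functions by their periodicity.
\<close>

proposition Gamma_eq_deck_group: "Gamma_group TP_kahler = (deck_group TP tau :: ('n::finite tvec \<Rightarrow> 'n tvec) set)"
proof (intro equalityI subsetI)
  fix \<phi> :: "'n tvec \<Rightarrow> 'n tvec" assume G: "\<phi> \<in> Gamma_group TP_kahler"
  hence ext: "\<phi> \<in> extensional TP" and d: "diffeo TP_kahler TP_kahler \<phi>"
    and K: "\<And>f x. f \<in> kahler_functions TP_kahler \<Longrightarrow> x \<in> TP \<Longrightarrow> f (\<phi> x) = f x"
    by (auto simp: Gamma_group_def)
  from d have bij: "bij_betw \<phi> TP TP" and sm: "smooth_map TP_kahler TP_kahler \<phi>" "smooth_map TP_kahler TP_kahler (inv_into TP \<phi>)"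
    by (auto simp: diffeo_def)
  have im: "\<phi> x \<in> TP" if "x \<in> TP" for x using bij that by (auto simp: bij_betw_def)
  have "homeomorphism TP TP \<phi> (inv_into TP \<phi>)"
    using bij smooth_TP_continuous[OF sm(1)] smooth_TP_continuous[OF sm(2)]
    by (intro homeomorphismI) (auto simp: bij_betw_def inv_into_into f_inv_into_f)
  moreover have "tau (\<phi> x) = tau x" if x: "x \<in> TP" for x
    by (rule tau_eq_of_interference[OF im[OF x] x]) (rule K[OF interference_kahler x])
  ultimately show "\<phi> \<in> deck_group TP tau" using ext by (auto simp: deck_group_def)
next
  fix \<phi> :: "'n tvec \<Rightarrow> 'n tvec" assume "\<phi> \<in> deck_group TP tau"
  then obtain m where m: "m \<in> int_lattice" "\<phi> = translate m" unfolding deck_group_eq by blast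
  have "metric TP_kahler (pushforward TP_kahler \<phi> A) (pushforward TP_kahler \<phi> B) = metric TP_kahler A B"
    if "A \<in> tangent_space TP_kahler x" "B \<in> tangent_space TP_kahler x" for x A B
    using tau_push_isometry(1)[OF that] tau_push_isometry(1)[OF tau_push_translate(2)[OF m(1) that(1)] tau_push_translate(2)[OF m(1) that(2)]]
    by (simp add: m(2) tau_push_translate(1)[OF m(1) that(1)] tau_push_translate(1)[OF m(1) that(2)])
  moreover have "pushforward TP_kahler \<phi> (cplx TP_kahler A) = cplx TP_kahler (pushforward TP_kahler \<phi> A)"
    if A: "A \<in> tangent_space TP_kahler x" for x A
  proof (rule tau_push_inj)
    note A' = tau_push_translate(2)[OF m(1) A]
    show "pushforward TP_kahler \<phi> (cplx TP_kahler A) \<in> tangent_space TP_kahler (translate m x)"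
      unfolding m(2) by (rule tau_push_translate(2)[OF m(1) cplx_TP_tangent[OF A]])
    show "cplx TP_kahler (pushforward TP_kahler \<phi> A) \<in> tangent_space TP_kahler (translate m x)"
      unfolding m(2) by (rule cplx_TP_tangent[OF A'])
    show "tau_push (pushforward TP_kahler \<phi> (cplx TP_kahler A)) = tau_push (cplx TP_kahler (pushforward TP_kahler \<phi> A))"
      unfolding m(2) tau_push_translate(1)[OF m(1) cplx_TP_tangent[OF A]] tau_push_cplx[OF A] tau_push_cplx[OF A'] tau_push_translate(1)[OF m(1) A] ..
  qed
  moreover have "f (\<phi> x) = f x" if f: "f \<in> kahler_functions TP_kahler" and x: "x \<in> TP" for f x
  proof -
    obtain y where y: "x = of_coords y" using x by (rule TP_cases)
    show ?thesis unfolding m(2) y translate_of_coords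
      by (rule kahler_function_lattice_translation[OF f]) (use m(1) in \<open>simp add: int_lattice_def\<close>)
  qed
  moreover have "\<phi> \<in> extensional TP" by (simp add: m(2) translate_def)
  ultimately show "\<phi> \<in> Gamma_group TP_kahler"
    using diffeo_translate[of m] by (auto simp: Gamma_group_def m(2))
qed

lemma Gamma_eq: "Gamma_group TP_kahler = translate ` int_lattice"
  by (simp add: Gamma_eq_deck_group deck_group_eq)

lemma translate_Bij: "translate m \<in> Bij TP"
  using diffeo_translate[of m] by (simp add: Bij_def diffeo_def) (simp add: translate_def)

lemma subgroup_translations: "subgroup (translate ` int_lattice) (BijGroup (TP :: 'n::finite tvec set))"
proof -
  interpret B: group "BijGroup (TP :: 'n tvec set)" by (rule group_BijGroup)
  have mult: "translate m \<otimes>\<^bsub>BijGroup TP\<^esub> translate m' = (translate (m + m') :: 'n tvec \<Rightarrow> 'n tvec)" for m m'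
    unfolding BijGroup_def using translate_Bij
    by (auto simp: compose_def translate_translate translate_TP intro!: extensionalityI[of _ TP])
      (auto simp: translate_def)
  have one: "\<one>\<^bsub>BijGroup TP\<^esub> = (translate 0 :: 'n tvec \<Rightarrow> 'n tvec)"
    unfolding BijGroup_def
    by (auto simp: translate_zero intro!: extensionalityI[of _ TP]) (auto simp: translate_def)
  have carrier: "translate m \<in> carrier (BijGroup (TP :: 'n tvec set))" for m
    by (simp add: BijGroup_def translate_Bij)
  have inv: "inv\<^bsub>BijGroup TP\<^esub> translate m = (translate (- m) :: 'n tvec \<Rightarrow> 'n tvec)" for m
    by (rule B.inv_equality) (auto simp: mult one carrier)
  show ?thesis
    by (rule B.subgroupI) (auto simp: carrier inv mult lattice_minus lattice_add intro: lattice_zero)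
qed

section \<open>The action of the lattice\<close>

text \<open>
  A translation is isolated by where it sends one point: to a sheet that contains no other translate of this point.
\<close>

lemma singleton_open:
  assumes m: "m \<in> int_lattice"
  shows "openin (compact_open_topology TP (translate ` int_lattice)) {translate m}"
proof -
  fix k :: 'a
  let ?x = "of_coords 0 :: 'a tvec"
  let ?V = "sheet k (vshift m 0) :: 'a tvec set"
  have eq: "{\<gamma> \<in> translate ` int_lattice. \<gamma> ` {?x} \<subseteq> ?V} = {translate m}"
  proof (intro equalityI subsetI)
    fix \<gamma> assume "\<gamma> \<in> {\<gamma> \<in> translate ` int_lattice. \<gamma> ` {?x} \<subseteq> ?V}"
    then obtain m' where m': "m' \<in> int_lattice" "\<gamma> = translate m'" "translate m' ?x \<in> ?V" by auto
    have "translate m' ?x \<in> sheet k (vshift m' 0)"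
      using sheet_self by (simp add: translate_of_coords)
    from sheet_overlap(1)[OF translate_TP[OF of_coords_in_TP] m m'(1) m'(3) this] m'(2) show "\<gamma> \<in> {translate m}" by simp
  next
    fix \<gamma> assume "\<gamma> \<in> {translate m}"
    thus "\<gamma> \<in> {\<gamma> \<in> translate ` int_lattice. \<gamma> ` {?x} \<subseteq> ?V}"
      using m sheet_self[of "(0, (4 * pi) *\<^sub>R m)" k] translate_of_coords[of m 0] by simp
  qed
  have "{\<gamma> \<in> translate ` int_lattice. \<gamma> ` {?x} \<subseteq> ?V} \<in>
     {{\<gamma>\<in>translate ` int_lattice. \<gamma> ` C \<subseteq> V} |C V. compact C \<and> C \<subseteq> TP \<and> openin (top_of_set TP) V}"
    unfolding mem_Collect_eq
    by (rule exI[of _ "{?x}"], rule exI[of _ ?V]) (intro conjI refl openin_sheet, simp_all add: of_coords_in_TP)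
  from topology_generated_by_Basis[OF this] show ?thesis
    unfolding eq compact_open_topology_def .
qed

lemma discrete_translations: "discrete_group TP (translate ` int_lattice)"
proof -
  let ?X = "compact_open_topology TP (translate ` int_lattice)"
  have "topspace ?X \<subseteq> translate ` int_lattice"
    unfolding compact_open_topology_def topology_generated_by_topspace by auto
  hence "openin ?X U \<Longrightarrow> U \<subseteq> translate ` int_lattice" for U using openin_subset by blast
  moreover have "openin ?X U" if U: "U \<subseteq> translate ` int_lattice" for U
  proof -
    have "openin ?X (\<Union>((\<lambda>\<gamma>. {\<gamma>}) ` U))"
      by (rule openin_Union) (use U singleton_open in auto)
    thus ?thesis by simp
  qed
  ultimately show ?thesis unfolding discrete_group_def topology_eq by auto
qed

lemma free_translations: "acts_freely TP (translate ` (int_lattice :: (real^'n::finite) set))"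
  unfolding acts_freely_def
proof (intro ballI impI)
  fix \<gamma> and x :: "'n tvec"
  assume "\<gamma> \<in> translate ` (int_lattice :: (real^'n) set)" "\<exists>x\<in>TP. \<gamma> x = x" and x: "x \<in> TP"
  then obtain m x0 where m: "\<gamma> = translate m" "x0 \<in> TP" "translate m x0 = x0"
    by blast
  have "translate m = translate 0" by (rule translate_eqD[OF _ m(2)]) (simp add: m(3) translate_zero[OF m(2)])
  show "\<gamma> x = x" unfolding m(1) \<open>translate m = _\<close> by (rule translate_zero[OF x])
qed

text \<open>
  The map \<open>(\<gamma>, x) \<mapsto> (\<gamma> x, x)\<close> is injective since the action is free, so it is enough that it is closed.  The image of a closed set
  is a union of closed subsets of graphs, and this family is locally finite: a product of two sheets meets
  the graph of at most one translation.
\<close>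

lemma proper_translations: "acts_properly TP (translate ` (int_lattice :: (real^'n::finite) set))"
proof -
  fix k :: 'n
  define G where "G = translate ` (int_lattice :: (real^'n) set)"
  define act where "act = (\<lambda>(\<gamma> :: 'n tvec \<Rightarrow> 'n tvec, x :: 'n tvec). (\<gamma> x, x))"
  let ?X = "prod_topology (discrete_topology G) (top_of_set (TP :: 'n tvec set))"
  let ?Y = "top_of_set (TP \<times> TP :: ('n tvec \<times> 'n tvec) set)"
  have Gi: "\<gamma> x \<in> TP" "continuous_on TP \<gamma>" if "\<gamma> \<in> G" "x \<in> TP" for \<gamma> x
    using that(1) translate_TP[OF that(2)] continuous_on_translate by (auto simp: G_def)
  have graph: "closedin ?Y {(\<gamma> x, x) |x. (\<gamma>, x) \<in> K}" if K: "closedin ?X K" and \<gamma>: "\<gamma> \<in> G" for K \<gamma>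
  proof -
    have "K \<subseteq> G \<times> TP" using closedin_subset[OF K] by simp
    have "continuous_map (top_of_set TP) ?X (\<lambda>x. (\<gamma>, x))"
      using \<gamma> by (intro continuous_map_pairedI) auto
    from closedin_continuous_map_preimage[OF this K] have 1: "closedin (top_of_set TP) {x \<in> TP. (\<gamma>, x) \<in> K}" by simp
    have "closedin ?Y ((TP \<times> TP) \<inter> snd -` {x \<in> TP. (\<gamma>, x) \<in> K})"
      by (rule continuous_closedin_preimage_gen[OF _ _ 1]) (auto intro: continuous_intros)
    moreover have "continuous_on (TP \<times> TP) (\<lambda>q :: 'n tvec \<times> 'n tvec. fst q - \<gamma> (snd q))"
      by (intro continuous_intros continuous_on_compose2[OF Gi(2)[OF \<gamma> of_coords_in_TP]]) auto
    hence "closedin ?Y {q \<in> TP \<times> TP. fst q - \<gamma> (snd q) = 0}"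
      by (rule continuous_closedin_preimage_constant)
    ultimately have "closedin ?Y ((TP \<times> TP) \<inter> snd -` {x \<in> TP. (\<gamma>, x) \<in> K} \<inter> {q \<in> TP \<times> TP. fst q - \<gamma> (snd q) = 0})"
      by (rule closedin_Int)
    moreover have "(TP \<times> TP) \<inter> snd -` {x \<in> TP. (\<gamma>, x) \<in> K} \<inter> {q \<in> TP \<times> TP. fst q - \<gamma> (snd q) = 0} = {(\<gamma> x, x) |x. (\<gamma>, x) \<in> K}"
      using \<open>K \<subseteq> G \<times> TP\<close> Gi(1)[OF \<gamma>] by auto
    ultimately show ?thesis by simp
  qed
  have "closed_map ?X ?Y act"
    unfolding closed_map_def
  proof (intro allI impI)
    fix K assume K: "closedin ?X K"
    have KG: "K \<subseteq> G \<times> TP" using closedin_subset[OF K] by simp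
    define S where "S \<gamma> = {(\<gamma> x, x) |x. (\<gamma>, x) \<in> K}" for \<gamma>
    have "closedin ?Y (\<Union>(S ` G))"
    proof (rule closedin_locally_finite_Union)
      show "closedin ?Y T" if "T \<in> S ` G" for T using that graph[OF K] by (auto simp: S_def)
      have near: "finite {T \<in> S ` G. T \<inter> (sheet k a \<times> sheet k b) \<noteq> {}}" for a b
      proof -
        have sep: "\<gamma> = \<gamma>'" if g: "\<gamma> \<in> G" "\<gamma>' \<in> G" and x: "x \<in> sheet k b" "\<gamma> x \<in> sheet k a" and x': "x' \<in> sheet k b" "\<gamma>' x' \<in> sheet k a" for \<gamma> \<gamma>' x x'
        proof -
          obtain m m' where m: "m \<in> int_lattice" "\<gamma> = translate m" "m' \<in> int_lattice" "\<gamma>' = translate m'" using g by (auto simp: G_def)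
          obtain w where w: "x = of_coords w" using x(1) by (auto simp: sheet_def elim: TP_cases)
          obtain w' where w': "x' = of_coords w'" using x'(1) by (auto simp: sheet_def elim: TP_cases)
          have "\<bar>4 * pi * ((m $ i - m $ k) - (m' $ i - m' $ k))\<bar> < 4 * pi" for i
          proof -
            define r where "r v = snd v $ i - snd v $ k" for v :: "'n tvec"
            have "\<bar>r w - r b\<bar> < pi" "\<bar>r w' - r b\<bar> < pi" "\<bar>r w + 4 * pi * (m $ i - m $ k) - r a\<bar> < pi" "\<bar>r w' + 4 * pi * (m' $ i - m' $ k) - r a\<bar> < pi"
              using x x' unfolding m(2,4) w w' translate_of_coords
              by (auto simp: sheet_def theta_map_of_coords reduce_def r_def algebra_simps)
            thus ?thesis unfolding right_diff_distrib[of "4 * pi" "m $ i - m $ k"] by linarith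
          qed
          from lattice_separation[OF m(1,3) this, of w]
          have "translate m x = translate m' x" unfolding w translate_of_coords of_coords_eq_iff[of _ _ k] .
          from translate_eqD[OF this] show ?thesis using x(1) by (simp add: m sheet_def)
        qed
        have uniq: "\<gamma> = \<gamma>'" if "\<gamma> \<in> G" "\<gamma>' \<in> G" "S \<gamma> \<inter> (sheet k a \<times> sheet k b) \<noteq> {}" "S \<gamma>' \<inter> (sheet k a \<times> sheet k b) \<noteq> {}" for \<gamma> \<gamma>'
        proof -
          obtain x x' where "x \<in> sheet k b" "\<gamma> x \<in> sheet k a" "x' \<in> sheet k b" "\<gamma>' x' \<in> sheet k a"
            using \<open>S \<gamma> \<inter> _ \<noteq> {}\<close> \<open>S \<gamma>' \<inter> _ \<noteq> {}\<close> unfolding S_def by blast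
          with sep[OF that(1,2)] show ?thesis by blast
        qed
        show ?thesis
        proof (cases "\<exists>\<gamma>\<in>G. S \<gamma> \<inter> (sheet k a \<times> sheet k b) \<noteq> {}")
          case True
          then obtain \<gamma> where "\<gamma> \<in> G" "S \<gamma> \<inter> (sheet k a \<times> sheet k b) \<noteq> {}" by blast
          hence "{T \<in> S ` G. T \<inter> (sheet k a \<times> sheet k b) \<noteq> {}} \<subseteq> {S \<gamma>}" using uniq by blast
          thus ?thesis by (rule finite_subset) simp
        next
          case False
          hence "{T \<in> S ` G. T \<inter> (sheet k a \<times> sheet k b) \<noteq> {}} = {}" by blast
          thus ?thesis by (simp only: finite.emptyI)
        qed
      qed
      show "locally_finite_in ?Y (S ` G)"
        unfolding locally_finite_in_def
      proof (intro conjI ballI)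
        show "\<Union> (S ` G) \<subseteq> topspace ?Y" using KG Gi(1) by (auto simp: S_def)
        fix q assume "q \<in> topspace ?Y"
        then obtain x' x where q: "q = (x', x)" "x' \<in> TP" "x \<in> TP" by auto
        obtain a where a: "x' = of_coords a" using q(2) by (rule TP_cases)
        obtain b where b: "x = of_coords b" using q(3) by (rule TP_cases)
        have "openin ?Y (sheet k a \<times> sheet k b)"
          using openin_prod_Times_iff[of "top_of_set TP" "top_of_set TP" "sheet k a" "sheet k b"] openin_sheet[of k a] openin_sheet[of k b] by simp
        thus "\<exists>V. openin ?Y V \<and> q \<in> V \<and> finite {U \<in> S ` G. U \<inter> V \<noteq> {}}"
          using near[of a b] sheet_self[of a k] sheet_self[of b k] by (intro exI[of _ "sheet k a \<times> sheet k b"]) (simp add: q(1) a b)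
      qed
    qed
    moreover have "\<Union>(S ` G) = act ` K" using KG by (fastforce simp: S_def act_def)
    ultimately show "closedin ?Y (act ` K)" by simp
  qed
  moreover have "inj_on act (topspace ?X)"
    using translate_eqD by (fastforce simp: inj_on_def act_def G_def)
  ultimately have "proper_map ?X ?Y act" by (rule closed_injective_imp_proper_map)
  moreover have "compact_open_topology TP G = discrete_topology G"
    using discrete_translations unfolding discrete_group_def G_def .
  ultimately show ?thesis by (simp add: acts_properly_def act_def G_def)
qed

section \<open>The quotient by the symmetry group\<close>

abbreviation orbit_space :: "('n::finite tvec set, 'n tvec) kahler" where
  "orbit_space \<equiv> kahlerification TP_kahler"

abbreviation orbit :: "'n::finite tvec \<Rightarrow> 'n tvec set" where
  "orbit \<equiv> orbit_of (Gamma_group TP_kahler)"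

lemma mem_orbit_iff: "y \<in> orbit x \<longleftrightarrow> (\<exists>m\<in>int_lattice. y = translate m x)"
  by (auto simp: orbit_of_def Gamma_eq)

lemma orbit_eq_iff:
  assumes x: "x \<in> TP" "x' \<in> TP"
  shows "orbit x = orbit x' \<longleftrightarrow> tau x = tau x'"
proof
  assume e: "orbit x = orbit x'"
  have "x \<in> orbit x" unfolding mem_orbit_iff using translate_zero[OF x(1)] lattice_zero by metis
  then obtain m where "m \<in> int_lattice" "x = translate m x'" unfolding e mem_orbit_iff by blast
  thus "tau x = tau x'" using tau_translate x(2) by metis
next
  assume "tau x = tau x'"
  then obtain m where m: "m \<in> int_lattice" "x' = translate m x" using tau_fibre[OF x] by blast
  have "y \<in> orbit x \<longleftrightarrow> y \<in> orbit x'" for y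
  proof
    assume "y \<in> orbit x"
    then obtain m' where m': "m' \<in> int_lattice" "y = translate m' x" unfolding mem_orbit_iff by blast
    have "y = translate (m' + - m) x'" using x(1) by (simp add: m' m translate_translate)
    thus "y \<in> orbit x'" unfolding mem_orbit_iff using lattice_add[OF m'(1) lattice_minus[OF m(1)]] by blast
  next
    assume "y \<in> orbit x'"
    then obtain m' where m': "m' \<in> int_lattice" "y = translate m' x'" unfolding mem_orbit_iff by blast
    have "y = translate (m' + m) x" using x(1) by (simp add: m' m(2) translate_translate)
    thus "y \<in> orbit x" unfolding mem_orbit_iff using lattice_add[OF m'(1) m(1)] by blast
  qed
  thus "orbit x = orbit x'" by blast
qed

text \<open>
  The map induced by the covering map on orbits; on an orbit the image under \<^const>\<open>tau\<close> is a singleton.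
\<close>

definition orbit_tau :: "'n::finite tvec set \<Rightarrow> 'n cproj" where
  "orbit_tau O' = the_elem (tau ` O')"

lemma orbit_tau: "x \<in> TP \<Longrightarrow> orbit_tau (orbit x) = tau x"
proof -
  assume x: "x \<in> TP"
  have "tau ` orbit x = {tau x}"
  proof (intro equalityI subsetI)
    fix L assume "L \<in> {tau x}"
    moreover have "x \<in> orbit x" unfolding mem_orbit_iff using translate_zero[OF x] lattice_zero by metis
    ultimately show "L \<in> tau ` orbit x" by blast
  next
    fix L assume "L \<in> tau ` orbit x"
    then obtain m where "m \<in> int_lattice" "L = tau (translate m x)" unfolding image_iff Bex_def mem_orbit_iff by blast
    thus "L \<in> {tau x}" using tau_translate[OF _ x] by simp
  qed
  thus ?thesis by (simp add: orbit_tau_def)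
qed

text \<open>
  The description of the quotient for this particular manifold, all of whose charts have the whole space as domain.
\<close>

lemma quotient_simps:
  fixes KQ :: "('n::finite tvec set, 'n tvec) kahler"
  defines "KQ \<equiv> orbit_space"
  shows "points KQ = orbit ` TP"
    "charts KQ = {(orbit ` U, theta_map k \<circ> inv_into U orbit, model k) |U k.
       U \<subseteq> TP \<and> openin (top_of_set (model k)) (theta_map k ` U) \<and> inj_on orbit U}"
    "metric KQ X Y = (THE r. \<exists>x\<in>TP. \<exists>A\<in>tangent_space TP_kahler x. \<exists>B\<in>tangent_space TP_kahler x.
       pushforward KQ orbit A = X \<and> pushforward KQ orbit B = Y \<and> r = metric TP_kahler A B)"
    "symp KQ X Y = (THE r. \<exists>x\<in>TP. \<exists>A\<in>tangent_space TP_kahler x. \<exists>B\<in>tangent_space TP_kahler x.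
       pushforward KQ orbit A = X \<and> pushforward KQ orbit B = Y \<and> r = symp TP_kahler A B)"
    "cplx KQ X = (THE Y. \<exists>x\<in>TP. \<exists>A\<in>tangent_space TP_kahler x.
       pushforward KQ orbit A = X \<and> Y = pushforward KQ orbit (cplx TP_kahler A))"
proof -
  define Q where "Q = \<lparr>points = orbit ` points (TP_kahler :: ('n tvec, 'n tvec) kahler),
     charts = {(orbit ` U, \<phi> \<circ> inv_into U orbit, W) |U U' \<phi> W.
        (U', \<phi>, W) \<in> charts (TP_kahler :: ('n tvec, 'n tvec) kahler) \<and> U \<subseteq> U' \<and> openin (top_of_set W) (\<phi> ` U) \<and> inj_on orbit U}\<rparr>"
  have KQ: "points KQ = points Q" "charts KQ = charts Q"
    by (simp_all add: KQ_def Q_def kahlerification_def quotient_kahler_def Let_def)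
  have pf: "pushforward KQ f = pushforward Q f" for f :: "'n tvec \<Rightarrow> 'n tvec set"
    by (rule charts_eq_imp_same_tangents(4)[OF KQ(2)])
  show "points KQ = orbit ` TP" unfolding KQ by (simp add: Q_def)
  show "charts KQ = {(orbit ` U, theta_map k \<circ> inv_into U orbit, model k) |U k.
       U \<subseteq> TP \<and> openin (top_of_set (model k)) (theta_map k ` U) \<and> inj_on orbit U}"
    unfolding KQ
  proof (intro equalityI subsetI)
    fix \<kappa> assume "\<kappa> \<in> {(orbit ` U, theta_map (k :: 'n) \<circ> inv_into U orbit, model k) |U k.
       U \<subseteq> TP \<and> openin (top_of_set (model k)) (theta_map k ` U) \<and> inj_on orbit U}"
    then obtain U k where k: "\<kappa> = (orbit ` U, theta_map k \<circ> inv_into U orbit, model k)"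
      "U \<subseteq> TP" "openin (top_of_set (model k)) (theta_map k ` U)" "inj_on orbit U" by blast
    moreover have "(TP, theta_map k, model k) \<in> charts (TP_kahler :: ('n tvec, 'n tvec) kahler)"
      by (simp add: theta_chart_eq[symmetric])
    ultimately show "\<kappa> \<in> charts Q" unfolding Q_def manifold.simps mem_Collect_eq by blast
  qed (auto simp: Q_def theta_chart_eq)
  show "metric KQ X Y = (THE r. \<exists>x\<in>TP. \<exists>A\<in>tangent_space TP_kahler x. \<exists>B\<in>tangent_space TP_kahler x.
       pushforward KQ orbit A = X \<and> pushforward KQ orbit B = Y \<and> r = metric TP_kahler A B)"
    "symp KQ X Y = (THE r. \<exists>x\<in>TP. \<exists>A\<in>tangent_space TP_kahler x. \<exists>B\<in>tangent_space TP_kahler x.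
       pushforward KQ orbit A = X \<and> pushforward KQ orbit B = Y \<and> r = symp TP_kahler A B)"
    "cplx KQ X = (THE Y. \<exists>x\<in>TP. \<exists>A\<in>tangent_space TP_kahler x.
       pushforward KQ orbit A = X \<and> Y = pushforward KQ orbit (cplx TP_kahler A))"
    unfolding pf unfolding KQ_def Q_def kahlerification_def quotient_kahler_def Let_def kahler.simps TP_kahler_simps(1) by (rule refl)+
qed

lemma quotient_chart:
  assumes U: "U \<subseteq> TP" "inj_on orbit U"
  shows "(theta_map k \<circ> inv_into U orbit) ` (orbit ` U) = theta_map k ` U"
    "inj_on (theta_map k \<circ> inv_into U orbit) (orbit ` U)"
    "y \<in> theta_map k ` U \<Longrightarrow> of_coords y \<in> U \<and> inv_into (orbit ` U) (theta_map k \<circ> inv_into U orbit) y = orbit (of_coords y)"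
proof -
  show "(theta_map k \<circ> inv_into U orbit) ` (orbit ` U) = theta_map k ` U"
    using U by (force simp: image_image inv_into_f_f)
  have "inj_on (theta_map k) U" using theta_map_inj U(1) inj_on_subset by blast
  thus inj: "inj_on (theta_map k \<circ> inv_into U orbit) (orbit ` U)"
    using U(2) by (auto simp: inj_on_def inv_into_f_f)
  assume "y \<in> theta_map k ` U"
  then obtain x where x: "x \<in> U" "y = theta_map k x" by blast
  hence xy: "of_coords y = x" using U(1) of_coords_theta_map by blast
  show "of_coords y \<in> U \<and> inv_into (orbit ` U) (theta_map k \<circ> inv_into U orbit) y = orbit (of_coords y)"
    unfolding xy using x U(2) by (auto intro!: inv_into_f_eq[OF inj])
qed

lemma orbit_inj_on_sheet: "inj_on orbit (sheet k y)"
proof -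
  obtain q where "homeomorphism (sheet k y) (tau ` sheet k y) tau q" using homeomorphism_sheet by blast
  hence "inj_on tau (sheet k y)" by (intro inj_on_inverseI[of _ q]) (simp add: homeomorphism_def)
  moreover have "sheet k y \<subseteq> TP" by (auto simp: sheet_def)
  ultimately show ?thesis unfolding inj_on_def by (meson orbit_eq_iff subsetD)
qed

lemma openin_theta_image:
  "openin (top_of_set TP) U \<Longrightarrow> openin (top_of_set (model k)) (theta_map k ` U)"
  by (rule homeomorphism_imp_open_map[OF homeomorphism_theta_map])

lemma quotient_atlas: "manifold_atlas (orbit_space :: ('n::finite tvec set, 'n tvec) kahler)"
  unfolding manifold_atlas_def
proof (intro conjI ballI)
  fix \<kappa> assume "\<kappa> \<in> charts (orbit_space :: ('n tvec set, 'n tvec) kahler)"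
  then obtain U k where k: "\<kappa> = (orbit ` U, theta_map k \<circ> inv_into U orbit, model k)"
    "U \<subseteq> TP" "openin (top_of_set (model k)) (theta_map k ` U)" "inj_on orbit U"
    unfolding quotient_simps by blast
  show "case \<kappa> of (U, \<phi>, W) \<Rightarrow> subspace W \<and> U \<subseteq> points (orbit_space :: ('n tvec set, 'n tvec) kahler) \<and> inj_on \<phi> U \<and> openin (top_of_set W) (\<phi> ` U)"
    unfolding k(1) prod.case quotient_chart(1)[OF k(2,4)] quotient_simps(1)
    using subspace_model k(2,3) quotient_chart(2)[OF k(2,4)] by blast
next
  fix O' assume "O' \<in> points (orbit_space :: ('n tvec set, 'n tvec) kahler)"
  then obtain x where x: "x \<in> TP" "O' = orbit x" unfolding quotient_simps by blast
  obtain y where y: "x = of_coords y" using x(1) by (rule TP_cases)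
  fix k :: 'n
  let ?U = "sheet k y"
  have "(orbit ` ?U, theta_map k \<circ> inv_into ?U orbit, model k) \<in> charts (orbit_space :: ('n tvec set, 'n tvec) kahler)"
    unfolding quotient_simps
    using openin_theta_image[OF openin_sheet[of k y], of k] orbit_inj_on_sheet[of k y] by (auto simp: sheet_def)
  moreover have "O' \<in> orbit ` ?U" using sheet_self[of y k] by (simp add: x(2) y)
  ultimately show "\<exists>(U, \<phi>, W)\<in>charts (orbit_space :: ('n tvec set, 'n tvec) kahler). O' \<in> U"
    by (intro bexI) auto
qed

lemma orbit_tau_smooth:
  "smooth_map (orbit_space :: ('n::finite tvec set, 'n tvec) kahler) units_kahler orbit_tau"
proof (rule smooth_map_to_units[OF quotient_atlas])
  fix U' \<phi> W assume "(U', \<phi>, W) \<in> charts (orbit_space :: ('n tvec set, 'n tvec) kahler)"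
  then obtain U k where k: "U' = orbit ` U" "\<phi> = theta_map k \<circ> inv_into U orbit" "W = model k"
    "U \<subseteq> TP" "openin (top_of_set (model k)) (theta_map k ` U)" "inj_on orbit U"
    unfolding quotient_simps by blast
  note qc = quotient_chart[OF k(4,6)]
  have "orbit_tau (inv_into U' \<phi> y) = line (expvec y)" if "y \<in> \<phi> ` U'" for y
    using qc(3)[of y k] that unfolding k(1,2) qc(1) by (simp add: orbit_tau of_coords_in_TP tau_of_coords)
  moreover have "Ck_on W j (\<phi> ` U') expvec" for j
    unfolding k(1-3) qc(1) by (rule Ck_on_expvec[OF subspace_model k(5)])
  ultimately show "\<exists>Z. (\<forall>j. Ck_on W j (\<phi> ` U') Z) \<and> (\<forall>y\<in>\<phi> ` U'. (\<forall>i. Z y $ i \<noteq> 0) \<and> orbit_tau (inv_into U' \<phi> y) = line (Z y))"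
    by (intro exI[of _ expvec]) simp
qed

lemma orbit_tau_bij: "bij_betw orbit_tau (orbit ` TP) cproj_units"
  unfolding bij_betw_def
proof
  show "inj_on orbit_tau (orbit ` TP)" by (auto simp: inj_on_def orbit_tau orbit_eq_iff)
  show "orbit_tau ` orbit ` TP = cproj_units"
    unfolding tau_image[symmetric] by (force simp: image_image orbit_tau)
qed

definition tau_orbit :: "'n::finite cproj \<Rightarrow> 'n tvec set" where
  "tau_orbit = inv_into (orbit ` TP) orbit_tau"

lemma tau_orbit: "x \<in> TP \<Longrightarrow> tau_orbit (tau x) = orbit x"
  unfolding tau_orbit_def
  by (rule inv_into_f_eq) (use orbit_tau_bij in \<open>auto simp: bij_betw_def orbit_tau\<close>)

lemma Ck_on_lift:
  fixes Z :: "'e::euclidean_space \<Rightarrow> complex^'n::finite"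
  assumes W: "subspace W" and S: "openin (top_of_set W) S" and Z: "\<And>j. Ck_on W j S Z"
    and D: "\<And>x i. x \<in> S \<Longrightarrow> Z x $ i \<noteq> 0" "\<And>x i. x \<in> S \<Longrightarrow> Re (ratio k y (Z x) i) > 0"
  shows "Ck_on W j S (\<lambda>x. lift k y (Z x))"
proof -
  have n: "Ck_on W j S (\<lambda>x. Z x $ i)" for i j
    by (rule Ck_on_bounded_linear_compose[OF bounded_linear_vec_nth Z])
  have "Ck_on W j S (\<lambda>x. (Z x $ i * inverse (Z x $ k)) * (expvec y $ k / expvec y $ i))" for i j
    by (intro Ck_on_bilinear[OF W S bounded_bilinear_mult] Ck_on_inverse[OF W S D(1)] n Ck_on_const)
  hence r: "Ck_on W j S (\<lambda>x. ratio k y (Z x) i)" for i j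
    by (simp add: ratio_def divide_inverse)
  have ln: "Ck_on W j S (\<lambda>x. Ln (ratio k y (Z x) i))" for i
  proof (rule Ck_on_Ln[OF W S _ r])
    fix x assume "x \<in> S"
    from D(2)[OF this, of i] show "ratio k y (Z x) i \<notin> \<real>\<^sub>\<le>\<^sub>0" by (simp add: complex_nonpos_Reals_iff)
  qed
  have "Ck_on W j S (\<lambda>x. y + (\<chi> i. 2 * Re (Ln (ratio k y (Z x) i)), \<chi> i. 2 * Im (Ln (ratio k y (Z x) i))))"
    by (intro Ck_on_add Ck_on_const Ck_on_Pair Ck_on_vec)
      (simp_all add: Ck_on_bounded_linear_compose[OF bounded_linear_mult_right] Ck_on_bounded_linear_compose[OF bounded_linear_Re ln] Ck_on_bounded_linear_compose[OF bounded_linear_Im ln])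
  thus ?thesis by (simp add: lift_def)
qed

text \<open>
  Near a line, the inverse of a chart of the quotient after the projective chart is
  \<^const>\<open>lift\<close>, which is smooth because it is a branch of the logarithm.  The lift stays in the domain \<open>U\<close> of the
  quotient chart near the given point by continuity, and there the orbit map is injective.
\<close>

lemma tau_orbit_smooth:
  "smooth_map units_kahler (orbit_space :: ('n::finite tvec set, 'n tvec) kahler) tau_orbit"
  unfolding smooth_map_def
proof (intro conjI ballI, goal_cases)
  case 1
  have "tau_orbit L \<in> orbit ` TP" if L: "L \<in> cproj_units" for L :: "'n cproj"
  proof -
    obtain x where "x \<in> TP" "L = tau x" using L unfolding tau_image[symmetric] by blast
    thus ?thesis by (simp add: tau_orbit)
  qed
  then show ?case by (auto simp: units_kahler_simps quotient_simps)
next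
  case (2 \<kappa>)
  obtain u :: "complex^'n" where u: "norm u = 1" "\<kappa> = (unit_dom u, unit_chart_map u, perp u)"
    using 2(1) by (auto simp: units_kahler_simps)
  show ?case unfolding u(2) prod.case
  proof (intro ballI, goal_cases)
  case (1 \<kappa>')
  obtain U k where k: "\<kappa>' = (orbit ` U, theta_map k \<circ> inv_into U orbit, model k)"
    "U \<subseteq> TP" "openin (top_of_set (model k)) (theta_map k ` U)" "inj_on orbit U"
    using 1 unfolding quotient_simps by blast
  define f where "f = (theta_map k \<circ> inv_into U orbit) \<circ> tau_orbit \<circ> inv_into (unit_dom u) (unit_chart_map u)"
  define S where "S = unit_chart_map u ` (unit_dom u \<inter> tau_orbit -` (orbit ` U))"
  have S: "\<xi> \<in> S \<longleftrightarrow> \<xi> \<in> unit_image u \<and> line (u + \<xi>) \<in> tau ` U" for \<xi>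
  proof -
    have *: "tau_orbit L \<in> orbit ` U \<longleftrightarrow> L \<in> tau ` U" if L: "L \<in> cproj_units" for L
    proof -
      obtain x where x: "x \<in> TP" "L = tau x" using L unfolding tau_image[symmetric] by blast
      show ?thesis unfolding x(2) tau_orbit[OF x(1)] image_iff using k(2) orbit_eq_iff[OF x(1)] by blast
    qed
    show ?thesis
    proof
      assume "\<xi> \<in> S"
      then obtain L where L: "L \<in> unit_dom u" "tau_orbit L \<in> orbit ` U" "\<xi> = unit_chart_map u L" by (auto simp: S_def)
      thus "\<xi> \<in> unit_image u \<and> line (u + \<xi>) \<in> tau ` U"
        using unit_dom_cases[OF u(1) L(1)] *[OF unit_dom_units[OF L(1)]] by simp
    next
      assume x: "\<xi> \<in> unit_image u \<and> line (u + \<xi>) \<in> tau ` U"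
      hence "line (u + \<xi>) \<in> unit_dom u" "unit_chart_map u (line (u + \<xi>)) = \<xi>"
        using line_unit_image[OF u(1)] unit_chart_map_line_image[OF u(1)] by auto
      thus "\<xi> \<in> S" using x *[OF unit_dom_units] unfolding S_def by (intro image_eqI[of _ _ "line (u + \<xi>)"]) auto
    qed
  qed
  obtain V where V: "open V" "U = TP \<inter> V"
  proof -
    have "openin (top_of_set TP) (TP \<inter> theta_map k -` (theta_map k ` U))"
      by (rule continuous_openin_preimage[OF continuous_on_theta_map _ k(3)]) (auto simp: theta_map_image[symmetric])
    moreover have "TP \<inter> theta_map k -` (theta_map k ` U) = U"
      using k(2) theta_map_inj by (auto simp: inj_on_def) blast
    ultimately show thesis using that by (auto simp: openin_open)
  qed
  \<comment> \<open>near a point of \<open>S\<close> the inverse is a branch of the logarithm\<close>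
  have loc: "\<exists>A y. open A \<and> \<xi>0 \<in> A \<and> (\<forall>\<xi>\<in>A \<inter> perp u. \<xi> \<in> S \<and> (\<forall>i. (u + \<xi>) $ i \<noteq> 0) \<and>
      (\<forall>i. Re (ratio k y (u + \<xi>) i) > 0) \<and> f \<xi> = reduce k (lift k y (u + \<xi>)))" if \<xi>0: "\<xi>0 \<in> S" for \<xi>0
  proof -
    from \<xi>0 obtain x0 where x0: "\<xi>0 \<in> unit_image u" "x0 \<in> U" "line (u + \<xi>0) = tau x0" unfolding S by blast
    obtain y where y: "x0 = of_coords y" using x0(2) k(2) TP_cases by blast
    have "line (expvec y) = line (u + \<xi>0)" using x0(3) by (simp add: y tau_of_coords)
    from line_eqD[OF expvec_nonzero(2) unit_image_nonzero[OF x0(1)] this]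
    obtain c where c: "c \<noteq> 0" "u + \<xi>0 = c *s expvec y" by blast
    have rat: "ratio k y (u + \<xi>0) i = 1" for i unfolding c(2) ratio_scale[OF c(1)] by (simp add: ratio_def)
    have l0: "lift k y (u + \<xi>0) = y" by (simp add: lift_def rat zero_prod_def[symmetric] zero_vec_def[symmetric])
    define D where "D = {z :: complex^'n. (\<forall>i. z $ i \<noteq> 0) \<and> (\<forall>i. Re (ratio k y z i) > 0)}"
    have D: "open D" unfolding D_def by (rule open_ratio_pos)
    have oD: "open ((\<lambda>\<xi>. u + \<xi>) -` D)" by (intro open_vimage D continuous_intros)
    have cl: "continuous_on ((\<lambda>\<xi>. u + \<xi>) -` D) (\<lambda>\<xi>. of_coords (lift k y (u + \<xi>)))"
      by (rule continuous_on_compose2[OF continuous_on_of_coords[of UNIV]],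
          rule continuous_on_compose2[OF continuous_on_lift[of k y]])
        (auto intro!: continuous_intros simp: D_def)
    define A where "A = (\<lambda>\<xi>. u + \<xi>) -` D \<inter> (\<lambda>\<xi>. of_coords (lift k y (u + \<xi>))) -` V"
    have "open A" unfolding A_def by (rule continuous_open_preimage[OF cl oD V(1)])
    moreover have "\<xi>0 \<in> A"
      using x0(1,2) V(2) by (simp add: A_def D_def rat l0 y[symmetric] unit_image_def)
    moreover have "\<xi> \<in> S \<and> (\<forall>i. (u + \<xi>) $ i \<noteq> 0) \<and> (\<forall>i. Re (ratio k y (u + \<xi>) i) > 0) \<and> f \<xi> = reduce k (lift k y (u + \<xi>))"
      if \<xi>: "\<xi> \<in> A \<inter> perp u" for \<xi>
    proof -
      have nz: "\<And>i. (u + \<xi>) $ i \<noteq> 0" and re: "\<And>i. Re (ratio k y (u + \<xi>) i) > 0"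
        using \<xi> by (auto simp: A_def D_def)
      have im: "\<xi> \<in> unit_image u" using \<xi> nz by (simp add: unit_image_def)
      define x where "x = of_coords (lift k y (u + \<xi>))"
      have xU: "x \<in> U" using \<xi> V(2) by (simp add: A_def x_def of_coords_in_TP)
      have tx: "tau x = line (u + \<xi>)" unfolding x_def by (rule tau_lift[OF nz])
      have "\<xi> \<in> S" unfolding S using im xU tx by (metis image_eqI)
      moreover have "f \<xi> = reduce k (lift k y (u + \<xi>))"
      proof -
        have "f \<xi> = theta_map k (inv_into U orbit (tau_orbit (line (u + \<xi>))))"
          by (simp add: f_def inv_into_unit_chart_map[OF u(1) im])
        also have "tau_orbit (line (u + \<xi>)) = orbit x" unfolding tx[symmetric] using xU k(2) tau_orbit by blast
        also have "inv_into U orbit (orbit x) = x" by (rule inv_into_f_f[OF k(4) xU])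
        finally show ?thesis by (simp add: x_def theta_map_of_coords)
      qed
      ultimately show ?thesis using nz re by blast
    qed
    ultimately show ?thesis by blast
  qed
  have Sp: "S \<subseteq> perp u" using S by (auto simp: unit_image_def)
  have oS: "openin (top_of_set (perp u)) S"
  proof (subst openin_subopen, intro ballI)
    fix \<xi>0 assume "\<xi>0 \<in> S"
    from loc[OF this] obtain A y where A: "open A" "\<xi>0 \<in> A" "\<forall>\<xi>\<in>A \<inter> perp u. \<xi> \<in> S" by blast
    show "\<exists>T. openin (top_of_set (perp u)) T \<and> \<xi>0 \<in> T \<and> T \<subseteq> S"
      by (rule exI[of _ "perp u \<inter> A"]) (use A Sp \<open>\<xi>0 \<in> S\<close> in \<open>auto intro: openin_open_Int\<close>)
  qed
  have "Ck_on (perp u) j S f" for j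
  proof (rule Ck_on_local[OF subspace_perp oS])
    fix \<xi>0 assume "\<xi>0 \<in> S"
    from loc[OF this] obtain A y where A: "open A" "\<xi>0 \<in> A"
      "\<forall>\<xi>\<in>A \<inter> perp u. \<xi> \<in> S \<and> (\<forall>i. (u + \<xi>) $ i \<noteq> 0) \<and> (\<forall>i. Re (ratio k y (u + \<xi>) i) > 0) \<and> f \<xi> = reduce k (lift k y (u + \<xi>))"
      by blast
    have o: "openin (top_of_set (perp u)) (S \<inter> A)" using oS A(1) by (rule openin_Int_open)
    have A': "(u + \<xi>) $ i \<noteq> 0" "Re (ratio k y (u + \<xi>) i) > 0" "f \<xi> = reduce k (lift k y (u + \<xi>))" if "\<xi> \<in> S \<inter> A" for \<xi> i
      using A(3) that Sp by blast+
    have "Ck_on (perp u) j (S \<inter> A) f"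
    proof (rule Ck_on_cong[OF subspace_perp o])
      show "Ck_on (perp u) j (S \<inter> A) (\<lambda>\<xi>. reduce k (lift k y (u + \<xi>)))"
        by (intro Ck_on_bounded_linear_compose[OF bounded_linear_reduce] Ck_on_lift[OF subspace_perp o] A'
            Ck_on_add Ck_on_const Ck_on_bounded_linear bounded_linear_ident)
    qed (simp add: A'(3))
    with A(1,2) show "\<exists>A. open A \<and> \<xi>0 \<in> A \<and> Ck_on (perp u) j (S \<inter> A) f" by blast
  qed
  with oS show ?case unfolding k(1) prod.case by (simp add: S_def f_def smooth_on_def)
  qed
qed

lemma orbit_tau_diff_map: "diff_map (orbit_space :: ('n::finite tvec set, 'n tvec) kahler) units_kahler orbit_tau"
  by (rule smooth_map_imp_diff_map[OF quotient_atlas orbit_tau_smooth])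

lemma tau_orbit_diff_map: "diff_map units_kahler (orbit_space :: ('n::finite tvec set, 'n tvec) kahler) tau_orbit"
  by (rule smooth_map_imp_diff_map[OF units_atlas tau_orbit_smooth])

text \<open>
  The chart changes of the quotient factor through the projective space.
\<close>

lemma quotient_diff_manifold: "diff_manifold (orbit_space :: ('n::finite tvec set, 'n tvec) kahler)"
proof -
  have "diff_map (orbit_space :: ('n tvec set, 'n tvec) kahler) orbit_space (\<lambda>x. x)"
    by (rule diff_map_cong[OF quotient_atlas diff_map_compose[OF quotient_atlas units_atlas orbit_tau_diff_map tau_orbit_diff_map]])
      (auto simp: quotient_simps orbit_tau tau_orbit)
  thus ?thesis by (simp add: diff_manifold_def quotient_atlas)
qed

lemma orbit_diff_map: "diff_map TP_kahler (orbit_space :: ('n::finite tvec set, 'n tvec) kahler) orbit"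
  by (rule diff_map_cong[OF TP_atlas diff_map_compose[OF TP_atlas units_atlas tau_diff_map tau_orbit_diff_map]])
    (simp add: tau_orbit)

abbreviation orbit_push :: "'n::finite tvec set tangent \<Rightarrow> 'n cproj tangent" where
  "orbit_push \<equiv> pushforward units_kahler orbit_tau"

abbreviation quotient_push :: "'n::finite tvec tangent \<Rightarrow> 'n tvec set tangent" where
  "quotient_push \<equiv> pushforward orbit_space orbit"

lemma push_orbit_tau_orbit:
  assumes A: "A \<in> tangent_space TP_kahler x"
  shows "orbit_push (quotient_push A) = tau_push A"
proof -
  have "orbit_push (quotient_push A) = pushforward units_kahler (orbit_tau \<circ> orbit) A"
    by (rule pushforward_compose[OF TP_diff_manifold quotient_diff_manifold units_diff_manifold orbit_diff_map orbit_tau_diff_map A])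
  also have "\<dots> = tau_push A"
    by (rule pushforward_cong[OF TP_diff_manifold units_diff_manifold tau_diff_map _ A, symmetric]) (simp add: orbit_tau)
  finally show ?thesis .
qed

lemma push_tau_orbit_orbit_tau:
  fixes X :: "('n::finite tvec set) tangent"
  assumes X: "X \<in> tangent_space orbit_space O'"
  shows "pushforward orbit_space tau_orbit (orbit_push X) = X"
proof -
  have "pushforward orbit_space tau_orbit (orbit_push X) = pushforward orbit_space (tau_orbit \<circ> orbit_tau) X"
    by (rule pushforward_compose[OF quotient_diff_manifold units_diff_manifold quotient_diff_manifold orbit_tau_diff_map tau_orbit_diff_map X])
  also have "\<dots> = pushforward orbit_space (\<lambda>x. x) X"
    by (rule pushforward_cong[OF quotient_diff_manifold quotient_diff_manifold diff_map_compose[OF quotient_atlas units_atlas orbit_tau_diff_map tau_orbit_diff_map] _ X])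
      (auto simp: quotient_simps orbit_tau tau_orbit)
  also have "\<dots> = X" by (rule pushforward_id[OF quotient_diff_manifold X])
  finally show ?thesis .
qed

text \<open>
  Tangent vectors of the quotient are lifted by passing to the projective space, where the covering map is known to be
  surjective on tangent spaces.
\<close>

lemma push_orbit_surj:
  fixes X :: "('n::finite tvec set) tangent"
  assumes x: "x \<in> TP" and X: "X \<in> tangent_space orbit_space (orbit x)"
  obtains A where "A \<in> tangent_space TP_kahler x" "quotient_push A = X"
proof -
  have "orbit_push X \<in> tangent_space units_kahler (tau x)"
    using pushforward_in_tangent_space[OF quotient_diff_manifold units_diff_manifold orbit_tau_diff_map X] by (simp add: orbit_tau[OF x])
  from tau_push_surj[OF x this] obtain A where A: "A \<in> tangent_space TP_kahler x" "tau_push A = orbit_push X" .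
  have "quotient_push A
      = pushforward orbit_space tau_orbit (orbit_push (quotient_push A))"
    by (rule push_tau_orbit_orbit_tau[OF pushforward_in_tangent_space[OF TP_diff_manifold quotient_diff_manifold orbit_diff_map A(1)], symmetric])
  also have "\<dots> = pushforward orbit_space tau_orbit (orbit_push X)"
    unfolding push_orbit_tau_orbit[OF A(1)] A(2) ..
  also have "\<dots> = X" by (rule push_tau_orbit_orbit_tau[OF X])
  finally have "quotient_push A = X" .
  with A(1) show thesis using that by blast
qed

text \<open>
  The covering map is the induced map after the orbit map, so all lifts of two tangent vectors of the
  quotient give the metric, symplectic form and complex structure of their images in the projective space.
  This shows at once that the tensors descend and that they are preserved.
\<close>

proposition orbit_tau_kahler_iso:
  "kahler_iso (orbit_space :: ('n::finite tvec set, 'n tvec) kahler) units_kahler orbit_tau"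
  unfolding kahler_iso_def
proof (intro conjI ballI)
  show "diffeo orbit_space units_kahler orbit_tau"
    using orbit_tau_bij orbit_tau_smooth tau_orbit_smooth by (simp add: diffeo_def quotient_simps units_kahler_simps tau_orbit_def)
  fix O' X assume O': "O' \<in> points orbit_space" and X: "X \<in> tangent_space orbit_space O'"
  obtain x where x: "x \<in> TP" "O' = orbit x" using O' unfolding quotient_simps by blast
  obtain A where A: "A \<in> tangent_space TP_kahler x" "quotient_push A = X" using push_orbit_surj[OF x(1) X[unfolded x(2)]] .
  { fix Y assume Y: "Y \<in> tangent_space orbit_space O'"
    obtain B where B: "B \<in> tangent_space TP_kahler x" "quotient_push B = Y" using push_orbit_surj[OF x(1) Y[unfolded x(2)]] .
    let ?X = "orbit_push X" and ?Y = "orbit_push Y"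
    have *: "metric TP_kahler A' B' = metric units_kahler ?X ?Y" "symp TP_kahler A' B' = symp units_kahler ?X ?Y"
      if "A' \<in> tangent_space TP_kahler x'" "B' \<in> tangent_space TP_kahler x'" "quotient_push A' = X" "quotient_push B' = Y" for x' A' B'
      using tau_push_isometry[OF that(1,2)] push_orbit_tau_orbit[OF that(1)] push_orbit_tau_orbit[OF that(2)] that(3,4) by simp_all
    have "metric orbit_space X Y = metric units_kahler ?X ?Y"
      unfolding quotient_simps(3) by (rule the_equality) (use * x(1) A B in \<open>metis\<close>)+
    thus "metric units_kahler ?X ?Y = metric orbit_space X Y" ..
    have "symp orbit_space X Y = symp units_kahler ?X ?Y"
      unfolding quotient_simps(4) by (rule the_equality) (use * x(1) A B in \<open>metis\<close>)+
    thus "symp units_kahler ?X ?Y = symp orbit_space X Y" .. }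
  let ?X = "orbit_push X"
  have push: "orbit_push (quotient_push (cplx TP_kahler A')) = cplx units_kahler ?X"
    if "A' \<in> tangent_space TP_kahler x'" "quotient_push A' = X" for x' A'
    using push_orbit_tau_orbit[OF cplx_TP_tangent[OF that(1)]] tau_push_cplx[OF that(1)] push_orbit_tau_orbit[OF that(1)] that(2) by simp
  have "cplx orbit_space X = quotient_push (cplx TP_kahler A)"
    unfolding quotient_simps(5)
  proof (rule the_equality)
    show "\<exists>x\<in>TP. \<exists>A'\<in>tangent_space TP_kahler x. quotient_push A' = X \<and> quotient_push (cplx TP_kahler A) = quotient_push (cplx TP_kahler A')"
      using x(1) A by blast
  next
    fix Y assume "\<exists>x\<in>TP. \<exists>A\<in>tangent_space TP_kahler x. quotient_push A = X \<and> Y = quotient_push (cplx TP_kahler A)"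
    then obtain x' A' where A': "A' \<in> tangent_space TP_kahler x'" "quotient_push A' = X" "Y = quotient_push (cplx TP_kahler A')" by blast
    have t: "quotient_push (cplx TP_kahler B) \<in> tangent_space orbit_space (orbit z)" if "B \<in> tangent_space TP_kahler z" for B z
      by (rule pushforward_in_tangent_space[OF TP_diff_manifold quotient_diff_manifold orbit_diff_map cplx_TP_tangent[OF that]])
    have "Y = pushforward orbit_space tau_orbit (cplx units_kahler ?X)"
      unfolding A'(3) push[OF A'(1,2), symmetric] by (rule push_tau_orbit_orbit_tau[OF t[OF A'(1)], symmetric])
    also have "\<dots> = quotient_push (cplx TP_kahler A)"
      unfolding push[OF A, symmetric] by (rule push_tau_orbit_orbit_tau[OF t[OF A(1)]])
    finally show "Y = quotient_push (cplx TP_kahler A)" .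
  qed
  thus "orbit_push (cplx orbit_space X) = cplx units_kahler ?X" using push[OF A] by simp
qed

lemma canonical_proj_orbit: "x \<in> TP \<Longrightarrow> canonical_proj (orbit x) = fst x"
proof -
  assume x: "x \<in> TP"
  have "fst (translate m x) = fst x" for m
    using x by (elim TP_cases) (simp add: translate_of_coords, simp add: of_coords_def)
  moreover have "x \<in> orbit x" unfolding mem_orbit_iff using translate_zero[OF x] lattice_zero by metis
  ultimately have "fst ` orbit x = {fst x}"
  proof (intro equalityI subsetI)
    fix p assume "p \<in> fst ` orbit x"
    then obtain m where "p = fst (translate m x)" unfolding image_iff Bex_def mem_orbit_iff by blast
    thus "p \<in> {fst x}" using \<open>\<And>m. fst (translate m x) = fst x\<close> by simp
  qed blast
  thus ?thesis by (simp add: canonical_proj_def)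
qed

text \<open>
  The unit representative of the line is \<open>z\<close> divided by its norm, up to a phase.
\<close>

lemma base_point_of_line:
  assumes x: "x \<in> TP" and z: "tau x = line z" "z \<noteq> 0"
  shows "complex_of_real (fst x $ k) = z $ k * cnj (z $ k) / herm z z"
proof -
  have "unit_rep (line z) \<noteq> 0" using unit_rep(1)[of "line z"] by auto
  from line_eqD[OF z(2) this unit_rep(2)[symmetric]] obtain c where c: "c \<noteq> 0" "unit_rep (line z) = c *s z" by blast
  have "cmod c * norm z = 1" using unit_rep(1)[of "line z"] by (simp add: c(2) norm_vec_complex_scale)
  hence n: "(cmod c)\<^sup>2 = 1 / (norm z)\<^sup>2" using z(2) by (simp add: power_divide field_simps flip: power_mult_distrib)
  have "fst x $ k = (cmod c)\<^sup>2 * (cmod (z $ k))\<^sup>2"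
    using unit_rep_tau(1)[OF x, of k] by (simp add: z(1) c(2) norm_mult power_mult_distrib)
  thus ?thesis by (simp add: n herm_self complex_norm_square[symmetric])
qed

theorem proposition7p4:
  "let N = (TP_kahler :: ('n::finite tvec, 'n tvec) kahler);
       P = rescale 4 (open_submanifold (fubini_study :: ('n cproj, complex^'n) kahler) cproj_units);
       \<Gamma> = Gamma_group N
   in covering_space (points N) tau (points P) \<and> simply_connected (points N) \<and>
      subgroup \<Gamma> (BijGroup (points N)) \<and>
      \<Gamma> = deck_group (points N) (tau :: 'n tvec \<Rightarrow> 'n cproj) \<and>
      discrete_group (points N) \<Gamma> \<and> acts_freely (points N) \<Gamma> \<and> acts_properly (points N) \<Gamma> \<and>
      (\<exists>\<Phi>. (\<forall>a\<in>points N. \<Phi> (orbit_of \<Gamma> a) = tau a) \<and>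
           kahler_iso (kahlerification N) P \<Phi> \<and>
           (\<forall>z :: complex^'n. (\<forall>i. z $ i \<noteq> 0) \<longrightarrow>
              (let p = canonical_proj (inv_into (points (kahlerification N)) \<Phi> (line z))
               in p \<in> prob_pos \<and>
                  (\<forall>k. complex_of_real (p $ k) = z $ k * cnj (z $ k) / herm z z))))"
proof -
  have proj: "canonical_proj (inv_into (orbit ` TP) orbit_tau (line z)) \<in> prob_pos \<and>
      (\<forall>k. complex_of_real (canonical_proj (inv_into (orbit ` TP) orbit_tau (line z)) $ k) = z $ k * cnj (z $ k) / herm z z)"
    if z: "\<forall>i. z $ i \<noteq> 0" for z :: "complex^'n"
  proof -
    have z0: "z \<noteq> 0" using z by (intro all_nonzero_imp_nonzero) auto
    have "line z \<in> cproj_units" using line_in_units_iff[OF z0] z by blast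
    then obtain x where x: "x \<in> TP" "tau x = line z" unfolding tau_image[symmetric] by force
    have "inv_into (orbit ` TP) orbit_tau (line z) = orbit x" using tau_orbit[OF x(1)] by (simp add: tau_orbit_def x(2))
    thus ?thesis using canonical_proj_orbit[OF x(1)] base_point_of_line[OF x z0] x(1) by (simp add: TP_iff)
  qed
  have "\<exists>\<Phi>. (\<forall>a\<in>(TP :: 'n tvec set). \<Phi> (orbit a) = tau a) \<and>
           kahler_iso (kahlerification TP_kahler) units_kahler \<Phi> \<and>
           (\<forall>z :: complex^'n. (\<forall>i. z $ i \<noteq> 0) \<longrightarrow>
              (let p = canonical_proj (inv_into (points (kahlerification TP_kahler)) \<Phi> (line z))
               in p \<in> prob_pos \<and>
                  (\<forall>k. complex_of_real (p $ k) = z $ k * cnj (z $ k) / herm z z)))"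
    by (intro exI[of _ orbit_tau] conjI ballI orbit_tau orbit_tau_kahler_iso) (use proj in \<open>auto simp: Let_def quotient_simps(1)\<close>)
  moreover have "subgroup (Gamma_group TP_kahler) (BijGroup (TP :: 'n tvec set))"
    "discrete_group (TP :: 'n tvec set) (Gamma_group TP_kahler)" "acts_freely (TP :: 'n tvec set) (Gamma_group TP_kahler)"
    "acts_properly (TP :: 'n tvec set) (Gamma_group TP_kahler)"
    unfolding Gamma_eq by (rule subgroup_translations discrete_translations free_translations proper_translations)+
  ultimately show ?thesis
    unfolding Let_def units_kahler_def[symmetric] units_kahler_simps(1) TP_kahler_simps(1)
    by (intro conjI tau_covering_space simply_connected_TP Gamma_eq_deck_group)
qed

end
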